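(* There exists a locally compact subspace $X$ of the plane $\mathbb{R}^2$ which is acyclic with respect to Čech homology and whose fine coverings are all nonacyclic; that is, $X$ is acyclic with respect to Čech homology, and there exists an open covering $\mathcal{U}$ of $X$ such that for every open covering $\mathcal{V}$ of $X$ refining $\mathcal{U}$ the homology of the nerve $\mathcal{N}(\mathcal{V})$ is not isomorphic to the homology of a point.
   Context: All homology is with integer coefficients. An open covering of a (not necessarily compact) space $X$ is a (possibly infinite) system of open subsets of $X$ whose union is $X$. The nerve $\mathcal{N}(\mathcal{V})$ of a covering $\mathcal{V}$ is the simplicial complex whose vertices are the nonempty elements of $\mathcal{V}$, in which finitely many elements span a simplex if and only if their intersection is nonempty. Čech homology of $X$ is the inverse limit $\check H_k(X)=\varprojlim_{\mathcal{U}} H_k(\mathcal{N}(\mathcal{U});\mathbb{Z})$ over all open coverings $\mathcal{U}$ of $X$ directed by refinement, with the homomorphisms induced by refinement. $X$ is acyclic with respect to Čech homology if $\check H_*(X)$ is the same as that of a point, i.e. $\check H_0(X)\cong\mathbb{Z}$ and $\check H_k(X)=0$ for $k\geq 1$. A space admits fine acyclic coverings if every open covering $\mathcal{U}$ has an open refinement $\mathcal{V}$ whose nerve has the homology of a point; "all fine coverings are nonacyclic" means that this fails. *)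

theory Defs
  imports "HOL-Analysis.Analysis" "HOL-Algebra.Free_Abelian_Groups"
begin

section \<open>Simplicial homology with integer coefficients\<close>

text \<open>
  An abstract simplicial complex is represented by the set of its simplices, a family of
  nonempty finite sets of vertices. Its homology is that of the ordered chain complex (as in
  Eilenberg--Steenrod, Chapter VI, or Spanier, Chapter 4): an ordered p-simplex of K is a list of
  p + 1 vertices, repetitions allowed, whose set of entries is a simplex of K. This chain complex
  is functorial without any choice of vertex orderings and is canonically chain equivalent to the
  oriented one.
\<close>

definition ordered_simplex_set :: "nat \<Rightarrow> 'v set set \<Rightarrow> 'v list set"
  where "ordered_simplex_set p K = {xs. length xs = Suc p \<and> set xs \<in> K}"

definition simplicial_chain_group :: "nat \<Rightarrow> 'v set set \<Rightarrow> ('v list \<Rightarrow>\<^sub>0 int) monoid"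
  where "simplicial_chain_group p K = free_Abelian_group (ordered_simplex_set p K)"

definition list_face :: "nat \<Rightarrow> 'v list \<Rightarrow> 'v list"
  where "list_face i xs = take i xs @ drop (Suc i) xs"

definition simplicial_boundary :: "nat \<Rightarrow> ('v list \<Rightarrow>\<^sub>0 int) \<Rightarrow> ('v list \<Rightarrow>\<^sub>0 int)"
  where "simplicial_boundary p c =
    (if p = 0 then 0
     else frag_extend (\<lambda>xs. \<Sum>i\<le>p. frag_cmul ((-1) ^ i) (frag_of (list_face i xs))) c)"

definition simplicial_cycles :: "nat \<Rightarrow> 'v set set \<Rightarrow> ('v list \<Rightarrow>\<^sub>0 int) set"
  where "simplicial_cycles p K =
    {c \<in> carrier (simplicial_chain_group p K). simplicial_boundary p c = 0}"

definition simplicial_boundaries :: "nat \<Rightarrow> 'v set set \<Rightarrow> ('v list \<Rightarrow>\<^sub>0 int) set"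
  where "simplicial_boundaries p K =
    simplicial_boundary (Suc p) ` carrier (simplicial_chain_group (Suc p) K)"

definition simplicial_cycle_group :: "nat \<Rightarrow> 'v set set \<Rightarrow> ('v list \<Rightarrow>\<^sub>0 int) monoid"
  where "simplicial_cycle_group p K =
    subgroup_generated (simplicial_chain_group p K) (simplicial_cycles p K)"

definition simplicial_homology_group :: "nat \<Rightarrow> 'v set set \<Rightarrow> ('v list \<Rightarrow>\<^sub>0 int) set monoid"
  where "simplicial_homology_group p K =
    simplicial_cycle_group p K Mod simplicial_boundaries p K"

definition simplicial_chain_map :: "('v \<Rightarrow> 'w) \<Rightarrow> ('v list \<Rightarrow>\<^sub>0 int) \<Rightarrow> ('w list \<Rightarrow>\<^sub>0 int)"
  where "simplicial_chain_map \<phi> = frag_extend (\<lambda>xs. frag_of (map \<phi> xs))"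

text \<open>
  The homomorphism induced by a simplicial map \<open>\<phi>\<close> into L. A homology class A is a coset, and all
  its members c yield the same coset on the right-hand side, so that the union is the class of
  the image of any representative.
\<close>

definition simplicial_hom_induced ::
    "nat \<Rightarrow> 'w set set \<Rightarrow> ('v \<Rightarrow> 'w) \<Rightarrow> ('v list \<Rightarrow>\<^sub>0 int) set \<Rightarrow> ('w list \<Rightarrow>\<^sub>0 int) set"
  where "simplicial_hom_induced p L \<phi> A =
    (\<Union>c\<in>A. simplicial_boundaries p L #>\<^bsub>simplicial_cycle_group p L\<^esub> simplicial_chain_map \<phi> c)"

definition has_homology_of_point :: "(nat \<Rightarrow> 'g monoid) \<Rightarrow> bool"
  where "has_homology_of_point H \<longleftrightarrow> H 0 \<cong> integer_group \<and> (\<forall>k\<ge>1. trivial_group (H k))"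

section \<open>Coverings, nerves and Cech homology\<close>

definition open_covering :: "'a topology \<Rightarrow> 'a set set \<Rightarrow> bool"
  where "open_covering X \<U> \<longleftrightarrow> (\<forall>U\<in>\<U>. openin X U) \<and> \<Union>\<U> = topspace X"

definition covering_refines :: "'a set set \<Rightarrow> 'a set set \<Rightarrow> bool"
  where "covering_refines \<V> \<U> \<longleftrightarrow> (\<forall>V\<in>\<V>. \<exists>U\<in>\<U>. V \<subseteq> U)"

definition nerve :: "'a set set \<Rightarrow> 'a set set set"
  where "nerve \<V> = {\<sigma>. finite \<sigma> \<and> \<sigma> \<noteq> {} \<and> \<sigma> \<subseteq> \<V> - {{}} \<and> \<Inter>\<sigma> \<noteq> {}}"

definition nerve_homology :: "nat \<Rightarrow> 'a set set \<Rightarrow> ('a set list \<Rightarrow>\<^sub>0 int) set monoid"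
  where "nerve_homology k \<V> = simplicial_homology_group k (nerve \<V>)"

definition refinement_projection :: "'a set set \<Rightarrow> 'a set set \<Rightarrow> ('a set \<Rightarrow> 'a set) \<Rightarrow> bool"
  where "refinement_projection \<V> \<U> \<phi> \<longleftrightarrow> (\<forall>V\<in>\<V>. \<phi> V \<in> \<U> \<and> V \<subseteq> \<phi> V)"

text \<open>
  Every refinement admits a projection, and any two projections are contiguous, hence induce the
  same homomorphism on homology. The compatibility condition below may therefore be required for
  all projections.
\<close>

definition cech_homology_group ::
    "nat \<Rightarrow> 'a topology \<Rightarrow> ('a set set \<Rightarrow> ('a set list \<Rightarrow>\<^sub>0 int) set) monoid"
  where "cech_homology_group k X =
    (let P = product_group {\<U>. open_covering X \<U>} (nerve_homology k)
     in P\<lparr>carrier := {a \<in> carrier P. \<forall>\<U> \<V> \<phi>. open_covering X \<U> \<and> open_covering X \<V> \<and>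
            covering_refines \<V> \<U> \<and> refinement_projection \<V> \<U> \<phi> \<longrightarrow>
            simplicial_hom_induced k (nerve \<U>) \<phi> (a \<V>) = a \<U>}\<rparr>)"

definition cech_acyclic :: "'a topology \<Rightarrow> bool"
  where "cech_acyclic X \<longleftrightarrow> has_homology_of_point (\<lambda>k. cech_homology_group k X)"

end

theory Submission
  imports Defs
begin

text \<open>
  The space is a curve that oscillates infinitely often between the heights 0 and 1 while approaching
  the vertical axis, together with only half of its limit segment, the half-open arc
  \<open>{0} \<times> [0, 1/2)\<close>. In a fine covering, all but finitely many oscillations are joined to this arc, so
  the first homology of the nerve is a nonzero direct sum over the late oscillations. Refining the
  covering detaches more and more oscillations, so a compatible family of classes, each being a finite
  sum, has to vanish. Higher homology vanishes already for a cofinal set of coverings,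
  whose nerves are reduced by removing vertices with conical links.
\<close>

section \<open>The augmented ordered chain complex\<close>

text \<open>Leaving the height 1/2 out of the limit arc makes the space open in a closed set, hence
  locally compact. It also means that a covering may become arbitrarily fine towards the missing
  end, so both the thickness and the reach of the basic sets along the arc depend on their height.
  Such a basic set meets infinitely many turns of the curve, so intersections are disconnected and
  no nerve lemma applies. The nerve is instead dismantled vertex by vertex: the link of a limit set
  is a cone, because a lower limit set, at least as thick and reaching at least as many turns, can
  be added to each of its simplices. Cycles are finite, which reduces infinite nerves to finite
  families closed under this choice of apex. The curve has height 1/2 exactly at the half-integers;
  arcs are confined to windows around integers and around half-integers, so that nerves can be cut
  there. A class of degree 1 is killed by a refinement chosen after the class: its limit sets start
  beyond the last arc that a representing cycle uses. Nontriviality is detected by a cocycle that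
  sees one late oscillation.\<close>

definition cone_chain :: "'v \<Rightarrow> ('v list \<Rightarrow>\<^sub>0 int) \<Rightarrow> ('v list \<Rightarrow>\<^sub>0 int)"
  where "cone_chain v = frag_extend (\<lambda>xs. frag_of (v # xs))"

text \<open>The alternating sum of faces in the recursive form \<partial>(x s) = s - x \<partial>s,
  suited to induction. A one-vertex list has the empty list as its boundary: this is the
  augmentation.\<close>

primrec list_bd :: "'v list \<Rightarrow> ('v list \<Rightarrow>\<^sub>0 int)"
  where
    "list_bd [] = 0"
  | "list_bd (x # xs) = frag_of xs - cone_chain x (list_bd xs)"

definition aug_bd :: "('v list \<Rightarrow>\<^sub>0 int) \<Rightarrow> ('v list \<Rightarrow>\<^sub>0 int)"
  where "aug_bd = frag_extend list_bd"

text \<open>The index counts vertices, so it is the dimension plus one. \<open>insert {}\<close>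
  admits the empty list, which occurs only for n = 0 and spans the augmentation group.\<close>

definition aug_chains :: "nat \<Rightarrow> 'v set set \<Rightarrow> ('v list \<Rightarrow>\<^sub>0 int) set"
  where "aug_chains n K = {c. \<forall>xs\<in>Poly_Mapping.keys c. length xs = n \<and> set xs \<in> insert {} K}"

text \<open>Vanishing of reduced homology in dimension n - 1: n = 0 says that there is a vertex, n =
  1 that there is at most one component, and n \<ge> 2 concerns the usual homology.\<close>

definition aug_acyclic :: "nat \<Rightarrow> 'v set set \<Rightarrow> bool"
  where "aug_acyclic n K \<longleftrightarrow>
    (\<forall>c\<in>aug_chains n K. aug_bd c = 0 \<longrightarrow> (\<exists>d\<in>aug_chains (Suc n) K. aug_bd d = c))"

definition subset_closed :: "'v set set \<Rightarrow> bool"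
  where "subset_closed K \<longleftrightarrow> (\<forall>\<sigma>\<in>K. \<forall>\<tau>. \<tau> \<subseteq> \<sigma> \<longrightarrow> \<tau> \<noteq> {} \<longrightarrow> \<tau> \<in> K)"

lemma cone_chain_simps [simp]:
  "cone_chain v 0 = 0"
  "cone_chain v (frag_of xs) = frag_of (v # xs)"
  "cone_chain v (a + b) = cone_chain v a + cone_chain v b"
  "cone_chain v (a - b) = cone_chain v a - cone_chain v b"
  "cone_chain v (- a) = - cone_chain v a"
  by (simp_all add: cone_chain_def frag_extend_add frag_extend_diff frag_extend_minus)

lemma aug_bd_simps [simp]:
  "aug_bd 0 = 0"
  "aug_bd (frag_of xs) = list_bd xs"
  "aug_bd (a + b) = aug_bd a + aug_bd b"
  "aug_bd (a - b) = aug_bd a - aug_bd b"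
  "aug_bd (- a) = - aug_bd a"
  by (simp_all add: aug_bd_def frag_extend_add frag_extend_diff frag_extend_minus)

lemma aug_bd_cone: "aug_bd (cone_chain v c) = c - cone_chain v (aug_bd c)"
proof -
  have "Poly_Mapping.keys c \<subseteq> UNIV" by simp
  then show ?thesis
    by (induction c rule: frag_induction) auto
qed

lemma aug_bd_list_bd: "aug_bd (list_bd xs) = 0"
  by (induction xs) (auto simp: aug_bd_cone)

lemma aug_bd_aug_bd: "aug_bd (aug_bd c) = 0"
proof -
  have "Poly_Mapping.keys c \<subseteq> UNIV" by simp
  then show ?thesis
    by (induction c rule: frag_induction) (auto simp: aug_bd_list_bd)
qed

lemma aug_chainsI: "(\<And>xs. xs \<in> Poly_Mapping.keys c \<Longrightarrow> length xs = n \<and> (set xs \<in> insert {} K)) \<Longrightarrow> c \<in> aug_chains n K"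
  by (auto simp: aug_chains_def)

lemma aug_chains_0 [simp]: "0 \<in> aug_chains n K"
  by (auto simp: aug_chains_def)

lemma aug_chains_add: "a \<in> aug_chains n K \<Longrightarrow> b \<in> aug_chains n K \<Longrightarrow> a + b \<in> aug_chains n K"
  using keys_add[of a b] by (auto simp: aug_chains_def)

lemma aug_chains_diff: "a \<in> aug_chains n K \<Longrightarrow> b \<in> aug_chains n K \<Longrightarrow> a - b \<in> aug_chains n K"
  using keys_diff[of a b] by (auto simp: aug_chains_def)

lemma aug_chains_minus: "a \<in> aug_chains n K \<Longrightarrow> - a \<in> aug_chains n K"
  by (auto simp: aug_chains_def)

lemma aug_chains_frag_of [simp]:
  "frag_of xs \<in> aug_chains n K \<longleftrightarrow> length xs = n \<and> (set xs \<in> insert {} K)"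
  by (simp add: aug_chains_def)

lemma aug_chains_mono: "K \<subseteq> L \<Longrightarrow> c \<in> aug_chains n K \<Longrightarrow> c \<in> aug_chains n L"
  by (auto simp: aug_chains_def)

lemma aug_chains_induct [consumes 1, case_names zero one diff]:
  assumes "c \<in> aug_chains n K" "P 0"
    "\<And>xs. length xs = n \<Longrightarrow> (set xs \<in> insert {} K) \<Longrightarrow> P (frag_of xs)"
    "\<And>a b. P a \<Longrightarrow> P b \<Longrightarrow> P (a - b)"
  shows "P c"
proof -
  have "Poly_Mapping.keys c \<subseteq> {xs. length xs = n \<and> (set xs \<in> insert {} K)}"
    using assms(1) by (auto simp: aug_chains_def)
  then show ?thesis
    by (induction c rule: frag_induction) (use assms in auto)
qed

lemma keys_cone_chain: "xs \<in> Poly_Mapping.keys (cone_chain v c) \<Longrightarrow> \<exists>ys\<in>Poly_Mapping.keys c. xs = v # ys"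
  using keys_frag_extend[of "\<lambda>xs. frag_of (v # xs)" c] by (auto simp: cone_chain_def)

lemma keys_list_bd:
  "ys \<in> Poly_Mapping.keys (list_bd xs) \<Longrightarrow> Suc (length ys) = length xs \<and> set ys \<subseteq> set xs"
proof (induction xs arbitrary: ys)
  case (Cons x xs)
  then have "ys = xs \<or> ys \<in> Poly_Mapping.keys (cone_chain x (list_bd xs))"
    using keys_diff[of "frag_of xs" "cone_chain x (list_bd xs)"] by auto
  then show ?case
    using Cons.IH by (force dest: keys_cone_chain)
qed simp

lemma keys_aug_bd:
  assumes "ys \<in> Poly_Mapping.keys (aug_bd c)"
  shows "\<exists>xs\<in>Poly_Mapping.keys c. Suc (length ys) = length xs \<and> set ys \<subseteq> set xs"
  using assms keys_frag_extend[of list_bd c] keys_list_bd unfolding aug_bd_def by blast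

lemma aug_bd_chains:
  assumes "subset_closed K" "c \<in> aug_chains (Suc n) K"
  shows "aug_bd c \<in> aug_chains n K"
proof (rule aug_chainsI)
  fix ys assume "ys \<in> Poly_Mapping.keys (aug_bd c)"
  then obtain xs where "xs \<in> Poly_Mapping.keys c" "Suc (length ys) = length xs" "set ys \<subseteq> set xs"
    using keys_aug_bd by blast
  then show "length ys = n \<and> (set ys \<in> insert {} K)"
    using assms unfolding aug_chains_def subset_closed_def
    by (metis (mono_tags, lifting) Suc_inject insert_iff mem_Collect_eq subset_empty)
qed

section \<open>Mayer-Vietoris splitting and cones\<close>

lemma aug_chains_split:
  assumes "c \<in> aug_chains n (K \<union> L)"
  obtains c1 c2 where "c = c1 + c2" "c1 \<in> aug_chains n K" "c2 \<in> aug_chains n L"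
proof -
  have "Poly_Mapping.keys c \<subseteq> {xs. length xs = n \<and> (set xs \<in> insert {} K)} \<union> {xs. length xs = n \<and> (set xs \<in> insert {} L)}"
    using assms by (auto simp: aug_chains_def)
  then obtain d e where "Poly_Mapping.keys d \<subseteq> {xs. length xs = n \<and> (set xs \<in> insert {} K)}"
    "Poly_Mapping.keys e \<subseteq> {xs. length xs = n \<and> (set xs \<in> insert {} L)}" "d + e = c"
    by (rule frag_split)
  then show ?thesis
    using that[of d e] by (auto simp: aug_chains_def)
qed

lemma aug_chains_Int:
  "c \<in> aug_chains n K \<Longrightarrow> c \<in> aug_chains n L \<Longrightarrow> c \<in> aug_chains n (K \<inter> L)"
  by (auto simp: aug_chains_def)

text \<open>The surjectivity step of the Mayer-Vietoris sequence: after any splitting, the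
  boundaries of the two parts are opposite, hence lie in the intersection. A filling there is moved
  from one part to the other and makes both parts cycles.\<close>

lemma aug_cycle_split:
  assumes K: "subset_closed K" and L: "subset_closed L"
    and c: "c \<in> aug_chains (Suc n) (K \<union> L)" "aug_bd c = 0" and ac: "aug_acyclic n (K \<inter> L)"
  obtains c1 c2 where "c = c1 + c2" "c1 \<in> aug_chains (Suc n) K" "aug_bd c1 = 0"
    "c2 \<in> aug_chains (Suc n) L" "aug_bd c2 = 0"
proof -
  obtain c1 c2 where c12: "c = c1 + c2" "c1 \<in> aug_chains (Suc n) K" "c2 \<in> aug_chains (Suc n) L"
    using c(1) aug_chains_split by blast
  have eq: "aug_bd c1 = - aug_bd c2"
    using c(2) c12(1) by (simp add: eq_neg_iff_add_eq_0)
  have "aug_bd c1 \<in> aug_chains n (K \<inter> L)"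
    using aug_bd_chains[OF K c12(2)] aug_bd_chains[OF L c12(3)] eq aug_chains_minus
    by (intro aug_chains_Int) auto
  then obtain e where e: "e \<in> aug_chains (Suc n) (K \<inter> L)" "aug_bd e = aug_bd c1"
    using ac aug_bd_aug_bd unfolding aug_acyclic_def by blast
  show ?thesis
  proof
    show "c = (c1 - e) + (c2 + e)" using c12 by simp
    show "c1 - e \<in> aug_chains (Suc n) K"
      using c12(2) e(1) by (intro aug_chains_diff) (auto intro: aug_chains_mono[of "K \<inter> L"])
    show "c2 + e \<in> aug_chains (Suc n) L"
      using c12(3) e(1) by (intro aug_chains_add) (auto intro: aug_chains_mono[of "K \<inter> L"])
  qed (use e eq in auto)
qed

lemma aug_acyclic_Un:
  assumes K: "subset_closed K" and L: "subset_closed L"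
    and "aug_acyclic (Suc n) K" "aug_acyclic (Suc n) L" "aug_acyclic n (K \<inter> L)"
  shows "aug_acyclic (Suc n) (K \<union> L)"
  unfolding aug_acyclic_def
proof (intro ballI impI)
  fix c assume "c \<in> aug_chains (Suc n) (K \<union> L)" "aug_bd c = 0"
  then obtain c1 c2 where c12: "c = c1 + c2" "c1 \<in> aug_chains (Suc n) K" "aug_bd c1 = 0"
    "c2 \<in> aug_chains (Suc n) L" "aug_bd c2 = 0"
    using aug_cycle_split[OF K L] assms(5) by metis
  then obtain d1 d2 where "d1 \<in> aug_chains (Suc (Suc n)) K" "aug_bd d1 = c1"
    "d2 \<in> aug_chains (Suc (Suc n)) L" "aug_bd d2 = c2"
    using assms unfolding aug_acyclic_def by meson
  then show "\<exists>d\<in>aug_chains (Suc (Suc n)) (K \<union> L). aug_bd d = c"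
    using c12(1) by (intro bexI[of _ "d1 + d2"])
      (auto intro!: aug_chains_add intro: aug_chains_mono[of K] aug_chains_mono[of L])
qed

text \<open>Prefixing \<open>w\<close> to every list is a contracting homotopy. Ordered simplices
  may repeat vertices, so no case distinction arises when \<open>w\<close> is already a vertex of
  the simplex. The empty set in the hypothesis supplies \<open>{w}\<close>, which matters for n =
  0.\<close>

lemma aug_acyclic_cone:
  assumes "\<And>\<sigma>. \<sigma> \<in> insert {} K \<Longrightarrow> insert w \<sigma> \<in> K"
  shows "aug_acyclic n K"
  unfolding aug_acyclic_def
proof (intro ballI impI)
  fix c assume c: "c \<in> aug_chains n K" "aug_bd c = 0"
  have "cone_chain w c \<in> aug_chains (Suc n) K"
    using c(1) assms by (intro aug_chainsI) (force dest!: keys_cone_chain simp: aug_chains_def)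
  moreover have "aug_bd (cone_chain w c) = c"
    using c(2) by (simp add: aug_bd_cone)
  ultimately show "\<exists>d\<in>aug_chains (Suc n) K. aug_bd d = c" by blast
qed

lemma aug_acyclic_empty: "n \<ge> 1 \<Longrightarrow> aug_acyclic n {}"
proof -
  assume "n \<ge> 1"
  then have "c = 0" if "c \<in> aug_chains n {}" for c :: "'a list \<Rightarrow>\<^sub>0 int"
  proof -
    have "Poly_Mapping.keys c = {}"
      using that \<open>n \<ge> 1\<close> by (fastforce simp: aug_chains_def)
    then show ?thesis by simp
  qed
  then show ?thesis
    unfolding aug_acyclic_def by (metis aug_bd_simps(1) aug_chains_0)
qed

section \<open>Comparison with the simplicial chain complex\<close>

lemma list_bd_eq_sum:
  assumes "length xs = Suc p"
  shows "list_bd xs = (\<Sum>i\<le>p. frag_cmul ((-1) ^ i) (frag_of (list_face i xs)))"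
  using assms
proof (induction p arbitrary: xs)
  case 0
  then obtain x where "xs = [x]" by (metis One_nat_def length_0_conv length_Suc_conv)
  then show ?case by (simp add: list_face_def)
next
  case (Suc p)
  then obtain x ys where xs: "xs = x # ys" "length ys = Suc p"
    by (metis length_Suc_conv)
  have "(\<Sum>i\<le>Suc p. frag_cmul ((-1) ^ i) (frag_of (list_face i xs)))
      = frag_of ys + (\<Sum>i\<le>p. frag_cmul ((-1) ^ Suc i) (frag_of (x # list_face i ys)))"
    by (subst sum.atMost_Suc_shift) (simp add: xs list_face_def)
  also have "(\<Sum>i\<le>p. frag_cmul ((-1) ^ Suc i) (frag_of (x # list_face i ys)))
      = - cone_chain x (\<Sum>i\<le>p. frag_cmul ((-1) ^ i) (frag_of (list_face i ys)))"
    by (simp add: cone_chain_def frag_extend_sum frag_extend_cmul sum_negf[symmetric] o_def)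
  also have "frag_of ys + \<dots> = list_bd xs"
    using Suc.IH[OF xs(2)] xs(1) by simp
  finally show ?case by simp
qed

lemma carrier_simplicial_chain_group:
  assumes "{} \<notin> K"
  shows "carrier (simplicial_chain_group p K) = aug_chains (Suc p) K"
  using assms by (fastforce simp: simplicial_chain_group_def ordered_simplex_set_def aug_chains_def)

lemma simplicial_boundary_eq:
  assumes "c \<in> aug_chains (Suc p) K" "p > 0"
  shows "simplicial_boundary p c = aug_bd c"
  using assms unfolding simplicial_boundary_def aug_bd_def
  by (auto intro!: frag_extend_eq simp: list_bd_eq_sum aug_chains_def)

lemma simplicial_boundaries_eq:
  assumes "{} \<notin> K"
  shows "simplicial_boundaries p K = aug_bd ` aug_chains (Suc (Suc p)) K"
  unfolding simplicial_boundaries_def carrier_simplicial_chain_group[OF assms]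
  using simplicial_boundary_eq by (intro image_cong) auto

text \<open>The boundary in degree 0 is zero by definition, whereas \<open>aug_bd\<close> is the
  augmentation there; hence the exception for p = 0.\<close>

lemma simplicial_cycles_eq:
  assumes "{} \<notin> K"
  shows "simplicial_cycles p K = {c \<in> aug_chains (Suc p) K. p = 0 \<or> aug_bd c = 0}"
proof (cases "p = 0")
  case False
  then have "simplicial_boundary p c = aug_bd c" if "c \<in> aug_chains (Suc p) K" for c
    using simplicial_boundary_eq[OF that] by simp
  then show ?thesis
    using False unfolding simplicial_cycles_def carrier_simplicial_chain_group[OF assms] by auto
qed (simp add: simplicial_cycles_def carrier_simplicial_chain_group[OF assms] simplicial_boundary_def)

lemma simplicial_chain_map_simps [simp]:
  "simplicial_chain_map \<phi> 0 = 0"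
  "simplicial_chain_map \<phi> (frag_of xs) = frag_of (map \<phi> xs)"
  "simplicial_chain_map \<phi> (a + b) = simplicial_chain_map \<phi> a + simplicial_chain_map \<phi> b"
  "simplicial_chain_map \<phi> (a - b) = simplicial_chain_map \<phi> a - simplicial_chain_map \<phi> b"
  "simplicial_chain_map \<phi> (- a) = - simplicial_chain_map \<phi> a"
  by (simp_all add: simplicial_chain_map_def frag_extend_add frag_extend_diff frag_extend_minus)

lemma simplicial_chain_map_cone:
  "simplicial_chain_map \<phi> (cone_chain v c) = cone_chain (\<phi> v) (simplicial_chain_map \<phi> c)"
proof -
  have "Poly_Mapping.keys c \<subseteq> UNIV" by simp
  then show ?thesis
    by (induction c rule: frag_induction) auto
qed

lemma aug_bd_simplicial_chain_map:
  "aug_bd (simplicial_chain_map \<phi> c) = simplicial_chain_map \<phi> (aug_bd c)"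
proof -
  have *: "list_bd (map \<phi> xs) = simplicial_chain_map \<phi> (list_bd xs)" for xs
    by (induction xs) (auto simp: simplicial_chain_map_cone)
  have "Poly_Mapping.keys c \<subseteq> UNIV" by simp
  then show ?thesis
    by (induction c rule: frag_induction) (auto simp: *)
qed

lemma simplicial_chain_map_chains:
  assumes "\<And>\<sigma>. \<sigma> \<in> K \<Longrightarrow> \<phi> ` \<sigma> \<in> L" "c \<in> aug_chains n K"
  shows "simplicial_chain_map \<phi> c \<in> aug_chains n L"
  using assms(2)
  by (induction rule: aug_chains_induct) (use assms(1) in \<open>auto intro: aug_chains_diff\<close>)

section \<open>Homology groups\<close>

locale abstract_complex =
  fixes K :: "'v set set"
  assumes nonempty_simplices: "{} \<notin> K" and closed: "subset_closed K"
begin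

lemmas boundaries_eq = simplicial_boundaries_eq[OF nonempty_simplices]
lemmas cycles_eq = simplicial_cycles_eq[OF nonempty_simplices]

lemma boundaries_add:
  "a \<in> simplicial_boundaries p K \<Longrightarrow> b \<in> simplicial_boundaries p K \<Longrightarrow> a + b \<in> simplicial_boundaries p K"
  unfolding boundaries_eq by (auto intro!: aug_chains_add image_eqI simp flip: aug_bd_simps(3))

lemma boundaries_minus:
  "a \<in> simplicial_boundaries p K \<Longrightarrow> - a \<in> simplicial_boundaries p K"
  unfolding boundaries_eq by (auto intro!: aug_chains_minus image_eqI simp flip: aug_bd_simps(5))

lemma zero_boundary: "0 \<in> simplicial_boundaries p K"
  unfolding boundaries_eq by (rule image_eqI[of _ _ 0]) auto

lemma boundaries_diff:
  "a \<in> simplicial_boundaries p K \<Longrightarrow> b \<in> simplicial_boundaries p K \<Longrightarrow> a - b \<in> simplicial_boundaries p K"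
  using boundaries_add[of a p "- b"] boundaries_minus[of b p] by simp

lemma boundaries_subset_cycles: "simplicial_boundaries p K \<subseteq> simplicial_cycles p K"
  unfolding boundaries_eq cycles_eq using aug_bd_chains[OF closed] by (auto simp: aug_bd_aug_bd)

lemma cycles_add:
  "a \<in> simplicial_cycles p K \<Longrightarrow> b \<in> simplicial_cycles p K \<Longrightarrow> a + b \<in> simplicial_cycles p K"
  unfolding cycles_eq by (auto intro: aug_chains_add)

lemma cycles_minus: "a \<in> simplicial_cycles p K \<Longrightarrow> - a \<in> simplicial_cycles p K"
  unfolding cycles_eq by (auto intro: aug_chains_minus)

lemma cycles_subset: "simplicial_cycles p K \<subseteq> carrier (simplicial_chain_group p K)"
  by (auto simp: simplicial_cycles_def)

lemma subgroup_cycles: "subgroup (simplicial_cycles p K) (simplicial_chain_group p K)"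
proof -
  interpret G: group "simplicial_chain_group p K"
    by (simp add: simplicial_chain_group_def)
  have inv: "inv\<^bsub>simplicial_chain_group p K\<^esub> a = - a" if "a \<in> simplicial_cycles p K" for a
    unfolding simplicial_chain_group_def
  proof (rule inv_free_Abelian_group)
    show "Poly_Mapping.keys a \<subseteq> ordered_simplex_set p K"
      using cycles_subset[of p] that unfolding simplicial_chain_group_def by (metis carrier_free_Abelian_group_iff subsetD)
  qed
  show ?thesis
  proof (rule G.subgroupI)
    show "simplicial_cycles p K \<noteq> {}"
      by (auto simp: cycles_eq intro!: exI[of _ 0])
  qed (use cycles_subset cycles_add cycles_minus inv in \<open>auto simp: simplicial_chain_group_def\<close>)
qed

lemma carrier_cycle_group: "carrier (simplicial_cycle_group p K) = simplicial_cycles p K"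
proof -
  interpret G: group "simplicial_chain_group p K"
    by (simp add: simplicial_chain_group_def)
  show ?thesis
    unfolding simplicial_cycle_group_def
    using subgroup_cycles by (rule subgroup.carrier_subgroup_generated_subgroup)
qed

lemma mult_cycle_group: "a \<otimes>\<^bsub>simplicial_cycle_group p K\<^esub> b = a + b"
  by (simp add: simplicial_cycle_group_def simplicial_chain_group_def)

lemma comm_group_cycle_group: "comm_group (simplicial_cycle_group p K)"
  unfolding simplicial_cycle_group_def
  by (intro group.abelian_subgroup_generated) (simp_all add: simplicial_chain_group_def abelian_free_Abelian_group)

lemma subgroup_boundaries: "subgroup (simplicial_boundaries p K) (simplicial_cycle_group p K)"
proof -
  interpret Z: comm_group "simplicial_cycle_group p K"
    by (rule comm_group_cycle_group)
  have one: "\<one>\<^bsub>simplicial_cycle_group p K\<^esub> = 0"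
    by (simp add: simplicial_cycle_group_def simplicial_chain_group_def)
  have inv: "inv\<^bsub>simplicial_cycle_group p K\<^esub> a = - a" if "a \<in> simplicial_cycles p K" for a
    using that cycles_minus[OF that]
    by (intro Z.inv_equality) (auto simp: carrier_cycle_group mult_cycle_group one)
  show ?thesis
  proof (rule Z.subgroupI)
    show "simplicial_boundaries p K \<noteq> {}" using zero_boundary by blast
    show "inv\<^bsub>simplicial_cycle_group p K\<^esub> a \<in> simplicial_boundaries p K"
      if "a \<in> simplicial_boundaries p K" for a
      using that boundaries_subset_cycles[of p] inv[of a] boundaries_minus[of a p] by auto
  qed (use boundaries_subset_cycles[of p] boundaries_add in \<open>auto simp: carrier_cycle_group mult_cycle_group\<close>)
qed

lemma normal_boundaries: "simplicial_boundaries p K \<lhd> simplicial_cycle_group p K"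
  using comm_group.normal_iff_subgroup[OF comm_group_cycle_group] subgroup_boundaries by blast

lemma group_homology: "group (simplicial_homology_group p K)"
  unfolding simplicial_homology_group_def using normal_boundaries by (rule normal.factorgroup_is_group)

definition homology_class :: "nat \<Rightarrow> ('v list \<Rightarrow>\<^sub>0 int) \<Rightarrow> ('v list \<Rightarrow>\<^sub>0 int) set"
  where "homology_class p c = simplicial_boundaries p K #>\<^bsub>simplicial_cycle_group p K\<^esub> c"

lemma homology_class_eq: "homology_class p c = {b + c | b. b \<in> simplicial_boundaries p K}"
  by (auto simp: homology_class_def r_coset_def mult_cycle_group)

lemma homology_class_eq_iff:
  "homology_class p c = homology_class p c' \<longleftrightarrow> c - c' \<in> simplicial_boundaries p K"
proof
  assume "homology_class p c = homology_class p c'"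
  then have "c \<in> homology_class p c'"
    using zero_boundary by (force simp: homology_class_eq)
  then show "c - c' \<in> simplicial_boundaries p K"
    by (auto simp: homology_class_eq)
next
  assume *: "c - c' \<in> simplicial_boundaries p K"
  have 1: "b + c \<in> homology_class p c'" if "b \<in> simplicial_boundaries p K" for b
    unfolding homology_class_eq using boundaries_add[OF that *] by (auto intro!: exI[of _ "b + (c - c')"])
  have 2: "b + c' \<in> homology_class p c" if "b \<in> simplicial_boundaries p K" for b
    unfolding homology_class_eq using boundaries_diff[OF that *] by (auto intro!: exI[of _ "b - (c - c')"])
  show "homology_class p c = homology_class p c'"
    using 1 2 by (auto simp: homology_class_eq)
qed

lemma carrier_homology:
  "carrier (simplicial_homology_group p K) = homology_class p ` simplicial_cycles p K"
  by (auto simp: simplicial_homology_group_def FactGroup_def RCOSETS_def homology_class_def carrier_cycle_group)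

lemma one_homology: "\<one>\<^bsub>simplicial_homology_group p K\<^esub> = homology_class p 0"
  by (auto simp: simplicial_homology_group_def homology_class_eq)

lemma mult_homology:
  assumes "c \<in> simplicial_cycles p K" "c' \<in> simplicial_cycles p K"
  shows "homology_class p c \<otimes>\<^bsub>simplicial_homology_group p K\<^esub> homology_class p c' = homology_class p (c + c')"
  using normal.rcos_sum[OF normal_boundaries, of c p c'] assms
  by (simp add: simplicial_homology_group_def homology_class_def carrier_cycle_group mult_cycle_group)

lemma homology_class_eq_one_iff:
  "homology_class p c = \<one>\<^bsub>simplicial_homology_group p K\<^esub> \<longleftrightarrow> c \<in> simplicial_boundaries p K"
  by (simp add: one_homology homology_class_eq_iff)

lemma trivial_homology_iff:
  "trivial_group (simplicial_homology_group p K) \<longleftrightarrow> simplicial_cycles p K \<subseteq> simplicial_boundaries p K"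
proof -
  have z: "0 \<in> simplicial_cycles p K"
    by (simp add: cycles_eq)
  have "trivial_group (simplicial_homology_group p K) \<longleftrightarrow>
    homology_class p ` simplicial_cycles p K \<subseteq> {\<one>\<^bsub>simplicial_homology_group p K\<^esub>}"
    using group.trivial_group_subset[OF group_homology] carrier_homology by metis
  also have "\<dots> \<longleftrightarrow> simplicial_cycles p K \<subseteq> simplicial_boundaries p K"
    using homology_class_eq_one_iff by blast
  finally show ?thesis .
qed

end

section \<open>Induced homomorphisms on homology\<close>

lemma simplicial_chain_map_boundaries:
  assumes K: "abstract_complex K" and L: "abstract_complex L"
    and \<phi>: "\<And>\<sigma>. \<sigma> \<in> K \<Longrightarrow> \<phi> ` \<sigma> \<in> L" and c: "c \<in> simplicial_boundaries p K"
  shows "simplicial_chain_map \<phi> c \<in> simplicial_boundaries p L"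
  using c simplicial_chain_map_chains[of K \<phi> L, OF \<phi>]
  by (force simp: abstract_complex.boundaries_eq[OF K] abstract_complex.boundaries_eq[OF L]
      simp flip: aug_bd_simplicial_chain_map)

text \<open>Images of two representatives differ by a boundary, so the union in the definition
  collapses to a single coset.\<close>

lemma simplicial_hom_induced_class:
  assumes K: "abstract_complex K" and L: "abstract_complex L"
    and \<phi>: "\<And>\<sigma>. \<sigma> \<in> K \<Longrightarrow> \<phi> ` \<sigma> \<in> L"
  shows "simplicial_hom_induced p L \<phi> (abstract_complex.homology_class K p c)
    = abstract_complex.homology_class L p (simplicial_chain_map \<phi> c)"
proof -
  interpret K: abstract_complex K by fact
  interpret L: abstract_complex L by fact
  have "L.homology_class p (simplicial_chain_map \<phi> x) = L.homology_class p (simplicial_chain_map \<phi> c)"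
    if "x \<in> K.homology_class p c" for x
  proof -
    have "x - c \<in> simplicial_boundaries p K"
      using that by (auto simp: K.homology_class_eq)
    then have "simplicial_chain_map \<phi> (x - c) \<in> simplicial_boundaries p L"
      using simplicial_chain_map_boundaries[OF K L, of \<phi>] \<phi> by blast
    then show ?thesis
      by (simp add: L.homology_class_eq_iff)
  qed
  moreover have "c \<in> K.homology_class p c"
    using K.zero_boundary by (force simp: K.homology_class_eq)
  ultimately show ?thesis
    unfolding simplicial_hom_induced_def L.homology_class_def by blast
qed

section \<open>Nerves\<close>

lemma abstract_complex_nerve: "abstract_complex (nerve \<V>)"
proof
  show "subset_closed (nerve \<V>)"
    unfolding subset_closed_def
  proof (intro ballI allI impI)
    fix \<sigma> \<tau> assume *: "\<sigma> \<in> nerve \<V>" "\<tau> \<subseteq> \<sigma>" "\<tau> \<noteq> {}"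
    then have "\<Inter>\<sigma> \<subseteq> \<Inter>\<tau>" "finite \<tau>" by (auto simp: nerve_def intro: finite_subset)
    then show "\<tau> \<in> nerve \<V>" using * unfolding nerve_def by blast
  qed
qed (simp add: nerve_def)

lemma refinement_projection_nerve:
  assumes "refinement_projection \<V> \<U> \<phi>" "\<sigma> \<in> nerve \<V>"
  shows "\<phi> ` \<sigma> \<in> nerve \<U>"
proof -
  obtain x where "x \<in> \<Inter>\<sigma>" using assms(2) by (auto simp: nerve_def)
  then have "x \<in> \<Inter>(\<phi> ` \<sigma>)"
    using assms by (auto simp: nerve_def refinement_projection_def)
  then show ?thesis
    using assms by (auto simp: nerve_def refinement_projection_def)
qed

lemma covering_refines_projection:
  assumes "covering_refines \<V> \<U>"
  obtains \<phi> where "refinement_projection \<V> \<U> \<phi>"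
  using assms unfolding covering_refines_def refinement_projection_def by metis

text \<open>Being joined by a 1-chain is an equivalence relation on members. Transported to points,
  it is locally constant because the points of one member are related through that member;
  connectedness then makes it total.\<close>

lemma nerve_vertices_joined:
  assumes conn: "connected (\<Union>\<V>)" and op: "\<And>V. V \<in> \<V> \<Longrightarrow> openin (top_of_set (\<Union>\<V>)) V"
    and VW: "V \<in> \<V>" "V \<noteq> {}" "W \<in> \<V>" "W \<noteq> {}"
  shows "\<exists>e\<in>aug_chains 2 (nerve \<V>). aug_bd e = frag_of [W] - frag_of [V]"
proof -
  define J where "J = (\<lambda>V W. \<exists>e\<in>aug_chains 2 (nerve \<V>). aug_bd e = frag_of [W] - frag_of [V])"
  have sym: "J W V" if "J V W" for V W
  proof -
    obtain e where "e\<in>aug_chains 2 (nerve \<V>)" "aug_bd e = frag_of [W] - frag_of [V]"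
      using \<open>J V W\<close> unfolding J_def by blast
    then show ?thesis unfolding J_def by (intro bexI[of _ "- e"]) (auto intro: aug_chains_minus)
  qed
  have trans: "J U W" if "J U V" "J V W" for U V W
  proof -
    obtain e where "e\<in>aug_chains 2 (nerve \<V>)" "aug_bd e = frag_of [V] - frag_of [U]"
      using \<open>J U V\<close> unfolding J_def by blast
    moreover obtain f where "f\<in>aug_chains 2 (nerve \<V>)" "aug_bd f = frag_of [W] - frag_of [V]"
      using \<open>J V W\<close> unfolding J_def by blast
    ultimately show ?thesis unfolding J_def by (intro bexI[of _ "e + f"]) (auto intro: aug_chains_add)
  qed
  have meet: "J V W" if "x \<in> V" "x \<in> W" "V \<in> \<V>" "W \<in> \<V>" for x V W
    unfolding J_def using that
    by (intro bexI[of _ "frag_of [V, W]"]) (auto simp: nerve_def)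
  define R where "R = (\<lambda>x y. \<forall>V\<in>\<V>. \<forall>W\<in>\<V>. x \<in> V \<longrightarrow> y \<in> W \<longrightarrow> J V W)"
  obtain x y where xy: "x \<in> V" "y \<in> W" using VW by blast
  have "R x y"
  proof (rule connected_equivalence_relation[OF conn])
    show "R y x" if "R x y" for x y using that sym unfolding R_def by blast
    show "R x z" if "R x y" "R y z" "y \<in> \<Union>\<V>" for x y z
      unfolding R_def
    proof (intro ballI impI)
      fix V W assume "V \<in> \<V>" "W \<in> \<V>" "x \<in> V" "z \<in> W"
      moreover obtain U where "U \<in> \<V>" "y \<in> U" using \<open>y \<in> \<Union>\<V>\<close> by blast
      ultimately have "J V U" "J U W" using that(1,2) unfolding R_def by blast+
      then show "J V W" by (rule trans)
    qed
    show "\<exists>T. openin (top_of_set (\<Union>\<V>)) T \<and> a \<in> T \<and> (\<forall>x\<in>T. R a x)" if "a \<in> \<Union>\<V>" for a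
    proof -
      obtain U where "U \<in> \<V>" "a \<in> U" using \<open>a \<in> \<Union>\<V>\<close> by blast
      have "J V W" if "x \<in> U" "V \<in> \<V>" "W \<in> \<V>" "a \<in> V" "x \<in> W" for x V W
        using trans[OF meet[of a V U] meet[of x U W]] that \<open>U \<in> \<V>\<close> \<open>a \<in> U\<close> by blast
      then have "R a x" if "x \<in> U" for x
        unfolding R_def using that by blast
      then show ?thesis using op \<open>U \<in> \<V>\<close> \<open>a \<in> U\<close> by blast
    qed
  qed (use xy VW in auto)
  then show ?thesis using xy VW unfolding R_def J_def by blast
qed

text \<open>Every 0-chain is homologous to a multiple of one fixed vertex, and the augmentation
  reads off the multiple.\<close>

lemma aug_acyclic_1:
  assumes joined: "\<And>v w. {v} \<in> K \<Longrightarrow> {w} \<in> K \<Longrightarrow> \<exists>e\<in>aug_chains 2 K. aug_bd e = frag_of [w] - frag_of [v]"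
  shows "aug_acyclic 1 K"
proof (cases "\<exists>v. {v} \<in> K")
  case True
  then obtain v where v: "{v} \<in> K" by blast
  have "\<exists>e\<in>aug_chains 2 K. \<exists>n. aug_bd e = c - frag_cmul n (frag_of [v]) \<and> aug_bd c = frag_cmul n (frag_of [])"
    if "c \<in> aug_chains 1 K" for c
    using that
  proof (induction rule: aug_chains_induct)
    case zero
    show ?case by (intro bexI[of _ 0] exI[of _ 0]) auto
  next
    case (one xs)
    then obtain w where w: "xs = [w]" "{w} \<in> K"
      by (auto simp: length_Suc_conv)
    then show ?case using joined[OF v w(2)] by (auto intro!: exI[of _ 1])
  next
    case (diff a b)
    then obtain e n f m where "e\<in>aug_chains 2 K" "aug_bd e = a - frag_cmul n (frag_of [v])" "aug_bd a = frag_cmul n (frag_of [])"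
      "f\<in>aug_chains 2 K" "aug_bd f = b - frag_cmul m (frag_of [v])" "aug_bd b = frag_cmul m (frag_of [])"
      by blast
    then show ?case
      by (intro bexI[of _ "e - f"] exI[of _ "n - m"]) (auto intro: aug_chains_diff simp: frag_cmul_diff_distrib)
  qed
  then have *: "\<exists>e\<in>aug_chains 2 K. aug_bd e = c" if "c \<in> aug_chains 1 K" "aug_bd c = 0" for c
    using that by fastforce
  show ?thesis
    unfolding aug_acyclic_def Suc_1 using * by blast
next
  case False
  then have "c = 0" if "c \<in> aug_chains 1 K" for c
  proof -
    have "Poly_Mapping.keys c = {}"
      using that False by (fastforce simp: aug_chains_def length_Suc_conv)
    then show ?thesis by simp
  qed
  then show ?thesis
    unfolding aug_acyclic_def by (metis aug_bd_simps(1) aug_chains_0)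
qed

section \<open>Removing vertices from a nerve\<close>

text \<open>The index starts at 2, that is, at dimension 1: removing an isolated vertex changes the
  number of components, so connectedness cannot be carried through the removal arguments.\<close>

definition higher_acyclic :: "'v set set \<Rightarrow> bool"
  where "higher_acyclic K \<longleftrightarrow> (\<forall>n\<ge>2. aug_acyclic n K)"

lemma subset_closed_nerve: "subset_closed (nerve \<V>)"
  using abstract_complex.closed[OF abstract_complex_nerve] .

lemma nerve_mono: "F \<subseteq> G \<Longrightarrow> nerve F \<subseteq> nerve G"
  by (auto simp: nerve_def)

lemma nerve_insert_iff:
  "insert v \<sigma> \<in> nerve F \<longleftrightarrow> finite \<sigma> \<and> insert v \<sigma> \<subseteq> F - {{}} \<and> \<Inter>\<sigma> \<inter> v \<noteq> {}"
  unfolding nerve_def by (auto simp: Int_commute)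

text \<open>Mayer-Vietoris for the star of \<open>v\<close>, a cone, and the nerve without
  \<open>v\<close>; they meet in the link of \<open>v\<close>. The two alternatives say that the
  link is empty or a cone with apex \<open>w\<close>. The empty family has intersection
  \<open>UNIV\<close>, so \<sigma> = {} in the second one makes \<open>w\<close> a vertex of the
  link.\<close>

lemma higher_acyclic_nerve_remove:
  assumes ac: "higher_acyclic (nerve (F - {v}))" and v: "v \<in> F" "v \<noteq> {}"
    and link: "(\<forall>w\<in>F - {v}. w \<inter> v = {}) \<or>
      (\<exists>w\<in>F - {v}. \<forall>\<sigma>. finite \<sigma> \<longrightarrow> \<sigma> \<subseteq> F - {v} \<longrightarrow> \<Inter>\<sigma> \<inter> v \<noteq> {} \<longrightarrow> \<Inter>\<sigma> \<inter> v \<inter> w \<noteq> {})"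
  shows "higher_acyclic (nerve F)"
  unfolding higher_acyclic_def
proof (intro allI impI)
  fix n :: nat assume "n \<ge> 2"
  then obtain m where n: "n = Suc m" "m \<ge> 1" by (cases n) auto
  define star where "star = {\<sigma> \<in> nerve F. insert v \<sigma> \<in> nerve F}"
  define rest where "rest = nerve (F - {v})"
  have closed: "subset_closed star" "subset_closed rest"
  proof -
    show "subset_closed star"
      unfolding subset_closed_def
    proof (intro ballI allI impI)
      fix \<sigma> \<tau> assume *: "\<sigma> \<in> star" "\<tau> \<subseteq> \<sigma>" "\<tau> \<noteq> {}"
      then have "insert v \<tau> \<subseteq> insert v \<sigma>" "insert v \<sigma> \<in> nerve F" "\<sigma> \<in> nerve F" by (auto simp: star_def)
      then have "insert v \<tau> \<in> nerve F" "\<tau> \<in> nerve F"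
        using subset_closed_nerve[of F] *(2,3) unfolding subset_closed_def by (meson insert_not_empty)+
      then show "\<tau> \<in> star" by (simp add: star_def)
    qed
  qed (simp add: rest_def subset_closed_nerve)
  have un: "nerve F = star \<union> rest"
  proof -
    have "\<sigma> \<in> star \<union> rest" if "\<sigma> \<in> nerve F" for \<sigma>
      using that by (cases "v \<in> \<sigma>") (auto simp: star_def rest_def nerve_def insert_absorb)
    moreover have "rest \<subseteq> nerve F" unfolding rest_def by (rule nerve_mono) blast
    ultimately show ?thesis unfolding star_def by blast
  qed
  have "aug_acyclic n star"
  proof (rule aug_acyclic_cone)
    show "insert v \<sigma> \<in> star" if "\<sigma> \<in> insert {} star" for \<sigma>
      using that v by (auto simp: star_def nerve_insert_iff)
  qed
  moreover have "aug_acyclic n rest"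
    using ac \<open>n \<ge> 2\<close> by (simp add: higher_acyclic_def rest_def)
  moreover have "aug_acyclic m (star \<inter> rest)"
    using link
  proof
    assume *: "\<forall>w\<in>F - {v}. w \<inter> v = {}"
    have "\<sigma> \<notin> star" if \<sigma>: "\<sigma> \<in> rest" for \<sigma>
    proof
      assume "\<sigma> \<in> star"
      then have "\<Inter>\<sigma> \<inter> v \<noteq> {}" by (simp add: star_def nerve_insert_iff)
      moreover obtain w where "w \<in> \<sigma>" "w \<in> F - {v}" using \<sigma> by (auto simp: rest_def nerve_def)
      ultimately show False using * by blast
    qed
    then have "star \<inter> rest = {}" by blast
    then show ?thesis using aug_acyclic_empty n by metis
  next
    assume "\<exists>w\<in>F - {v}. \<forall>\<sigma>. finite \<sigma> \<longrightarrow> \<sigma> \<subseteq> F - {v} \<longrightarrow> \<Inter>\<sigma> \<inter> v \<noteq> {} \<longrightarrow> \<Inter>\<sigma> \<inter> v \<inter> w \<noteq> {}"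
    then obtain w where w: "w \<in> F - {v}"
      "\<forall>\<sigma>. finite \<sigma> \<longrightarrow> \<sigma> \<subseteq> F - {v} \<longrightarrow> \<Inter>\<sigma> \<inter> v \<noteq> {} \<longrightarrow> \<Inter>\<sigma> \<inter> v \<inter> w \<noteq> {}" by (elim bexE)
    show ?thesis
    proof (rule aug_acyclic_cone)
      fix \<sigma> assume "\<sigma> \<in> insert {} (star \<inter> rest)"
      then have \<sigma>: "finite \<sigma>" "\<sigma> \<subseteq> F - {v}" "\<sigma> \<subseteq> F - {{}}" "\<Inter>\<sigma> \<inter> v \<noteq> {}"
        using v by (auto simp: star_def rest_def nerve_insert_iff) (auto simp: nerve_def)
      then have ne: "\<Inter>\<sigma> \<inter> v \<inter> w \<noteq> {}" using w(2) by simp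
      then have "insert w \<sigma> \<in> rest"
        unfolding rest_def nerve_insert_iff using \<sigma> w(1) by blast
      moreover have "insert v (insert w \<sigma>) \<in> nerve F"
        unfolding nerve_insert_iff using \<sigma> w(1) v ne by blast
      moreover have "insert w \<sigma> \<in> nerve F"
        unfolding nerve_insert_iff using \<sigma> w(1) v ne by blast
      ultimately show "insert w \<sigma> \<in> star \<inter> rest" by (simp add: star_def)
    qed
  qed
  ultimately show "aug_acyclic n (nerve F)"
    unfolding un n(1) using closed by (intro aug_acyclic_Un)
qed

text \<open>The filter \<open>G\<close> plays the role of a germ contained in every set that meets
  \<open>f x\<close>. Finitely many neighbours then always have a common point inside
  \<open>f x\<close>, so the link is a full simplex and any neighbour can serve as apex.\<close>

lemma higher_acyclic_nerve_remove_germ: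
  assumes ac: "higher_acyclic (nerve (f ` (I - {x})))" and x: "x \<in> I"
    and G: "G \<noteq> bot" "eventually (\<lambda>z. z \<in> f x) G"
    and nb: "\<And>y. y \<in> I \<Longrightarrow> f y \<inter> f x \<noteq> {} \<Longrightarrow> eventually (\<lambda>z. z \<in> f y) G"
  shows "higher_acyclic (nerve (f ` I))"
\<comment> \<open>Different indices may denote the same set; then dropping one index leaves the
  nerve unchanged.\<close>
proof (cases "\<exists>y\<in>I - {x}. f y = f x")
  case True
  then have "f x \<in> f ` (I - {x})" by (metis imageI)
  then have "f ` (I - {x}) = f ` I" using x by blast
  then show ?thesis using ac by simp
next
  case False
  then have F: "f ` (I - {x}) = f ` I - {f x}" by blast
  show ?thesis
  proof (rule higher_acyclic_nerve_remove)
    show "f x \<noteq> {}" using G eventually_happens' by fastforce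
    show "(\<forall>w\<in>f ` I - {f x}. w \<inter> f x = {}) \<or>
      (\<exists>w\<in>f ` I - {f x}. \<forall>\<sigma>. finite \<sigma> \<longrightarrow> \<sigma> \<subseteq> f ` I - {f x} \<longrightarrow> \<Inter>\<sigma> \<inter> f x \<noteq> {} \<longrightarrow> \<Inter>\<sigma> \<inter> f x \<inter> w \<noteq> {})"
    proof (cases "\<forall>w\<in>f ` I - {f x}. w \<inter> f x = {}")
      case False
      then obtain w where w: "w \<in> f ` I - {f x}" "w \<inter> f x \<noteq> {}" by blast
      have nb': "eventually (\<lambda>z. z \<in> u) G" if "u \<in> f ` I" "u \<inter> f x \<noteq> {}" for u
        using nb that by blast
      have "\<Inter>\<sigma> \<inter> f x \<inter> w \<noteq> {}" if \<sigma>: "finite \<sigma>" "\<sigma> \<subseteq> f ` I - {f x}" "\<Inter>\<sigma> \<inter> f x \<noteq> {}" for \<sigma>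
      proof -
        have "eventually (\<lambda>z. z \<in> u) G" if "u \<in> \<sigma>" for u
          by (rule nb') (use that \<sigma> in blast)+
        then have "eventually (\<lambda>z. \<forall>u\<in>\<sigma>. z \<in> u) G"
          using \<sigma>(1) by (simp add: eventually_ball_finite)
        then have "eventually (\<lambda>z. (\<forall>u\<in>\<sigma>. z \<in> u) \<and> z \<in> f x \<and> z \<in> w) G"
          using nb'[of w] w G(2) by (auto intro: eventually_conj)
        then obtain z where "(\<forall>u\<in>\<sigma>. z \<in> u) \<and> z \<in> f x \<and> z \<in> w"
          using eventually_happens'[OF G(1)] by blast
        then show ?thesis by blast
      qed
      then show ?thesis using w(1) by (intro disjI2 bexI[of _ w] allI impI)
    qed simp
  qed (use ac x F in auto)
qed

text \<open>A cycle involves finitely many sets, so it can be filled in the nerve of any acyclic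
  subfamily containing them. Passing from \<open>F\<close> to a larger \<open>F'\<close> allows for
  families in which only suitably closed finite subfamilies are known to be acyclic.\<close>

lemma higher_acyclic_nerve_directed:
  assumes "\<And>F. finite F \<Longrightarrow> F \<subseteq> \<V> \<Longrightarrow> \<exists>F'. F \<subseteq> F' \<and> F' \<subseteq> \<V> \<and> higher_acyclic (nerve F')"
  shows "higher_acyclic (nerve \<V>)"
  unfolding higher_acyclic_def aug_acyclic_def
proof (intro allI impI ballI)
  fix n :: nat and c assume n: "2 \<le> n" and c: "c \<in> aug_chains n (nerve \<V>)" "aug_bd c = 0"
  define F where "F = \<Union>(set ` Poly_Mapping.keys c)"
  have "finite F" "F \<subseteq> \<V>"
    using c(1) by (auto simp: F_def aug_chains_def nerve_def)
  then obtain F' where F': "F \<subseteq> F'" "F' \<subseteq> \<V>" "higher_acyclic (nerve F')"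
    using assms by meson
  have "c \<in> aug_chains n (nerve F')"
  proof (rule aug_chainsI)
    fix xs assume xs: "xs \<in> Poly_Mapping.keys c"
    then have "set xs \<subseteq> F'" using F' by (auto simp: F_def)
    then show "length xs = n \<and> set xs \<in> insert {} (nerve F')"
      using c(1) xs by (auto simp: aug_chains_def nerve_def)
  qed
  then obtain d where "d \<in> aug_chains (Suc n) (nerve F')" "aug_bd d = c"
    using F'(3) n c(2) unfolding higher_acyclic_def aug_acyclic_def by meson
  moreover have "nerve F' \<subseteq> nerve \<V>" using F'(2) by (auto simp: nerve_def)
  ultimately show "\<exists>d\<in>aug_chains (Suc n) (nerve \<V>). aug_bd d = c"
    using aug_chains_mono by blast
qed

lemma higher_acyclic_nerve_empty: "higher_acyclic (nerve {})"
proof -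
  have "nerve {} = {}" by (auto simp: nerve_def)
  then show ?thesis unfolding higher_acyclic_def by (metis aug_acyclic_empty le_trans one_le_numeral)
qed

text \<open>Take the interval with the least right end q: every interval meeting it contains the
  points just to the left of q, so it can be removed by this germ.\<close>

lemma higher_acyclic_nerve_intervals:
  fixes E :: "real \<Rightarrow> 'a"
  assumes E: "inj E" and \<V>: "\<V> \<subseteq> {E ` {p<..<q} | p q. p < q}"
  shows "higher_acyclic (nerve \<V>)"
proof (rule higher_acyclic_nerve_directed)
  fix F assume F: "finite F" "F \<subseteq> \<V>"
  define f where "f = (\<lambda>(p, q). E ` {p<..<q})"
  have "F \<subseteq> f ` {(p, q). p < q}" using F \<V> by (force simp: f_def)
  then obtain I where I: "I \<subseteq> {(p, q). p < q}" "finite I" "F = f ` I"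
    using F(1) finite_subset_image by metis
  have "higher_acyclic (nerve (f ` I))"
    using I(2,1)
  proof (induction "card I" arbitrary: I)
    case 0
    then show ?case by (simp add: higher_acyclic_nerve_empty)
  next
    case (Suc n)
    then have "I \<noteq> {}" by auto
    define x where "x = arg_min_on snd I"
    have x: "x \<in> I" "\<And>y. y \<in> I \<Longrightarrow> snd x \<le> snd y"
      using arg_min_if_finite[of I snd] \<open>I \<noteq> {}\<close> Suc.prems by (force simp: x_def not_less[symmetric])+
    obtain p q where pq: "x = (p, q)" by (cases x)
    then have "p < q" using x(1) Suc.prems by auto
    show ?case
    proof (rule higher_acyclic_nerve_remove_germ[where G = "filtermap E (at_left q)"])
      show "higher_acyclic (nerve (f ` (I - {x})))"
        using Suc x(1) by (intro Suc.hyps(1)) auto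
      show "eventually (\<lambda>z. z \<in> f x) (filtermap E (at_left q))"
        using eventually_at_left_real[OF \<open>p < q\<close>] by (auto simp: eventually_filtermap pq f_def elim!: eventually_mono)
      show "eventually (\<lambda>z. z \<in> f y) (filtermap E (at_left q))" if y: "y \<in> I" "f y \<inter> f x \<noteq> {}" for y
      proof -
        obtain p' q' where y': "y = (p', q')" by (cases y)
        have "E ` ({p'<..<q'} \<inter> {p<..<q}) \<noteq> {}"
          using y(2) unfolding y' pq f_def image_Int[OF E] by simp
        then have "p' < q" "q \<le> q'" using x(2)[OF y(1)] y' pq by auto
        then show ?thesis
          using eventually_at_left_real[of p' q] by (auto simp: eventually_filtermap y' f_def elim!: eventually_mono)
      qed
    qed (auto simp: x(1) filtermap_bot_iff)
  qed
  then show "\<exists>F'. F \<subseteq> F' \<and> F' \<subseteq> \<V> \<and> higher_acyclic (nerve F')"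
    using F I by blast
qed

section \<open>Cech homology\<close>

lemma carrier_cech_homology_group:
  "carrier (cech_homology_group k X) =
    {a \<in> \<Pi>\<^sub>E \<U>\<in>{\<U>. open_covering X \<U>}. carrier (nerve_homology k \<U>).
      \<forall>\<U> \<V> \<phi>. open_covering X \<U> \<and> open_covering X \<V> \<and>
            covering_refines \<V> \<U> \<and> refinement_projection \<V> \<U> \<phi> \<longrightarrow>
            simplicial_hom_induced k (nerve \<U>) \<phi> (a \<V>) = a \<U>}"
  by (simp add: cech_homology_group_def Let_def)

lemma group_nerve_homology: "group (nerve_homology k \<U>)"
  unfolding nerve_homology_def using abstract_complex.group_homology[OF abstract_complex_nerve] .

abbreviation nerve_class :: "nat \<Rightarrow> 'a set set \<Rightarrow> ('a set list \<Rightarrow>\<^sub>0 int) \<Rightarrow> ('a set list \<Rightarrow>\<^sub>0 int) set"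
  where "nerve_class k \<U> \<equiv> abstract_complex.homology_class (nerve \<U>) k"

lemmas carrier_nerve_homology =
  abstract_complex.carrier_homology[OF abstract_complex_nerve, folded nerve_homology_def]
lemmas one_nerve_homology =
  abstract_complex.one_homology[OF abstract_complex_nerve, folded nerve_homology_def]
lemmas mult_nerve_homology =
  abstract_complex.mult_homology[OF abstract_complex_nerve, folded nerve_homology_def]
lemmas nerve_class_eq_iff = abstract_complex.homology_class_eq_iff[OF abstract_complex_nerve]
lemmas nerve_cycles_eq = abstract_complex.cycles_eq[OF abstract_complex_nerve]
lemmas nerve_boundaries_eq = abstract_complex.boundaries_eq[OF abstract_complex_nerve]

lemma nerve_hom_induced_class:
  assumes "refinement_projection \<V> \<U> \<phi>"
  shows "simplicial_hom_induced k (nerve \<U>) \<phi> (nerve_class k \<V> c) = nerve_class k \<U> (simplicial_chain_map \<phi> c)"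
  using assms
  by (intro simplicial_hom_induced_class abstract_complex_nerve refinement_projection_nerve)

lemma refinement_projection_refines: "refinement_projection \<V> \<U> \<phi> \<Longrightarrow> covering_refines \<V> \<U>"
  by (auto simp: refinement_projection_def covering_refines_def)

lemma cech_compatible:
  assumes "a \<in> carrier (cech_homology_group k X)" "open_covering X \<U>" "open_covering X \<V>"
    "refinement_projection \<V> \<U> \<phi>"
  shows "simplicial_hom_induced k (nerve \<U>) \<phi> (a \<V>) = a \<U>"
  using assms refinement_projection_refines unfolding carrier_cech_homology_group by blast

lemma cech_class:
  assumes "a \<in> carrier (cech_homology_group k X)" "open_covering X \<U>"
  obtains c where "c \<in> simplicial_cycles k (nerve \<U>)" "a \<U> = nerve_class k \<U> c"
  using assms unfolding carrier_cech_homology_group carrier_nerve_homology by (auto simp: PiE_iff)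

text \<open>The refinement may depend on the cycle c: if c represents the component at \<V> of a
  compatible family, the component at \<open>\<V>'\<close> supplies a cycle whose image is
  homologous to c, so c bounds. Vanishing on a cofinal set of coverings then makes the whole family
  trivial.\<close>

lemma trivial_cech_homologyI:
  assumes "\<And>\<U>. open_covering X \<U> \<Longrightarrow> \<exists>\<V>. open_covering X \<V> \<and> covering_refines \<V> \<U> \<and>
    (\<forall>c\<in>simplicial_cycles k (nerve \<V>). \<exists>\<V>' \<phi>. open_covering X \<V>' \<and> refinement_projection \<V>' \<V> \<phi> \<and>
      (\<forall>c'\<in>simplicial_cycles k (nerve \<V>').
        c - simplicial_chain_map \<phi> c' \<in> simplicial_boundaries k (nerve \<V>) \<longrightarrow>
        c \<in> simplicial_boundaries k (nerve \<V>)))"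
  shows "trivial_group (cech_homology_group k X)"
proof -
  let ?P = "product_group {\<U>. open_covering X \<U>} (nerve_homology k)"
  have P: "group ?P" by (simp add: group_nerve_homology)
  have vanish: "a \<U> = \<one>\<^bsub>nerve_homology k \<U>\<^esub>"
    if a: "a \<in> carrier (cech_homology_group k X)" and \<U>: "open_covering X \<U>" for a \<U>
  proof -
    obtain \<V> where \<V>: "open_covering X \<V>" "covering_refines \<V> \<U>" and
      *: "\<And>c. c \<in> simplicial_cycles k (nerve \<V>) \<Longrightarrow> \<exists>\<V>' \<phi>. open_covering X \<V>' \<and> refinement_projection \<V>' \<V> \<phi> \<and>
      (\<forall>c'\<in>simplicial_cycles k (nerve \<V>').
        c - simplicial_chain_map \<phi> c' \<in> simplicial_boundaries k (nerve \<V>) \<longrightarrow>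
        c \<in> simplicial_boundaries k (nerve \<V>))"
      using assms[OF \<U>] by blast
    obtain \<psi> where \<psi>: "refinement_projection \<V> \<U> \<psi>"
      using covering_refines_projection[OF \<V>(2)] .
    obtain c where c: "c \<in> simplicial_cycles k (nerve \<V>)" "a \<V> = nerve_class k \<V> c"
      using cech_class[OF a \<V>(1)] .
    obtain \<V>' \<phi> where \<V>': "open_covering X \<V>'" "refinement_projection \<V>' \<V> \<phi>" and
      **: "\<And>c'. c' \<in> simplicial_cycles k (nerve \<V>') \<Longrightarrow>
        c - simplicial_chain_map \<phi> c' \<in> simplicial_boundaries k (nerve \<V>) \<Longrightarrow>
        c \<in> simplicial_boundaries k (nerve \<V>)"
      using *[OF c(1)] by blast
    obtain c' where c': "c' \<in> simplicial_cycles k (nerve \<V>')" "a \<V>' = nerve_class k \<V>' c'"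
      using cech_class[OF a \<V>'(1)] .
    have "nerve_class k \<V> c = nerve_class k \<V> (simplicial_chain_map \<phi> c')"
      using cech_compatible[OF a \<V>(1) \<V>'] nerve_hom_induced_class[OF \<V>'(2)] c(2) c'(2) by metis
    then have "c \<in> simplicial_boundaries k (nerve \<V>)"
      using **[OF c'(1)] nerve_class_eq_iff by blast
    then have "a \<V> = nerve_class k \<V> 0"
      using c(2) nerve_class_eq_iff[of \<V> k c 0] by simp
    then have "a \<U> = nerve_class k \<U> (simplicial_chain_map \<psi> 0)"
      using cech_compatible[OF a \<U> \<V>(1) \<psi>] nerve_hom_induced_class[OF \<psi>] by metis
    then show ?thesis by (simp add: one_nerve_homology)
  qed
  have carrier: "carrier (cech_homology_group k X) = {\<one>\<^bsub>?P\<^esub>}"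
  proof (intro equalityI subsetI)
    fix a assume a: "a \<in> carrier (cech_homology_group k X)"
    then have "a \<in> (\<Pi>\<^sub>E \<U>\<in>{\<U>. open_covering X \<U>}. carrier (nerve_homology k \<U>))"
      by (simp add: carrier_cech_homology_group)
    then show "a \<in> {\<one>\<^bsub>?P\<^esub>}"
      using vanish[OF a] by (auto simp: fun_eq_iff PiE_def extensional_def)
  next
    fix a assume "a \<in> {\<one>\<^bsub>?P\<^esub>}"
    moreover have "\<one>\<^bsub>?P\<^esub> \<in> carrier ?P" using P by (rule group.is_monoid[THEN monoid.one_closed])
    moreover have "simplicial_hom_induced k (nerve \<U>) \<phi> \<one>\<^bsub>nerve_homology k \<V>\<^esub> = \<one>\<^bsub>nerve_homology k \<U>\<^esub>"
      if "refinement_projection \<V> \<U> \<phi>" for \<U> \<V> \<phi>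
      using nerve_hom_induced_class[OF that, of k 0] by (simp add: one_nerve_homology)
    ultimately show "a \<in> carrier (cech_homology_group k X)"
      unfolding carrier_cech_homology_group by (simp add: carrier_product_group) blast
  qed
  have eq: "\<one>\<^bsub>cech_homology_group k X\<^esub> = \<one>\<^bsub>?P\<^esub>" "mult (cech_homology_group k X) = mult ?P"
    by (simp_all add: cech_homology_group_def Let_def)
  have one: "\<one>\<^bsub>?P\<^esub> \<otimes>\<^bsub>?P\<^esub> \<one>\<^bsub>?P\<^esub> = \<one>\<^bsub>?P\<^esub>"
    using P by (intro monoid.l_one group.is_monoid monoid.one_closed)
  have "group (cech_homology_group k X)"
    by (rule groupI) (simp_all only: carrier eq singleton_iff one simp_thms bex_simps)
  then show ?thesis
    by (simp add: trivial_group_def carrier eq del: one_product_group)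
qed

section \<open>Degree zero for a connected space\<close>

lemma aug_bd_chains_1: "c \<in> aug_chains 1 K \<Longrightarrow> \<exists>n. aug_bd c = frag_cmul n (frag_of [])"
proof (induction rule: aug_chains_induct)
  case zero
  show ?case by (intro exI[of _ 0]) auto
next
  case (one xs)
  then show ?case by (intro exI[of _ 1]) (auto simp: length_Suc_conv)
next
  case (diff a b)
  then show ?case by (metis aug_bd_simps(4) frag_cmul_diff_distrib)
qed

lemma aug_acyclic_1_nerve:
  assumes "connected S" "open_covering (top_of_set S) \<U>"
  shows "aug_acyclic 1 (nerve \<U>)"
proof (rule aug_acyclic_1)
  have *: "\<Union>\<U> = S" "\<And>U. U \<in> \<U> \<Longrightarrow> openin (top_of_set S) U"
    using assms(2) by (auto simp: open_covering_def)
  show "\<exists>e\<in>aug_chains 2 (nerve \<U>). aug_bd e = frag_of [w] - frag_of [v]"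
    if "{v} \<in> nerve \<U>" "{w} \<in> nerve \<U>" for v w
    using that nerve_vertices_joined[of \<U> v w] * assms(1) by (auto simp: nerve_def)
qed

text \<open>Nerves of coverings of a connected space are connected, so a class of degree 0 is
  determined by its augmentation. Refinement maps preserve the augmentation; a compatible family
  therefore amounts to one integer, read off at the covering \<open>{S}\<close>.\<close>

lemma cech_homology_0:
  fixes S :: "'a::topological_space set"
  assumes "connected S" "S \<noteq> {}"
  shows "cech_homology_group 0 (top_of_set S) \<cong> integer_group"
proof -
  let ?X = "top_of_set S"
  let ?I = "{\<U>. open_covering ?X \<U>}"
  define v where "v = (\<lambda>\<U> :: 'a set set. SOME V. V \<in> \<U> \<and> V \<noteq> {})"
  have v: "v \<U> \<in> \<U>" "v \<U> \<noteq> {}" if "open_covering ?X \<U>" for \<U>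
  proof -
    have "\<exists>V. V \<in> \<U> \<and> V \<noteq> {}" using that assms(2) by (auto simp: open_covering_def)
    then show "v \<U> \<in> \<U>" "v \<U> \<noteq> {}" unfolding v_def by (metis (mono_tags, lifting) someI_ex)+
  qed
  have cyc: "frag_cmul n (frag_of [V]) \<in> simplicial_cycles 0 (nerve \<U>)" if "V \<in> \<U>" "V \<noteq> {}" for n \<U> and V :: "'a set"
  proof -
    have "{V} \<in> nerve \<U>" using that by (auto simp: nerve_def)
    then show ?thesis by (auto simp: nerve_cycles_eq aug_chains_def)
  qed
  have bd: "aug_bd (frag_cmul n (frag_of [V])) = frag_cmul n (frag_of [])" for n and V :: "'a set"
    by (simp add: aug_bd_def frag_extend_cmul)
  have same: "nerve_class 0 \<U> c = nerve_class 0 \<U> d"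
    if "open_covering ?X \<U>" "c \<in> simplicial_cycles 0 (nerve \<U>)" "d \<in> simplicial_cycles 0 (nerve \<U>)"
      "aug_bd c = aug_bd d" for \<U> c d
  proof -
    have "c - d \<in> aug_chains 1 (nerve \<U>)" "aug_bd (c - d) = 0"
      using that by (auto simp: nerve_cycles_eq intro: aug_chains_diff)
    then have "\<exists>e\<in>aug_chains (Suc 1) (nerve \<U>). aug_bd e = c - d"
      using aug_acyclic_1_nerve[OF assms(1) that(1)] unfolding aug_acyclic_def by blast
    then show ?thesis
      unfolding nerve_class_eq_iff nerve_boundaries_eq One_nat_def by (metis imageI)
  qed
  have aug_eq: "aug_bd c = aug_bd d" if "nerve_class 0 \<U> c = nerve_class 0 \<U> d" for \<U> and c d :: "'a set list \<Rightarrow>\<^sub>0 int"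
  proof -
    have "aug_bd (c - d) = 0"
      using that unfolding nerve_class_eq_iff nerve_boundaries_eq by (auto simp: aug_bd_aug_bd simp del: aug_bd_simps(4))
    then show ?thesis by simp
  qed
  \<comment> \<open>The vertices \<open>v \<U>\<close> are chosen independently for each covering;
    compatibility holds because all vertices of a nerve are homologous.\<close>
  define \<theta> where "\<theta> = (\<lambda>n. \<lambda>\<U>\<in>?I. nerve_class 0 \<U> (frag_cmul n (frag_of [v \<U>])))"
  have T: "open_covering ?X {S}" by (auto simp: open_covering_def)
  have car: "\<theta> n \<in> carrier (cech_homology_group 0 ?X)" for n
    unfolding carrier_cech_homology_group
  proof (intro CollectI conjI allI impI)
    show "\<theta> n \<in> (\<Pi>\<^sub>E \<U>\<in>?I. carrier (nerve_homology 0 \<U>))"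
      unfolding \<theta>_def using v cyc by (auto simp: carrier_nerve_homology intro!: imageI)
    fix \<U> \<V> \<phi>
    assume *: "open_covering ?X \<U> \<and> open_covering ?X \<V> \<and> covering_refines \<V> \<U> \<and> refinement_projection \<V> \<U> \<phi>"
    then have "simplicial_hom_induced 0 (nerve \<U>) \<phi> (\<theta> n \<V>)
      = nerve_class 0 \<U> (simplicial_chain_map \<phi> (frag_cmul n (frag_of [v \<V>])))"
      using nerve_hom_induced_class by (fastforce simp: \<theta>_def)
    also have "simplicial_chain_map \<phi> (frag_cmul n (frag_of [v \<V>])) = frag_cmul n (frag_of [\<phi> (v \<V>)])"
      by (simp add: simplicial_chain_map_def frag_extend_cmul)
    also have "nerve_class 0 \<U> \<dots> = nerve_class 0 \<U> (frag_cmul n (frag_of [v \<U>]))"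
    proof (rule same)
      have "\<phi> (v \<V>) \<in> \<U>" "\<phi> (v \<V>) \<noteq> {}"
        using * v[of \<V>] by (auto simp: refinement_projection_def)
      then show "frag_cmul n (frag_of [\<phi> (v \<V>)]) \<in> simplicial_cycles 0 (nerve \<U>)" by (rule cyc)
    qed (use * v cyc bd in auto)
    finally show "simplicial_hom_induced 0 (nerve \<U>) \<phi> (\<theta> n \<V>) = \<theta> n \<U>"
      using * by (simp add: \<theta>_def)
  qed
  have hom: "\<theta> (n + m) = \<theta> n \<otimes>\<^bsub>cech_homology_group 0 ?X\<^esub> \<theta> m" for n m
  proof -
    have "mult (cech_homology_group 0 ?X) = mult (product_group ?I (nerve_homology 0))"
      by (simp add: cech_homology_group_def Let_def)
    moreover have "nerve_class 0 \<U> (frag_cmul n (frag_of [v \<U>])) \<otimes>\<^bsub>nerve_homology 0 \<U>\<^esub> nerve_class 0 \<U> (frag_cmul m (frag_of [v \<U>]))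
      = nerve_class 0 \<U> (frag_cmul (n + m) (frag_of [v \<U>]))" if "open_covering ?X \<U>" for \<U>
      unfolding frag_cmul_distrib using v cyc that by (intro mult_nerve_homology) simp_all
    ultimately show ?thesis
      by (simp add: \<theta>_def fun_eq_iff)
  qed
  have inj: "n = m" if "\<theta> n = \<theta> m" for n m
  proof -
    have "\<theta> n {S} = \<theta> m {S}" using that by simp
    then have "frag_cmul n (frag_of []) = frag_cmul m (frag_of ([] :: 'a set list))"
      using T aug_eq[of "{S}"] by (simp add: \<theta>_def bd) (metis bd)
    then have "frag_cmul (n - m) (frag_of ([] :: 'a set list)) = 0"
      by (simp add: frag_cmul_diff_distrib)
    then show ?thesis by (simp add: frag_cmul_eq_0_iff)
  qed
  have surj: "\<exists>n. a = \<theta> n" if a: "a \<in> carrier (cech_homology_group 0 ?X)" for a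
  proof -
    obtain c where c: "c \<in> simplicial_cycles 0 (nerve {S})" "a {S} = nerve_class 0 {S} c"
      using cech_class[OF a T] .
    then obtain n where n: "aug_bd c = frag_cmul n (frag_of [])"
      using aug_bd_chains_1[of c] by (auto simp: nerve_cycles_eq)
    have "a \<U> = \<theta> n \<U>" if \<U>: "open_covering ?X \<U>" for \<U>
    proof -
      obtain d where d: "d \<in> simplicial_cycles 0 (nerve \<U>)" "a \<U> = nerve_class 0 \<U> d"
        using cech_class[OF a \<U>] .
      obtain m where m: "aug_bd d = frag_cmul m (frag_of [])"
        using aug_bd_chains_1[of d] d(1) by (auto simp: nerve_cycles_eq)
      have proj: "refinement_projection \<U> {S} (\<lambda>_. S)"
        using \<U> by (auto simp: refinement_projection_def open_covering_def)
      have "nerve_class 0 {S} (simplicial_chain_map (\<lambda>_. S) d) = nerve_class 0 {S} c"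
        using cech_compatible[OF a T \<U> proj] nerve_hom_induced_class[OF proj] c d by metis
      then have "aug_bd (simplicial_chain_map (\<lambda>_. S) d) = aug_bd c" by (rule aug_eq)
      moreover have "aug_bd (simplicial_chain_map (\<lambda>_. S) d) = frag_cmul m (frag_of [])"
        by (simp add: aug_bd_simplicial_chain_map m) (simp add: simplicial_chain_map_def frag_extend_cmul)
      ultimately have "aug_bd d = aug_bd (frag_cmul n (frag_of [v \<U>]))"
        using m n by (simp add: bd)
      then have "nerve_class 0 \<U> d = nerve_class 0 \<U> (frag_cmul n (frag_of [v \<U>]))"
        using v cyc \<U> d(1) by (intro same) auto
      then show ?thesis using \<U> d(2) by (simp add: \<theta>_def)
    qed
    moreover have "a \<U> = \<theta> n \<U>" if "\<not> open_covering ?X \<U>" for \<U>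
      using that a by (auto simp: carrier_cech_homology_group \<theta>_def PiE_def extensional_def)
    ultimately show ?thesis by blast
  qed
  have "\<theta> \<in> iso integer_group (cech_homology_group 0 ?X)"
    unfolding iso_def hom_def bij_betw_def inj_on_def
    using car hom inj surj by (auto simp: integer_group_def image_iff)
  then show ?thesis
    using group.iso_sym[OF group_integer_group] unfolding is_iso_def by blast
qed

section \<open>The space\<close>

definition pt :: "real \<Rightarrow> real \<Rightarrow> real^2"
  where "pt x y = x *\<^sub>R axis 1 1 + y *\<^sub>R axis 2 1"

text \<open>The distance of u to the set of even integers.\<close>

definition wave :: "real \<Rightarrow> real"
  where "wave u = arccos (cos (pi * u)) / pi"

definition curve :: "real \<Rightarrow> real^2"
  where "curve u = pt (exp (- u)) (wave u)"

definition wave_space :: "(real^2) set"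
  where "wave_space = {z. z$1 > 0 \<and> z$2 = wave (- ln (z$1))} \<union> {z. z$1 = 0 \<and> 0 \<le> z$2 \<and> z$2 < 1/2}"

lemma pt_nth [simp]: "pt x y $ 1 = x" "pt x y $ 2 = y"
  by (simp_all add: pt_def axis_def)

lemma pt_eq_iff: "z = pt x y \<longleftrightarrow> z$1 = x \<and> z$2 = y"
  by (auto simp: vec_eq_iff forall_2)

lemma curve_nth [simp]: "curve u $ 1 = exp (- u)" "curve u $ 2 = wave u"
  by (simp_all add: curve_def)

lemma continuous_wave: "continuous_on S wave"
  unfolding wave_def by (intro continuous_intros) auto

lemma continuous_curve: "continuous_on S curve"
  unfolding curve_def pt_def by (intro continuous_intros continuous_wave)

lemma inj_curve: "inj curve"
  by (rule injI) (metis curve_nth(1) exp_inj_iff neg_equal_iff_equal)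

lemma wave_bounds: "0 \<le> wave u" "wave u \<le> 1"
  by (auto simp: wave_def arccos_lbound arccos_ubound)

lemma wave_eq:
  fixes i :: int
  assumes "\<bar>u - 2 * of_int i\<bar> \<le> 1"
  shows "wave u = \<bar>u - 2 * of_int i\<bar>"
proof -
  define t where "t = pi * \<bar>u - 2 * of_int i\<bar>"
  have t: "0 \<le> t" "t \<le> pi" using assms by (auto simp: t_def)
  have "cos (pi * u) = cos (pi * (u - 2 * of_int i) + 2 * pi * of_int i)"
    by (simp add: algebra_simps)
  also have "\<dots> = cos (pi * (u - 2 * of_int i))"
    by (simp only: cos_add cos_int_2pin sin_int_2pin)
  also have "\<dots> = cos t"
    unfolding t_def by (cases "u - 2 * of_int i \<ge> 0") (simp_all only: abs_of_nonneg abs_of_neg not_le mult_minus_right cos_minus)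
  finally show ?thesis
    using t by (simp add: wave_def arccos_cos t_def)
qed

lemma near_even:
  fixes u :: real
  obtains i :: int where "\<bar>u - 2 * of_int i\<bar> \<le> 1"
proof
  show "\<bar>u - 2 * of_int (round (u / 2))\<bar> \<le> 1"
    using of_int_round_abs_le[of "u / 2"] by (simp add: abs_if split: if_splits)
qed

lemma curve_in_space [simp]: "curve u \<in> wave_space"
  by (simp add: wave_space_def)

lemma limit_in_space [simp]: "pt 0 y \<in> wave_space \<longleftrightarrow> 0 \<le> y \<and> y < 1/2"
  by (simp add: wave_space_def)

lemma wave_space_cases:
  assumes "z \<in> wave_space"
  obtains (curve) u where "z = curve u" | (limit) y where "z = pt 0 y" "0 \<le> y" "y < 1/2"
proof (cases "z$1 > 0")
  case True
  then have "z = curve (- ln (z$1))"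
    using assms by (auto simp: curve_def pt_eq_iff wave_space_def)
  then show ?thesis by (rule curve)
next
  case False
  then have "z = pt 0 (z$2)" "0 \<le> z$2" "z$2 < 1/2"
    using assms by (auto simp: pt_eq_iff wave_space_def)
  then show ?thesis by (rule limit)
qed

text \<open>The space is the intersection of a closed and an open set. \<open>C\<close> is the curve
  with the whole segment from height 0 to height 1 over 0; \<open>O1\<close> cuts away the heights
  from 1/2 on, over the axis only.\<close>

lemma locally_compact_wave_space: "locally_compact_space (top_of_set wave_space)"
proof -
  define C :: "(real^2) set" where "C = {z. 0 \<le> z$1} \<inter> {z. 0 \<le> z$2} \<inter> {z. z$2 \<le> 1} - {z. 0 < z$1 \<and> z$2 \<noteq> wave (- ln (z$1))}"
  define O1 :: "(real^2) set" where "O1 = {z. 0 < z$1} \<union> {z. z$2 < 1/2}"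
  have "open {z :: real^2. 0 < z$1 \<and> z$2 \<noteq> wave (- ln (z$1))}"
  proof -
    have 1: "open {z :: real^2. 0 < z$1}" by (intro open_Collect_less continuous_intros)
    have "continuous_on {z :: real^2. 0 < z$1} (\<lambda>z. z$2 - wave (- ln (z$1)))"
      by (intro continuous_intros continuous_on_compose2[OF continuous_wave[of UNIV]]) auto
    then have "open ({z :: real^2. 0 < z$1} \<inter> (\<lambda>z. z$2 - wave (- ln (z$1))) -` (- {0}))"
      using 1 by (intro continuous_open_preimage) auto
    then show ?thesis by (simp add: vimage_def Int_def)
  qed
  then have "closed C"
    unfolding C_def by (intro closed_Diff closed_Int closed_Collect_le continuous_intros)
  moreover have "open O1"
    unfolding O1_def by (intro open_Un open_Collect_less continuous_intros)
  moreover have "wave_space = C \<inter> O1"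
  proof (intro equalityI subsetI)
    fix z assume "z \<in> wave_space"
    then show "z \<in> C \<inter> O1"
      using wave_bounds by (auto simp: C_def O1_def wave_space_def)
  next
    fix z assume "z \<in> C \<inter> O1"
    then show "z \<in> wave_space" by (auto simp: C_def O1_def wave_space_def)
  qed
  ultimately have "openin (top_of_set C) wave_space"
    by (auto simp: openin_open)
  moreover have "locally_compact_space (top_of_set C)"
    using locally_compact_space_closed_subset[OF locally_compact_space_euclidean] \<open>closed C\<close> by simp
  ultimately have "locally_compact_space (subtopology (top_of_set C) wave_space)"
    using locally_compact_space_open_subset[of "top_of_set C" wave_space]
    by (simp add: Hausdorff_space_subtopology)
  moreover have "wave_space \<subseteq> C" using \<open>wave_space = C \<inter> O1\<close> by blast
  ultimately show ?thesis
    by (simp add: subtopology_subtopology inf.absorb2)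
qed

lemma curve_tendsto_limit:
  assumes "0 \<le> y" "y \<le> 1"
  shows "(\<lambda>n. curve (2 * real n + y)) \<longlonglongrightarrow> pt 0 y"
proof -
  have eq: "curve (2 * real n + y) = pt (exp (- (2 * real n + y))) y" for n
    using wave_eq[of "2 * real n + y" "int n"] assms by (simp add: curve_def)
  have "(\<lambda>n. exp (- (2 * real n + y))) \<longlonglongrightarrow> 0"
    by real_asymp
  then show ?thesis
    unfolding eq pt_def by (intro tendsto_intros)
qed

lemma connected_wave_space: "connected wave_space"
proof (rule connected_intermediate_closure)
  show "connected (range curve)"
    by (intro connected_continuous_image continuous_curve connected_UNIV)
  show "range curve \<subseteq> wave_space" by auto
  show "wave_space \<subseteq> closure (range curve)"
  proof
    fix z assume "z \<in> wave_space"
    then show "z \<in> closure (range curve)"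
    proof (cases rule: wave_space_cases)
      case (limit y)
      then show ?thesis
        unfolding closure_sequential using curve_tendsto_limit[of y]
        by (intro exI[of _ "\<lambda>n. curve (2 * real n + y)"]) auto
    qed (use closure_subset[of "range curve"] in auto)
  qed
qed

subsection \<open>Basic open sets\<close>

text \<open>On the curve the bound on the first coordinate means u > 2 * k - 1. At that cutoff the
  curve has height 1, so for s \<le> 1/2 it severs nothing: the set consists of full pieces around 2
  * i for all i \<ge> k, together with a piece of the limit arc.\<close>

definition limit_nbhd :: "real \<Rightarrow> int \<Rightarrow> real \<Rightarrow> (real^2) set"
  where "limit_nbhd r k s = wave_space \<inter> {z. z$1 < exp (1 - 2 * of_int k) \<and> s - r < z$2 \<and> z$2 < s}"

lemma open_limit_nbhd: "openin (top_of_set wave_space) (limit_nbhd r k s)"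
  unfolding limit_nbhd_def
  by (intro openin_open_Int open_Collect_conj open_Collect_less continuous_intros)

lemma arc_eq: "curve ` {p<..<q} = wave_space \<inter> {z. exp (- q) < z$1 \<and> z$1 < exp (- p)}"
proof (intro equalityI subsetI)
  fix z assume "z \<in> wave_space \<inter> {z. exp (- q) < z$1 \<and> z$1 < exp (- p)}"
  then have z: "z \<in> wave_space" "exp (- q) < z$1" "z$1 < exp (- p)" by auto
  from z(1) show "z \<in> curve ` {p<..<q}"
  proof (cases rule: wave_space_cases)
    case (limit y)
    then show ?thesis using z(2) exp_gt_zero[of "-q"] by (simp del: exp_gt_zero)
  qed (use z in auto)
qed auto

lemma open_arc: "openin (top_of_set wave_space) (curve ` {p<..<q})"
  unfolding arc_eq
  by (intro openin_open_Int open_Collect_conj open_Collect_less continuous_intros)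

lemma limit_in_limit_nbhd:
  assumes "s \<le> 1/2"
  shows "pt 0 y \<in> limit_nbhd r k s \<longleftrightarrow> 0 \<le> y \<and> s - r < y \<and> y < s"
  using assms by (auto simp: limit_nbhd_def)

lemma curve_in_limit_nbhd:
  assumes "s \<le> 1/2"
  shows "curve u \<in> limit_nbhd r k s \<longleftrightarrow>
    (\<exists>i\<ge>k. s - r < \<bar>u - 2 * of_int i\<bar> \<and> \<bar>u - 2 * of_int i\<bar> < s)"
proof
  assume "curve u \<in> limit_nbhd r k s"
  then have u: "2 * of_int k - 1 < u" "s - r < wave u" "wave u < s"
    by (auto simp: limit_nbhd_def)
  obtain i :: int where i: "\<bar>u - 2 * of_int i\<bar> \<le> 1" by (rule near_even)
  then have w: "wave u = \<bar>u - 2 * of_int i\<bar>" by (rule wave_eq)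
  then have "real_of_int k < of_int i + 1" using u assms by linarith
  then have "k \<le> i" by linarith
  then show "\<exists>i\<ge>k. s - r < \<bar>u - 2 * of_int i\<bar> \<and> \<bar>u - 2 * of_int i\<bar> < s"
    using u w by auto
next
  assume "\<exists>i\<ge>k. s - r < \<bar>u - 2 * of_int i\<bar> \<and> \<bar>u - 2 * of_int i\<bar> < s"
  then obtain i where i: "i \<ge> k" "s - r < \<bar>u - 2 * of_int i\<bar>" "\<bar>u - 2 * of_int i\<bar> < s" by blast
  then have "wave u = \<bar>u - 2 * of_int i\<bar>" using assms by (intro wave_eq) auto
  moreover have "real_of_int k \<le> of_int i" using i(1) by simp
  then have "2 * of_int k - 1 < u" using i(3) assms by linarith
  ultimately show "curve u \<in> limit_nbhd r k s"
    using i by (simp add: limit_nbhd_def)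
qed

subsection \<open>Families of basic sets along the limit arc\<close>

text \<open>Vertices are indexed rather than taken as sets, because the order of removal is computed
  from the parameters. The integer of an \<open>Arc\<close> names the even integer 2 * i near which
  it is meant to lie.\<close>

datatype basic_index = Arc int real real | Limit real

text \<open>Thickness \<open>r\<close> and first turn \<open>k\<close> of the limit set with top s.
  They may degenerate as s approaches 1/2, as arbitrary coverings require. Monotonicity makes a
  lower limit set at least as thick and lets it reach at least as many turns.\<close>

locale limit_scale =
  fixes r :: "real \<Rightarrow> real" and k :: "real \<Rightarrow> int"
  assumes r_pos: "\<And>s. 0 < s \<Longrightarrow> s < 1/2 \<Longrightarrow> 0 < r s"
    and r_anti: "\<And>s t. 0 < s \<Longrightarrow> s \<le> t \<Longrightarrow> t < 1/2 \<Longrightarrow> r t \<le> r s"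
    and k_mono: "\<And>s t. 0 < s \<Longrightarrow> s \<le> t \<Longrightarrow> t < 1/2 \<Longrightarrow> k s \<le> k t"
begin

fun basic_set :: "basic_index \<Rightarrow> (real^2) set"
  where
    "basic_set (Arc i p q) = curve ` {p<..<q}"
  | "basic_set (Limit s) = limit_nbhd (r s) (k s) s"

text \<open>The radius 3/4 leaves room for a neighbourhood of the crossings of height 1/2, while
  windows around different even integers stay disjoint.\<close>

fun hump_index :: "basic_index \<Rightarrow> bool"
  where
    "hump_index (Arc i p q) \<longleftrightarrow> p < q \<and> 2 * of_int i - 3/4 \<le> p \<and> q \<le> 2 * of_int i + 3/4"
  | "hump_index (Limit s) \<longleftrightarrow> 0 < s \<and> s < 1/2"

text \<open>
  Vertices are removed from a nerve in the order of decreasing depth, the distance to the end of the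
  limit arc. The values below 0 make the limit sets that reach this end the last ones to go.
\<close>

fun depth :: "basic_index \<Rightarrow> real"
  where
    "depth (Arc i p q) = (if p < 2 * of_int i \<and> 2 * of_int i < q then -1
      else min \<bar>p - 2 * of_int i\<bar> \<bar>q - 2 * of_int i\<bar>)"
  | "depth (Limit s) = (if s - r s < 0 then -2 else s - r s)"

text \<open>The height s - r s / 2 is the middle of the slab from s - r s to s. The limit set with
  this top reaches below s - r s and is the apex of the link when \<open>Limit s\<close> is removed.
  Sets with r s > s contain the origin and are handled through this point instead.\<close>

definition limit_closed :: "basic_index set \<Rightarrow> bool"
  where "limit_closed I \<longleftrightarrow> (\<forall>s. Limit s \<in> I \<longrightarrow> r s \<le> s \<longrightarrow> Limit (s - r s / 2) \<in> I)"

lemma limit_successor: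
  assumes "0 < s" "s < 1/2" "r s \<le> s"
  shows "0 < s - r s / 2" "s - r s / 2 < s" "s - r s / 2 - r (s - r s / 2) < s - r s"
    "k (s - r s / 2) \<le> k s"
proof -
  have "0 < r s" using assms r_pos by simp
  then show *: "0 < s - r s / 2" "s - r s / 2 < s" using assms by auto
  then have "r s \<le> r (s - r s / 2)" using assms by (intro r_anti) auto
  then show "s - r s / 2 - r (s - r s / 2) < s - r s" using \<open>0 < r s\<close> by linarith
  show "k (s - r s / 2) \<le> k s" using * assms by (intro k_mono) auto
qed

text \<open>Each successor lies lower by at least half the thickness at the starting height, since
  \<open>r\<close> can only grow on the way down. The descent therefore stops, at a height exceeded
  by its thickness.\<close>

lemma limit_closure_finite:
  assumes "0 < s" "s < 1/2"
  shows "\<exists>T. finite T \<and> s \<in> T \<and> T \<subseteq> {0<..<1/2} \<and> limit_closed (Limit ` T)"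
proof -
  define c where "c = r s / 2"
  have "c > 0" using r_pos assms by (simp add: c_def)
  have "\<exists>T. finite T \<and> t \<in> T \<and> T \<subseteq> {0<..<1/2} \<and> limit_closed (Limit ` T)"
    if "0 < t" "t < 1/2" "t \<le> real n * c" "2 * c \<le> r t" for n t
    using that
  proof (induction n arbitrary: t)
    case 0
    then show ?case by simp
  next
    case (Suc n)
    show ?case
    proof (cases "r t \<le> t")
      case False
      then show ?thesis
        using Suc.prems by (intro exI[of _ "{t}"]) (auto simp: limit_closed_def)
    next
      case True
      let ?t = "t - r t / 2"
      have *: "0 < ?t" "?t < t" using limit_successor[OF Suc.prems(1,2) True] by auto
      have "?t \<le> real n * c" using Suc.prems by (simp add: algebra_simps)
      moreover have "2 * c \<le> r ?t" using r_anti[of ?t t] * Suc.prems by linarith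
      ultimately obtain T where "finite T" "?t \<in> T" "T \<subseteq> {0<..<1/2}" "limit_closed (Limit ` T)"
        using Suc.IH[of ?t] * Suc.prems by auto
      then show ?thesis
        using Suc.prems by (intro exI[of _ "insert t T"]) (auto simp: limit_closed_def)
    qed
  qed
  moreover obtain n where "s \<le> real n * c"
    using real_arch_simple[of "s / c"] \<open>c > 0\<close> by (auto simp: pos_divide_le_eq)
  moreover have "2 * c \<le> r s" by (simp add: c_def)
  ultimately show ?thesis using assms by blast
qed

lemma finite_limit_closed:
  assumes "finite I" "\<forall>x\<in>I. hump_index x"
  shows "\<exists>T. finite T \<and> T \<subseteq> {0<..<1/2} \<and> limit_closed (I \<union> Limit ` T)"
proof -
  define S where "S = {s. Limit s \<in> I}"
  have "S = Limit -` I" by (auto simp: S_def)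
  then have "finite S" using assms(1) by (simp add: finite_vimageI inj_def)
  have "\<forall>s\<in>S. \<exists>T. finite T \<and> s \<in> T \<and> T \<subseteq> {0<..<1/2} \<and> limit_closed (Limit ` T)"
    using assms(2) limit_closure_finite by (fastforce simp: S_def)
  then obtain T where T: "\<And>s. s \<in> S \<Longrightarrow> finite (T s) \<and> s \<in> T s \<and> T s \<subseteq> {0<..<1/2} \<and> limit_closed (Limit ` T s)"
    by metis
  have "limit_closed (I \<union> Limit ` (\<Union>s\<in>S. T s))"
    unfolding limit_closed_def
  proof (intro allI impI)
    fix s assume *: "Limit s \<in> I \<union> Limit ` (\<Union>s\<in>S. T s)" "r s \<le> s"
    then obtain t where t: "t \<in> S" "s \<in> T t" using T by (auto simp: S_def)
    then have "Limit (s - r s / 2) \<in> Limit ` T t"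
      using T[OF t(1)] *(2) unfolding limit_closed_def by blast
    then show "Limit (s - r s / 2) \<in> I \<union> Limit ` (\<Union>s\<in>S. T s)" using t by blast
  qed
  then show ?thesis using T \<open>finite S\<close> by (intro exI[of _ "\<Union>s\<in>S. T s"]) auto
qed

section \<open>Membership in basic sets and removal of their vertices\<close>

lemma curve_in_basic_set:
  "curve u \<in> basic_set (Arc i p q) \<longleftrightarrow> p < u \<and> u < q"
  "s \<le> 1/2 \<Longrightarrow> curve u \<in> basic_set (Limit s) \<longleftrightarrow>
    (\<exists>i\<ge>k s. s - r s < \<bar>u - 2 * of_int i\<bar> \<and> \<bar>u - 2 * of_int i\<bar> < s)"
  using inj_image_mem_iff[OF inj_curve] by (auto simp: curve_in_limit_nbhd)

lemma limit_in_basic_set: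
  "pt 0 y \<notin> basic_set (Arc i p q)"
  "s \<le> 1/2 \<Longrightarrow> pt 0 y \<in> basic_set (Limit s) \<longleftrightarrow> 0 \<le> y \<and> s - r s < y \<and> y < s"
proof -
  show "pt 0 y \<notin> basic_set (Arc i p q)"
    by (auto simp: pt_eq_iff curve_def)
qed (auto simp: limit_in_limit_nbhd)

lemma basic_set_in_space: "z \<in> basic_set x \<Longrightarrow> z \<in> wave_space"
  by (cases x) (auto simp: limit_nbhd_def)

lemma hump_unique:
  fixes i j :: int and u :: real
  assumes "\<bar>u - 2 * of_int i\<bar> \<le> 3/4" "\<bar>u - 2 * of_int j\<bar> \<le> 3/4"
  shows "i = j"
proof -
  have "\<bar>real_of_int i - of_int j\<bar> < 1" using assms by linarith
  then show ?thesis by linarith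
qed

lemma arc_meets_cases:
  assumes x: "hump_index (Arc i p q)" and y: "hump_index y"
    and "basic_set y \<inter> basic_set (Arc i p q) \<noteq> {}"
  obtains u p' q' where "p < u" "u < q" "y = Arc i p' q'" "p' < u" "u < q'"
        "p' < q'" "2 * of_int i - 3/4 \<le> p'" "q' \<le> 2 * of_int i + 3/4"
  | u s where "p < u" "u < q" "y = Limit s" "0 < s" "s < 1/2" "k s \<le> i"
      "s - r s < \<bar>u - 2 * of_int i\<bar>" "\<bar>u - 2 * of_int i\<bar> < s"
proof -
  obtain u where u: "p < u" "u < q" "curve u \<in> basic_set y"
    using assms(3) by auto
  have "2 * of_int i - 3/4 \<le> p" "q \<le> 2 * of_int i + 3/4" using x by simp_all
  then have ui: "\<bar>u - 2 * of_int i\<bar> \<le> 3/4" using u by linarith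
  show ?thesis
  proof (cases y)
    case (Arc j p' q')
    then have "p' < u" "u < q'" using u(3) curve_in_basic_set(1) by auto
    moreover have "2 * of_int j - 3/4 \<le> p'" "q' \<le> 2 * of_int j + 3/4" using y Arc by simp_all
    then have "\<bar>u - 2 * of_int j\<bar> \<le> 3/4" using calculation by linarith
    then have "j = i" using hump_unique ui by blast
    ultimately show ?thesis using that(1)[of u p' q'] u y Arc by auto
  next
    case (Limit s)
    then obtain j where j: "j \<ge> k s" "s - r s < \<bar>u - 2 * of_int j\<bar>" "\<bar>u - 2 * of_int j\<bar> < s"
      using u(3) y curve_in_basic_set(2)[of s u] by auto
    have "\<bar>u - 2 * of_int j\<bar> \<le> 3/4" using j y Limit by auto
    then have "j = i" using hump_unique ui by blast
    then show ?thesis using that(2)[of u s] u y Limit j by auto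
  qed
qed

text \<open>The germ is taken at the end of the arc facing 2 * i, or at 2 * i itself if the arc
  contains it. A neighbour missing this germ would begin further from 2 * i and so have greater
  depth.\<close>

lemma higher_acyclic_remove_arc:
  assumes ac: "higher_acyclic (nerve (basic_set ` (I - {x})))" and x: "x \<in> I" "x = Arc i p q"
    and I: "\<And>y. y \<in> I \<Longrightarrow> hump_index y" and max: "\<And>y. y \<in> I \<Longrightarrow> depth y \<le> depth x"
  shows "higher_acyclic (nerve (basic_set ` I))"
proof -
  define m where "m = 2 * real_of_int i"
  have hx: "hump_index (Arc i p q)" using I[OF x(1)] x(2) by simp
  then have pq: "p < q" "m - 3/4 \<le> p" "q \<le> m + 3/4" by (simp_all add: m_def)
  note remove = higher_acyclic_nerve_remove_germ[OF ac x(1)]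
  consider "m \<le> p" | "q \<le> m" | "p < m" "m < q" by linarith
  then show ?thesis
  proof cases
    case 1
    have dx: "depth x = p - m" using 1 pq by (simp add: x(2) m_def[symmetric])
    have germ: "eventually (\<lambda>u. a < u \<and> u < b) (at_right p)" if "a \<le> p" "p < b" for a b
      using eventually_at_right_real[OF that(2)] that(1) by (auto elim!: eventually_mono)
    show ?thesis
    proof (rule remove[of "filtermap curve (at_right p)"])
      show "eventually (\<lambda>z. z \<in> basic_set x) (filtermap curve (at_right p))"
        using germ[of p q] pq by (simp add: x(2) eventually_filtermap curve_in_basic_set del: basic_set.simps)
      fix y assume y: "y \<in> I" "basic_set y \<inter> basic_set x \<noteq> {}"
      have dy: "depth y \<le> p - m" using max[OF y(1)] dx by simp
      show "eventually (\<lambda>z. z \<in> basic_set y) (filtermap curve (at_right p))"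
        using hx I[OF y(1)] y(2)[unfolded x(2)]
      proof (cases rule: arc_meets_cases)
        case (1 u p' q')
        have "p' \<le> p"
        proof (rule ccontr)
          assume "\<not> p' \<le> p"
          then have "depth y = p' - m" using 1 \<open>m \<le> p\<close> by (simp add: m_def[symmetric])
          then show False using dy \<open>\<not> p' \<le> p\<close> by simp
        qed
        then show ?thesis
          using germ[of p' q'] 1 by (simp add: eventually_filtermap curve_in_basic_set del: basic_set.simps)
      next
        case (2 u s)
        have u: "\<bar>u - m\<bar> = u - m" using 2 \<open>m \<le> p\<close> by simp
        \<comment> \<open>The depth is -2 only if s - r s < 0, so the bound holds in that case as
          well.\<close>
        have lower: "s - r s \<le> p - m" using dy 2 \<open>m \<le> p\<close> by (auto split: if_splits)
        have "p < m + s" using 2 u by (simp add: m_def)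
        from germ[OF order_refl this] show ?thesis
          unfolding eventually_filtermap
          by eventually_elim (use 2 lower \<open>m \<le> p\<close> in \<open>auto simp: curve_in_basic_set m_def simp del: basic_set.simps intro!: exI[of _ i]\<close>)
      qed
    qed (simp add: filtermap_bot_iff)
  next
    case 2
    have dx: "depth x = m - q" using 2 pq by (simp add: x(2) m_def[symmetric])
    have germ: "eventually (\<lambda>u. a < u \<and> u < b) (at_left q)" if "a < q" "q \<le> b" for a b
      using eventually_at_left_real[OF that(1)] that(2) by (auto elim!: eventually_mono)
    show ?thesis
    proof (rule remove[of "filtermap curve (at_left q)"])
      show "eventually (\<lambda>z. z \<in> basic_set x) (filtermap curve (at_left q))"
        using germ[of p q] pq by (simp add: x(2) eventually_filtermap curve_in_basic_set del: basic_set.simps)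
      fix y assume y: "y \<in> I" "basic_set y \<inter> basic_set x \<noteq> {}"
      have dy: "depth y \<le> m - q" using max[OF y(1)] dx by simp
      show "eventually (\<lambda>z. z \<in> basic_set y) (filtermap curve (at_left q))"
        using hx I[OF y(1)] y(2)[unfolded x(2)]
      proof (cases rule: arc_meets_cases)
        case (1 u p' q')
        have "q \<le> q'"
        proof (rule ccontr)
          assume "\<not> q \<le> q'"
          then have "depth y = m - q'" using 1 \<open>q \<le> m\<close> by (simp add: m_def[symmetric])
          then show False using dy \<open>\<not> q \<le> q'\<close> by simp
        qed
        then show ?thesis
          using germ[of p' q'] 1 by (simp add: eventually_filtermap curve_in_basic_set del: basic_set.simps)
      next
        case (2 u s)
        have u: "\<bar>u - m\<bar> = m - u" using 2 \<open>q \<le> m\<close> by simp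
        have lower: "s - r s \<le> m - q" using dy 2 \<open>q \<le> m\<close> by (auto split: if_splits)
        have "m - s < q" using 2 u by (simp add: m_def)
        from germ[OF this order_refl] show ?thesis
          unfolding eventually_filtermap
          by eventually_elim (use 2 lower \<open>q \<le> m\<close> in \<open>auto simp: curve_in_basic_set m_def simp del: basic_set.simps intro!: exI[of _ i]\<close>)
      qed
    qed (simp add: filtermap_bot_iff)
  next
    case 3
    have dx: "depth x = -1" using 3 by (simp add: x(2) m_def)
    show ?thesis
    proof (rule remove[of "principal {curve m}"])
      show "eventually (\<lambda>z. z \<in> basic_set x) (principal {curve m})"
        using 3 by (simp add: x(2) eventually_principal)
      fix y assume y: "y \<in> I" "basic_set y \<inter> basic_set x \<noteq> {}"
      have dy: "depth y \<le> -1" using max[OF y(1)] dx by simp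
      show "eventually (\<lambda>z. z \<in> basic_set y) (principal {curve m})"
        using hx I[OF y(1)] y(2)[unfolded x(2)]
      proof (cases rule: arc_meets_cases)
        case (1 u p' q')
        then have "p' < m \<and> m < q'" using dy by (auto simp: m_def split: if_splits)
        then show ?thesis using 1 by (simp add: eventually_principal)
      next
        case (2 u s)
        then have "s - r s < 0" using dy by (auto split: if_splits)
        then have "curve m \<in> basic_set y"
          using 2 by (auto simp: curve_in_basic_set m_def simp del: basic_set.simps intro!: exI[of _ i])
        then show ?thesis by (simp add: eventually_principal)
      qed
    qed (simp add: principal_eq_bot_iff)
  qed
qed

text \<open>The limit set has pieces on the limit arc and on infinitely many turns, so its
  neighbours need not share a germ. Given a simplex of the link, the branch through one of its
  points is followed down to the height b = s - r s. Maximality of the depth keeps all members of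
  the simplex present just above b, and the successor \<open>Limit t\<close> is present there on
  every branch; it is therefore an apex.\<close>

lemma higher_acyclic_remove_limit:
  assumes ac: "higher_acyclic (nerve (basic_set ` (I - {x})))" and x: "x \<in> I" "x = Limit s" "r s \<le> s"
    and I: "\<And>y. y \<in> I \<Longrightarrow> hump_index y" and max: "\<And>y. y \<in> I \<Longrightarrow> depth y \<le> depth x"
    and closed: "limit_closed I"
  shows "higher_acyclic (nerve (basic_set ` I))"
proof (cases "\<exists>y\<in>I - {x}. basic_set y = basic_set x")
  case True
  then have "basic_set x \<in> basic_set ` (I - {x})" by (metis imageI)
  then have "basic_set ` (I - {x}) = basic_set ` I" using x by blast
  then show ?thesis using ac by simp
next
  case False
  then have F: "basic_set ` (I - {x}) = basic_set ` I - {basic_set x}" by blast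
  have s: "0 < s" "s < 1/2" using I[OF x(1)] x(2) by auto
  have "0 < r s" using r_pos s by simp
  define b where "b = s - r s"
  have b: "0 \<le> b" "b < s" using x(3) \<open>0 < r s\<close> by (auto simp: b_def)
  have dx: "depth x = b" using x by (simp add: b_def)
  define t where "t = s - r s / 2"
  have t: "0 < t" "t < s" "t - r t < b" "k t \<le> k s" "b < t"
    using limit_successor[OF s x(3)] \<open>0 < r s\<close> by (auto simp: t_def b_def)
  have w: "Limit t \<in> I" using closed x unfolding limit_closed_def t_def by blast
  have germ: "eventually (\<lambda>y. a < y \<and> y < c) (at_right b)" if "a \<le> b" "b < c" for a c
    using eventually_at_right_real[OF that(2)] that(1) by (auto elim!: eventually_mono)
  have upper: "s' - r s' \<le> b" if "Limit s' \<in> I" for s'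
    using max[OF that] dx b(1) by (auto split: if_splits)
  show ?thesis
  proof (rule higher_acyclic_nerve_remove)
    have mem: "pt 0 ((b + s) / 2) \<in> basic_set x"
      using s b by (simp add: x(2) limit_in_basic_set b_def del: basic_set.simps)
    then show "basic_set x \<noteq> {}" by blast
    have "basic_set (Limit t) \<noteq> basic_set x"
      using False w t(2) x(2) by blast
    then have wI: "basic_set (Limit t) \<in> basic_set ` I - {basic_set x}" using w by blast
    have "\<Inter>\<sigma> \<inter> basic_set x \<inter> basic_set (Limit t) \<noteq> {}"
      if \<sigma>: "finite \<sigma>" "\<sigma> \<subseteq> basic_set ` I - {basic_set x}" "\<Inter>\<sigma> \<inter> basic_set x \<noteq> {}" for \<sigma>
    proof -
      obtain z where z: "z \<in> \<Inter>\<sigma>" "z \<in> basic_set x" using \<sigma>(3) by blast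
      have zI: "\<exists>y\<in>I. v = basic_set y \<and> z \<in> basic_set y" if "v \<in> \<sigma>" for v
        using \<sigma>(2) z(1) that by blast
      \<comment> \<open>\<open>f\<close> runs along the branch through z, parametrised by height:
        the limit arc, or one side of one turn.\<close>
      obtain f where f: "\<And>v. v \<in> insert (basic_set (Limit t)) (insert (basic_set x) \<sigma>) \<Longrightarrow>
          eventually (\<lambda>y. f y \<in> v) (at_right b)"
      proof -
        from z(2) have "z \<in> wave_space" by (rule basic_set_in_space)
        then show ?thesis
        proof (cases rule: wave_space_cases)
          case (limit y)
          then have y: "b < y" "y < s" using z(2) s by (auto simp: x(2) limit_in_basic_set b_def simp del: basic_set.simps)
          have *: "eventually (\<lambda>y. pt 0 y \<in> basic_set (Limit s')) (at_right b)"
            if "0 < s'" "s' < 1/2" "s' - r s' \<le> b" "b < s'" for s'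
            using germ[OF that(3,4)] germ[OF order_refl that(4)]
            by eventually_elim (use that b(1) in \<open>auto simp: limit_in_basic_set simp del: basic_set.simps\<close>)
          have **: "eventually (\<lambda>y. pt 0 y \<in> basic_set (Limit s')) (at_right b)"
            if "Limit s' \<in> I" "pt 0 y \<in> basic_set (Limit s')" for s'
            using that I[OF that(1)] upper[OF that(1)] y by (intro *) (auto simp: limit_in_basic_set simp del: basic_set.simps)
          have "eventually (\<lambda>y. pt 0 y \<in> v) (at_right b)" if "v \<in> \<sigma>" for v
          proof -
            obtain j where j: "j \<in> I" "v = basic_set j" "z \<in> basic_set j" using zI \<open>v \<in> \<sigma>\<close> by blast
            show ?thesis
            proof (cases j)
              case (Limit s')
              then show ?thesis using ** j limit by blast
            qed (use j limit limit_in_basic_set in auto)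
          qed
          then show ?thesis
            using that[of "pt 0"] *[of t] *[of s] t b s x(2) by (auto simp: b_def simp del: basic_set.simps)
        next
          case (curve u)
          then obtain i where i: "k s \<le> i" "b < \<bar>u - 2 * of_int i\<bar>" "\<bar>u - 2 * of_int i\<bar> < s"
            using z(2) s by (auto simp: x(2) curve_in_basic_set b_def simp del: basic_set.simps)
          define m where "m = 2 * real_of_int i"
          \<comment> \<open>The side of the turn on which u lies; u \<noteq> m because \<bar>u -
            m\<bar> > b \<ge> 0.\<close>
          define e :: real where "e = (if m < u then 1 else -1)"
          have e: "\<bar>e * y\<bar> = \<bar>y\<bar>" for y by (simp add: e_def abs_mult)
          have ue: "u = m + e * \<bar>u - m\<bar>" by (simp add: e_def)
          have *: "eventually (\<lambda>y. curve (m + e * y) \<in> basic_set (Limit s')) (at_right b)"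
            if "0 < s'" "s' < 1/2" "s' - r s' \<le> b" "b < s'" "k s' \<le> i" for s'
            using germ[OF that(3,4)] germ[of b s', OF order_refl that(4)]
            by eventually_elim
              (use that b(1) in \<open>auto simp: curve_in_basic_set m_def e simp del: basic_set.simps intro!: exI[of _ i]\<close>)
          have "eventually (\<lambda>y. curve (m + e * y) \<in> v) (at_right b)" if "v \<in> \<sigma>" for v
          proof -
            obtain j where j: "j \<in> I" "v = basic_set j" "z \<in> basic_set j" using zI \<open>v \<in> \<sigma>\<close> by blast
            show ?thesis
            proof (cases j)
              case (Limit s')
              then have s': "0 < s'" "s' < 1/2" using I[OF j(1)] by auto
              obtain i' where i': "k s' \<le> i'" "\<bar>u - 2 * of_int i'\<bar> < s'"
                using j(3) s' by (auto simp: curve Limit curve_in_basic_set simp del: basic_set.simps)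
              have "i' = i" using hump_unique[of u i' i] i' i s s' by auto
              then show ?thesis
                using *[of s'] s' upper[of s'] j Limit i i' by auto
            next
              case (Arc i' p q)
              then have pq: "p < u" "u < q" "2 * of_int i' - 3/4 \<le> p" "q \<le> 2 * of_int i' + 3/4"
                using I[OF j(1)] j(3) by (auto simp: curve curve_in_basic_set simp del: basic_set.simps)
              have "i' = i" using hump_unique[of u i' i] pq i s by auto
              then have dj: "depth (Arc i p q) \<le> b" using max[OF j(1)] dx Arc by simp
              show ?thesis
              proof (cases "m < u")
                case True
                have "p \<le> m + b"
                  using dj pq True b(1) by (auto simp: m_def[symmetric] min_def split: if_splits)
                moreover have "m + b < q" using i pq True by (simp add: m_def)
                ultimately have "p - m \<le> b" "b < q - m" by auto
                from germ[OF this] show ?thesis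
                  by eventually_elim (use True j(2) Arc in \<open>auto simp: curve_in_basic_set e_def simp del: basic_set.simps\<close>)
              next
                case False
                then have "u < m" using i b(1) by (auto simp: m_def)
                have "m - b \<le> q"
                  using dj pq \<open>u < m\<close> b(1) by (auto simp: m_def[symmetric] min_def split: if_splits)
                moreover have "p < m - b" using i pq \<open>u < m\<close> by (simp add: m_def)
                ultimately have "m - q \<le> b" "b < m - p" by auto
                from germ[OF this] show ?thesis
                  by eventually_elim (use False j(2) Arc in \<open>auto simp: curve_in_basic_set e_def simp del: basic_set.simps\<close>)
              qed
            qed
          qed
          then show ?thesis
            using that[of "\<lambda>y. curve (m + e * y)"] *[of t] *[of s] t b s i x(2) by (auto simp: b_def simp del: basic_set.simps)
        qed
      qed
      have "eventually (\<lambda>y. \<forall>v\<in>insert (basic_set (Limit t)) (insert (basic_set x) \<sigma>). f y \<in> v) (at_right b)"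
        using \<sigma>(1) f by (intro eventually_ball_finite) auto
      then obtain y where "\<forall>v\<in>insert (basic_set (Limit t)) (insert (basic_set x) \<sigma>). f y \<in> v"
        using eventually_happens'[OF trivial_limit_at_right_real] by blast
      then show ?thesis by blast
    qed
    then show "(\<forall>w\<in>basic_set ` I - {basic_set x}. w \<inter> basic_set x = {}) \<or>
      (\<exists>w\<in>basic_set ` I - {basic_set x}. \<forall>\<sigma>. finite \<sigma> \<longrightarrow> \<sigma> \<subseteq> basic_set ` I - {basic_set x} \<longrightarrow>
        \<Inter>\<sigma> \<inter> basic_set x \<noteq> {} \<longrightarrow> \<Inter>\<sigma> \<inter> basic_set x \<inter> w \<noteq> {})"
      using wI by (intro disjI2 bexI[of _ "basic_set (Limit t)"] allI impI)
  qed (use ac F x(1) in auto)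
qed

text \<open>A vertex of maximal depth is removed. Successors have strictly smaller depth, so it is
  not the successor of a remaining limit set and the family stays closed.\<close>

lemma higher_acyclic_finite_hump:
  assumes "finite I" "\<And>y. y \<in> I \<Longrightarrow> hump_index y" "limit_closed I"
  shows "higher_acyclic (nerve (basic_set ` I))"
  using assms
proof (induction "card I" arbitrary: I)
  case 0
  then show ?case by (simp add: higher_acyclic_nerve_empty)
next
  case (Suc n)
  then have "I \<noteq> {}" by auto
  then have "Max (depth ` I) \<in> depth ` I"
    using Suc.prems(1) by (intro Max_in) auto
  then obtain x where "x \<in> I" "depth x = Max (depth ` I)" by force
  then have x: "x \<in> I" "\<And>y. y \<in> I \<Longrightarrow> depth y \<le> depth x"
    using Suc.prems(1) by auto
  have "limit_closed (I - {x})"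
    unfolding limit_closed_def
  proof (intro allI impI)
    fix s assume s: "Limit s \<in> I - {x}" "r s \<le> s"
    then have *: "0 < s" "s < 1/2" using Suc.prems(2)[of "Limit s"] by auto
    have "depth (Limit (s - r s / 2)) < depth (Limit s)"
      using limit_successor[OF * s(2)] s(2) by auto
    then have "Limit (s - r s / 2) \<noteq> x" using x(2)[of "Limit s"] s(1) by auto
    then show "Limit (s - r s / 2) \<in> I - {x}"
      using Suc.prems(3) s unfolding limit_closed_def by blast
  qed
  then have ac: "higher_acyclic (nerve (basic_set ` (I - {x})))"
    using Suc x(1) by (intro Suc.hyps(1)) auto
  show ?case
  proof (cases x)
    case (Arc i p q)
    then show ?thesis using higher_acyclic_remove_arc[OF ac x(1)] Suc.prems(2) x(2) by blast
  next
    case (Limit s)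
    show ?thesis
    proof (cases "r s \<le> s")
      case True
      then show ?thesis
        using higher_acyclic_remove_limit[OF ac x(1) Limit] Suc.prems(2,3) x(2) by blast
    next
      case False
      \<comment> \<open>The maximal depth is -2, while arcs have depth at least -1: only limit sets
        through the origin are left.\<close>
      have "pt 0 0 \<in> basic_set y" if y: "y \<in> I" for y
      proof -
        have "depth y \<le> -2" using x(2)[OF y] Limit False by auto
        then show ?thesis
          using Suc.prems(2)[OF y]
          by (cases y) (auto simp: limit_in_basic_set min_def simp del: basic_set.simps split: if_splits)
      qed
      then show ?thesis
        using x(1) by (intro higher_acyclic_nerve_remove_germ[OF ac, where G = "principal {pt 0 0}"])
          (auto simp: eventually_principal principal_eq_bot_iff)
    qed
  qed
qed

text \<open>With all limit sets present, every finite subfamily can be closed under successors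
  inside \<open>I\<close>.\<close>

lemma higher_acyclic_hump:
  assumes I: "\<And>y. y \<in> I \<Longrightarrow> hump_index y" and limits: "Limit ` {0<..<1/2} \<subseteq> I"
  shows "higher_acyclic (nerve (basic_set ` I))"
proof (rule higher_acyclic_nerve_directed)
  fix F assume "finite F" "F \<subseteq> basic_set ` I"
  then obtain J where J: "J \<subseteq> I" "finite J" "F = basic_set ` J"
    using finite_subset_image by metis
  then obtain T where T: "finite T" "T \<subseteq> {0<..<1/2}" "limit_closed (J \<union> Limit ` T)"
    using finite_limit_closed[of J] I by blast
  then have "J \<union> Limit ` T \<subseteq> I" using J limits by blast
  moreover have "higher_acyclic (nerve (basic_set ` (J \<union> Limit ` T)))"
    using calculation T J I by (intro higher_acyclic_finite_hump) auto
  ultimately show "\<exists>F'. F \<subseteq> F' \<and> F' \<subseteq> basic_set ` I \<and> higher_acyclic (nerve F')"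
    using J(3) by (intro exI[of _ "basic_set ` (J \<union> Limit ` T)"]) auto
qed

end

section \<open>Fine coverings\<close>

lemma higher_acyclic_2D:
  assumes "higher_acyclic K" "c \<in> aug_chains 2 K" "aug_bd c = 0"
  shows "\<exists>d\<in>aug_chains 3 K. aug_bd d = c"
proof -
  have "aug_acyclic 2 K" using assms(1) by (simp add: higher_acyclic_def)
  then show ?thesis using assms(2,3) unfolding aug_acyclic_def by (simp add: numeral_3_eq_3 numeral_2_eq_2)
qed

abbreviation wave_topology :: "(real^2) topology"
  where "wave_topology \<equiv> top_of_set wave_space"

text \<open>Windows have radius 1/2 around an integer or radius 1/4 around a half-integer, where the
  curve has height 1/2. An arc of the first kind never crosses that height, one of the second kind
  stays near a single crossing.\<close>

definition small_arc :: "real \<Rightarrow> real \<Rightarrow> bool"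
  where "small_arc p q \<longleftrightarrow> p < q \<and> (\<exists>j::int. of_int j - 1/2 \<le> p \<and> q \<le> of_int j + 1/2 \<or>
    of_int j + 1/4 \<le> p \<and> q \<le> of_int j + 3/4)"

text \<open>All small arcs inside members of \<U> are taken, not a selection; thus the arcs within a
  window still cover it, and unions of such families correspond to disjunctions of conditions
  \<open>P\<close>.\<close>

definition arc_sets :: "(real \<Rightarrow> real \<Rightarrow> bool) \<Rightarrow> (real^2) set set \<Rightarrow> (real^2) set set"
  where "arc_sets P \<U> = {curve ` {p<..<q} | p q. P p q \<and> small_arc p q \<and> (\<exists>U\<in>\<U>. curve ` {p<..<q} \<subseteq> U)}"

definition limit_sets :: "(real \<Rightarrow> real) \<Rightarrow> (real \<Rightarrow> int) \<Rightarrow> (real^2) set set"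
  where "limit_sets r k = (\<lambda>s. limit_nbhd (r s) (k s) s) ` {0<..<1/2}"

section \<open>From an arbitrary covering to a fine one\<close>

lemma limit_nbhd_mono: "k \<le> k' \<Longrightarrow> limit_nbhd r k' s \<subseteq> limit_nbhd r k s"
proof -
  assume "k \<le> k'"
  then have "exp (1 - 2 * real_of_int k') \<le> exp (1 - 2 * of_int k)" by simp
  then show ?thesis unfolding limit_nbhd_def by (auto intro: less_le_trans)
qed

text \<open>The arc up to a height s < 1/2 is compact and so has a Lebesgue number for \<U>; up to
  1/2 there is no uniform one in general.\<close>

lemma small_neighbourhoods:
  assumes "open_covering wave_topology \<U>" "0 \<le> s" "s < 1/2"
  shows "\<exists>\<delta>>0. \<delta> \<le> 1 \<and> (\<forall>y. 0 \<le> y \<and> y \<le> s \<longrightarrow> (\<exists>U\<in>\<U>. ball (pt 0 y) \<delta> \<inter> wave_space \<subseteq> U))"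
proof -
  define \<G> where "\<G> = {G. open G \<and> (\<exists>U\<in>\<U>. wave_space \<inter> G \<subseteq> U)}"
  have "continuous_on {0..s} (pt 0)"
    unfolding pt_def by (intro continuous_intros)
  then have "compact (pt 0 ` {0..s})" by (intro compact_continuous_image) auto
  moreover have "pt 0 ` {0..s} \<subseteq> \<Union>\<G>"
  proof
    fix z assume "z \<in> pt 0 ` {0..s}"
    then have "z \<in> \<Union>\<U>" using assms by (auto simp: open_covering_def)
    then obtain U where "U \<in> \<U>" "z \<in> U" by blast
    moreover have "openin wave_topology U"
      using assms(1) \<open>U \<in> \<U>\<close> by (simp add: open_covering_def)
    ultimately show "z \<in> \<Union>\<G>" unfolding \<G>_def openin_open by blast
  qed
  ultimately obtain e where e: "e > 0" "\<And>x. x \<in> pt 0 ` {0..s} \<Longrightarrow> \<exists>G\<in>\<G>. ball x e \<subseteq> G"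
    by (rule Heine_Borel_lemma) (auto simp: \<G>_def)
  have "\<exists>U\<in>\<U>. ball (pt 0 y) (min e 1) \<inter> wave_space \<subseteq> U" if "0 \<le> y" "y \<le> s" for y
  proof -
    obtain G where G: "G \<in> \<G>" "ball (pt 0 y) e \<subseteq> G" using e(2)[of "pt 0 y"] \<open>0 \<le> y\<close> \<open>y \<le> s\<close> by auto
    moreover have "ball (pt 0 y) (min e 1) \<subseteq> ball (pt 0 y) e" by (rule subset_ball) simp
    ultimately show ?thesis unfolding \<G>_def by blast
  qed
  then show ?thesis using e(1) by (intro exI[of _ "min e 1"]) auto
qed

text \<open>The supremum of all admissible radii up to height s is automatically antitone in s.
  Capping radii by 1 keeps it finite. The factor 1/4 puts 2 * r s below some admissible radius,
  which absorbs a deviation of r s in each of the two coordinates.\<close>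

lemma limit_scale_exists:
  assumes \<U>: "open_covering wave_topology \<U>"
  obtains r k where "limit_scale r k"
    "\<And>s. 0 < s \<Longrightarrow> s < 1/2 \<Longrightarrow> \<exists>U\<in>\<U>. limit_nbhd (r s) (k s) s \<subseteq> U"
proof -
  define ok where "ok = (\<lambda>s. {\<delta>. \<delta> \<le> 1 \<and> (\<forall>y. 0 \<le> y \<and> y \<le> s \<longrightarrow> (\<exists>U\<in>\<U>. ball (pt 0 y) \<delta> \<inter> wave_space \<subseteq> U))})"
  define r where "r = (\<lambda>s. Sup (ok s) / 4)"
  \<comment> \<open>Chosen to give exp (1 - 2 * k s) \<le> r s: the cutoff in the first coordinate
    is at most the thickness.\<close>
  define k where "k = (\<lambda>s. \<lceil>- ln (r s)\<rceil> + 1)"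
  have bdd: "bdd_above (ok s)" for s by (auto simp: ok_def bdd_above_def)
  have ne: "\<exists>\<delta>\<in>ok s. 0 < \<delta>" if "0 < s" "s < 1/2" for s
    using small_neighbourhoods[OF \<U>, of s] that by (auto simp: ok_def)
  have r_pos: "0 < r s" if "0 < s" "s < 1/2" for s
  proof -
    obtain \<delta> where "\<delta> \<in> ok s" "0 < \<delta>" using ne[OF \<open>0 < s\<close> \<open>s < 1/2\<close>] by blast
    then have "\<delta> \<le> Sup (ok s)" by (intro cSup_upper bdd)
    then show ?thesis using \<open>0 < \<delta>\<close> by (simp add: r_def)
  qed
  have r_le: "r s \<le> 1/4" if "0 < s" "s < 1/2" for s
  proof -
    have "Sup (ok s) \<le> 1" using ne[OF that] by (intro cSup_least) (auto simp: ok_def)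
    then show ?thesis by (simp add: r_def)
  qed
  have r_anti: "r t \<le> r s" if "0 < s" "s \<le> t" "t < 1/2" for s t
  proof -
    have "ok t \<subseteq> ok s" using that by (auto simp: ok_def)
    then have "Sup (ok t) \<le> Sup (ok s)" using ne[of t] that by (intro cSup_subset_mono bdd) auto
    then show ?thesis by (simp add: r_def)
  qed
  have "limit_scale r k"
  proof
    fix s t :: real assume st: "0 < s" "s \<le> t" "t < 1/2"
    then have "ln (r t) \<le> ln (r s)" using r_anti[OF st] r_pos[of t] r_pos[of s] by simp
    then show "k s \<le> k t" by (simp add: k_def ceiling_mono)
  qed (use r_pos r_anti in auto)
  moreover have "\<exists>U\<in>\<U>. limit_nbhd (r s) (k s) s \<subseteq> U" if s: "0 < s" "s < 1/2" for s
  proof -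
    have "2 * r s < Sup (ok s)" using r_pos[OF s] by (simp add: r_def)
    moreover have "ok s \<noteq> {}" using ne[OF s] by blast
    ultimately obtain \<delta> where \<delta>: "\<delta> \<in> ok s" "2 * r s < \<delta>"
      using less_cSupD by metis
    then have "\<exists>U\<in>\<U>. ball (pt 0 s) \<delta> \<inter> wave_space \<subseteq> U"
      using s by (simp add: ok_def)
    then obtain U where U: "U \<in> \<U>" "ball (pt 0 s) \<delta> \<inter> wave_space \<subseteq> U" by blast
    have "ln (r s) < 0" using r_pos[OF s] r_le[OF s] by simp
    then have "k s \<ge> 1" "- ln (r s) \<le> k s" by (simp_all add: k_def) linarith+
    then have "1 - 2 * real_of_int (k s) \<le> ln (r s)" by linarith
    then have e: "exp (1 - 2 * real_of_int (k s)) \<le> r s"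
      using r_pos[OF s] by (simp add: ln_ge_iff)
    have "z \<in> ball (pt 0 s) \<delta> \<inter> wave_space" if z: "z \<in> limit_nbhd (r s) (k s) s" for z
    proof -
      have "z \<in> wave_space" "z$1 < r s" "\<bar>z$2 - s\<bar> < r s"
        using z e by (auto simp: limit_nbhd_def)
      moreover have "0 \<le> z$1" using \<open>z \<in> wave_space\<close> by (auto simp: wave_space_def)
      moreover have "norm (z - pt 0 s) \<le> (\<Sum>i\<in>UNIV. \<bar>(z - pt 0 s)$i\<bar>)" by (rule norm_le_l1_cart)
      then have "norm (z - pt 0 s) \<le> \<bar>z$1\<bar> + \<bar>z$2 - s\<bar>" by (simp add: sum_2)
      ultimately show ?thesis using \<delta>(2) by (auto simp: dist_norm norm_minus_commute)
    qed
    then show ?thesis using U by blast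
  qed
  ultimately show ?thesis by (rule that)
qed

lemma arc_at:
  assumes \<U>: "open_covering wave_topology \<U>" and u: "a < u" "u < b"
  obtains p q where "a \<le> p" "p < u" "u < q" "q \<le> b" "\<exists>U\<in>\<U>. curve ` {p<..<q} \<subseteq> U"
proof -
  have "curve u \<in> \<Union>\<U>" using \<U> by (simp add: open_covering_def)
  then obtain U where U: "U \<in> \<U>" "curve u \<in> U" by blast
  then have "openin wave_topology U" using \<U> by (auto simp: open_covering_def)
  then obtain G where G: "open G" "U = wave_space \<inter> G" by (auto simp: openin_open)
  have "open (curve -` G)" using G(1) continuous_curve[of UNIV] by (simp add: continuous_on_open_vimage)
  then obtain e where e: "e > 0" "ball u e \<subseteq> curve -` G"
    using U(2) G(2) by (meson IntD2 open_contains_ball vimageI2)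
  show ?thesis
  proof
    show "\<exists>U\<in>\<U>. curve ` {max a (u - e)<..<min b (u + e)} \<subseteq> U"
    proof (intro bexI[of _ U] subsetI)
      fix z assume "z \<in> curve ` {max a (u - e)<..<min b (u + e)}"
      then obtain v where v: "z = curve v" "u - e < v" "v < u + e" by auto
      then have "v \<in> ball u e" by (simp add: dist_real_def abs_less_iff)
      then show "z \<in> U" using e(2) G(2) v(1) by auto
    qed (rule U)
  qed (use u e in auto)
qed

lemma limit_scale_shift:
  assumes "limit_scale r k"
  shows "limit_scale r (\<lambda>s. max (k s) m)"
proof -
  interpret limit_scale r k by fact
  show ?thesis
    by unfold_locales (use r_pos r_anti k_mono in \<open>auto intro: max.coboundedI1\<close>)
qed

lemma fine_covering:
  assumes \<U>: "open_covering wave_topology \<U>" and rk: "limit_scale r k"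
    and sub: "\<And>s. 0 < s \<Longrightarrow> s < 1/2 \<Longrightarrow> \<exists>U\<in>\<U>. limit_nbhd (r s) (k s) s \<subseteq> U"
  shows "open_covering wave_topology (arc_sets (\<lambda>_ _. True) \<U> \<union> limit_sets r k)"
    and "covering_refines (arc_sets (\<lambda>_ _. True) \<U> \<union> limit_sets r k) \<U>"
proof -
  interpret limit_scale r k by fact
  let ?V = "arc_sets (\<lambda>_ _. True) \<U> \<union> limit_sets r k"
  show "covering_refines ?V \<U>"
    unfolding covering_refines_def arc_sets_def limit_sets_def using sub by auto
  have op: "openin wave_topology V" if "V \<in> ?V" for V
    using that open_arc open_limit_nbhd by (auto simp: arc_sets_def limit_sets_def)
  have "z \<in> \<Union>?V" if "z \<in> wave_space" for z
    using that
  proof (cases rule: wave_space_cases)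
    case (curve u)
    obtain a b where ab: "a < u" "u < b" "\<And>p q. a \<le> p \<Longrightarrow> p < q \<Longrightarrow> q \<le> b \<Longrightarrow> small_arc p q"
    \<comment> \<open>Open arcs in windows around integers miss the half-integers, which therefore
      use the windows of radius 1/4.\<close>
    proof (cases "\<lfloor>u\<rfloor> + 1/2 = u")
      case True
      then show ?thesis using that[of "\<lfloor>u\<rfloor> + 1/4" "\<lfloor>u\<rfloor> + 3/4"] by (auto simp: small_arc_def)
    next
      case False
      show ?thesis
      proof (cases "u < \<lfloor>u\<rfloor> + 1/2")
        case True
        have "real_of_int \<lfloor>u\<rfloor> - 1/2 < u" by linarith
        then show ?thesis using True by (rule that) (auto simp: small_arc_def intro!: exI[of _ "\<lfloor>u\<rfloor>"])
      next
        case False': False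
        have "real_of_int (\<lfloor>u\<rfloor> + 1) - 1/2 < u" "u < real_of_int (\<lfloor>u\<rfloor> + 1) + 1/2" using False False' by linarith+
        then show ?thesis
          by (rule that) (auto simp: small_arc_def intro!: exI[of _ "\<lfloor>u\<rfloor> + 1"])
      qed
    qed
    then obtain p q where pq: "a \<le> p" "p < u" "u < q" "q \<le> b" "\<exists>U\<in>\<U>. curve ` {p<..<q} \<subseteq> U"
      using arc_at[OF \<U>] by metis
    then have "curve ` {p<..<q} \<in> arc_sets (\<lambda>_ _. True) \<U>"
      using ab(3)[of p q] unfolding arc_sets_def by auto
    then show ?thesis using pq curve by (intro UnionI[of "curve ` {p<..<q}"]) auto
  next
    case (limit y)
    \<comment> \<open>The thickness at t < 1/2 is a lower bound for the thickness at all lower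
      heights; s is then taken above y by less than r t.\<close>
    define t where "t = (y + 1/2) / 2"
    have t: "0 < t" "t < 1/2" "y < t" using limit by (auto simp: t_def)
    define s where "s = min t (y + r t / 2)"
    have "0 < r t" using r_pos t by simp
    then have s: "0 < s" "s < 1/2" "y < s" "s \<le> t" "s < y + r t" using t limit by (auto simp: s_def min_def)
    then have "r t \<le> r s" using t by (intro r_anti) auto
    then have "z \<in> limit_nbhd (r s) (k s) s"
      using s limit by (auto simp: limit_in_limit_nbhd)
    then show ?thesis using s by (auto simp: limit_sets_def)
  qed
  then show "open_covering wave_topology ?V"
    using op openin_imp_subset unfolding open_covering_def by (fastforce simp: openin_imp_subset)
qed

section \<open>Fine coverings in degrees two and higher\<close>

lemma higher_acyclic_arcs: "\<V> \<subseteq> arc_sets P \<U> \<Longrightarrow> higher_acyclic (nerve \<V>)"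
proof (rule higher_acyclic_nerve_intervals[OF inj_curve])
  have "arc_sets P \<U> \<subseteq> {curve ` {p<..<q} | p q. p < q}"
    unfolding arc_sets_def small_arc_def by blast
  then show "\<V> \<subseteq> {curve ` {p<..<q} | p q. p < q}" if "\<V> \<subseteq> arc_sets P \<U>"
    using that by blast
qed

lemma higher_acyclic_arcs_limits:
  assumes rk: "limit_scale r k"
    and P: "\<And>p q. P p q \<Longrightarrow> \<exists>i::int. 2 * of_int i - 3/4 \<le> p \<and> q \<le> 2 * of_int i + 3/4"
  shows "higher_acyclic (nerve (arc_sets P \<U> \<union> limit_sets r k))"
proof -
  interpret limit_scale r k by fact
  define I where "I = {Arc i p q | i p q. P p q \<and> small_arc p q \<and> (\<exists>U\<in>\<U>. curve ` {p<..<q} \<subseteq> U) \<and>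
    2 * of_int i - 3/4 \<le> p \<and> q \<le> 2 * of_int i + 3/4} \<union> Limit ` {0<..<1/2}"
  have "basic_set ` I = arc_sets P \<U> \<union> limit_sets r k"
  proof (intro equalityI subsetI)
    fix V assume "V \<in> arc_sets P \<U> \<union> limit_sets r k"
    then consider p q where "V = curve ` {p<..<q}" "P p q" "small_arc p q" "\<exists>U\<in>\<U>. curve ` {p<..<q} \<subseteq> U"
      | s where "V = limit_nbhd (r s) (k s) s" "s \<in> {0<..<1/2}"
      unfolding arc_sets_def limit_sets_def by blast
    then show "V \<in> basic_set ` I"
    proof cases
      case 1
      then obtain i :: int where "2 * of_int i - 3/4 \<le> p \<and> q \<le> 2 * of_int i + 3/4" using P by blast
      then have "Arc i p q \<in> I" using 1 by (auto simp: I_def)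
      then show ?thesis using 1(1) by (intro image_eqI[of _ _ "Arc i p q"]) auto
    next
      case 2
      then have "Limit s \<in> I" by (auto simp: I_def)
      then show ?thesis using 2(1) by (intro image_eqI[of _ _ "Limit s"]) auto
    qed
  qed (auto simp: I_def arc_sets_def limit_sets_def)
  moreover have "higher_acyclic (nerve (basic_set ` I))"
    by (rule higher_acyclic_hump) (auto simp: I_def small_arc_def)
  ultimately show ?thesis by simp
qed

lemma nerve_Un:
  assumes "\<And>V W. V \<in> F - G \<Longrightarrow> W \<in> G - F \<Longrightarrow> V \<inter> W = {}"
  shows "nerve (F \<union> G) = nerve F \<union> nerve G"
proof
  show "nerve (F \<union> G) \<subseteq> nerve F \<union> nerve G"
  proof
    fix \<sigma> assume \<sigma>: "\<sigma> \<in> nerve (F \<union> G)"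
    have "\<sigma> \<subseteq> F \<or> \<sigma> \<subseteq> G"
    proof (rule ccontr)
      assume "\<not> (\<sigma> \<subseteq> F \<or> \<sigma> \<subseteq> G)"
      then obtain V W where "V \<in> \<sigma>" "W \<in> \<sigma>" "V \<notin> G" "W \<notin> F" by blast
      moreover have "\<sigma> \<subseteq> F \<union> G" "\<Inter>\<sigma> \<noteq> {}" using \<sigma> by (auto simp: nerve_def)
      ultimately show False using assms[of V W] by blast
    qed
    then show "\<sigma> \<in> nerve F \<union> nerve G" using \<sigma> by (auto simp: nerve_def)
  qed
  show "nerve F \<union> nerve G \<subseteq> nerve (F \<union> G)"
    using nerve_mono[of F "F \<union> G"] nerve_mono[of G "F \<union> G"] by blast
qed

lemma nerve_Int: "nerve (F \<inter> G) = nerve F \<inter> nerve G"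
  by (auto simp: nerve_def)

text \<open>The curve is injective, so an arc determines its end points and conditions on them do
  not depend on the presentation.\<close>

lemma arc_sets_eq_mem:
  assumes "curve ` {p<..<q} \<in> arc_sets P \<U>" "p < q"
  shows "P p q" "small_arc p q"
proof -
  obtain p' q' where *: "curve ` {p<..<q} = curve ` {p'<..<q'}" "P p' q'" "small_arc p' q'"
    using assms(1) by (auto simp: arc_sets_def)
  then have "{p<..<q} = {p'<..<q'}" using inj_image_eq_iff[OF inj_curve] by blast
  then have "p = p'" "q = q'" using assms(2) *(3) by (auto simp: greaterThanLessThan_eq_iff small_arc_def)
  then show "P p q" "small_arc p q" using * by auto
qed

lemma arc_limit_disjoint:
  assumes "0 < s" "s < 1/2" "\<And>u i. p < u \<Longrightarrow> u < q \<Longrightarrow> k \<le> i \<Longrightarrow> 1/2 \<le> \<bar>u - 2 * of_int i\<bar>"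
  shows "curve ` {p<..<q} \<inter> limit_nbhd r k s = {}"
proof (rule ccontr)
  assume "curve ` {p<..<q} \<inter> limit_nbhd r k s \<noteq> {}"
  then obtain u where "p < u" "u < q" "curve u \<in> limit_nbhd r k s" by auto
  then show False using assms curve_in_limit_nbhd[of s u r k] by fastforce
qed

lemma arc_disjoint: "q \<le> p' \<or> q' \<le> p \<Longrightarrow> curve ` {p<..<q} \<inter> curve ` {p'<..<q'} = {}"
  using image_Int[OF inj_curve, of "{p<..<q}" "{p'<..<q'}"] by auto

text \<open>
  Mayer--Vietoris for the parts of the space near the limit arc (parameters around even integers) and
  far from it: all sets in the overlap are arcs, so its nerve is acyclic in positive dimensions. This says
  nothing in dimension 1, since the overlap has infinitely many components.
\<close>

lemma aug_acyclic_fine: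
  assumes rk: "limit_scale r k" and n: "n \<ge> 3"
  shows "aug_acyclic n (nerve (arc_sets (\<lambda>_ _. True) \<U> \<union> limit_sets r k))"
proof -
  define S where "S = (\<lambda>(p :: real) (q :: real). \<exists>i::int. 2 * of_int i + 1/4 \<le> p \<and> q \<le> 2 * of_int i + 7/4)"
  define B where "B = (\<lambda>(p :: real) (q :: real). \<exists>i::int. 2 * of_int i - 3/4 \<le> p \<and> q \<le> 2 * of_int i + 3/4)"
  let ?F = "arc_sets S \<U>"
  let ?G = "arc_sets B \<U> \<union> limit_sets r k"
  \<comment> \<open>Such an arc comes from a window around an odd integer; it misses the limit sets,
    whose points on the curve lie within 1/2 of even integers.\<close>
  have not_B: "\<exists>i::int. 2 * of_int i + 1/2 \<le> p \<and> q \<le> 2 * of_int i + 3/2"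
    if "small_arc p q" "\<not> B p q" for p q
  proof -
    obtain j :: int where j: "of_int j - 1/2 \<le> p \<and> q \<le> of_int j + 1/2 \<or> of_int j + 1/4 \<le> p \<and> q \<le> of_int j + 3/4"
      using \<open>small_arc p q\<close> by (auto simp: small_arc_def)
    show ?thesis
    proof (cases "even j")
      case True
      then obtain i where "j = 2 * i" by blast
      then have "B p q" using j unfolding B_def by (intro exI[of _ i]) auto
      then show ?thesis using that by blast
    next
      case False
      then obtain i where i: "j = 2 * i + 1" by (rule oddE)
      have "\<not> (2 * of_int (i + 1) - 3/4 \<le> p \<and> q \<le> 2 * of_int (i + 1) + 3/4)"
        using that(2) unfolding B_def by blast
      then show ?thesis using j i by (intro exI[of _ i]) auto
    qed
  qed
  have not_S: "\<exists>i::int. 2 * of_int i - 1/2 \<le> p \<and> q \<le> 2 * of_int i + 1/2"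
    if "small_arc p q" "\<not> S p q" for p q
  proof -
    obtain j :: int where j: "of_int j - 1/2 \<le> p \<and> q \<le> of_int j + 1/2 \<or> of_int j + 1/4 \<le> p \<and> q \<le> of_int j + 3/4"
      using \<open>small_arc p q\<close> by (auto simp: small_arc_def)
    show ?thesis
    proof (cases "even j")
      case True
      then obtain i where i: "j = 2 * i" by blast
      have "\<not> (2 * of_int i + 1/4 \<le> p \<and> q \<le> 2 * of_int i + 7/4)"
        using that(2) unfolding S_def by blast
      then show ?thesis using j i by (intro exI[of _ i]) auto
    next
      case False
      then obtain i where "j = 2 * i + 1" by (rule oddE)
      then have "S p q" using j unfolding S_def by (intro exI[of _ i]) auto
      then show ?thesis using that by blast
    qed
  qed
  have eq: "arc_sets (\<lambda>_ _. True) \<U> \<union> limit_sets r k = ?F \<union> ?G"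
  proof -
    have "S p q" if small: "small_arc p q" "\<not> B p q" for p q
    proof -
      obtain i :: int where "2 * of_int i + 1/2 \<le> p" "q \<le> 2 * of_int i + 3/2" using not_B[OF small] by blast
      then show ?thesis unfolding S_def by (intro exI[of _ i]) auto
    qed
    then show ?thesis unfolding arc_sets_def by blast
  qed
  have "nerve (?F \<union> ?G) = nerve ?F \<union> nerve ?G"
  proof (rule nerve_Un)
    fix V W assume V: "V \<in> ?F - ?G" and W: "W \<in> ?G - ?F"
    obtain p q where pq: "V = curve ` {p<..<q}" "small_arc p q" "\<not> B p q"
      using V unfolding arc_sets_def by blast
    then obtain i :: int where i: "2 * of_int i + 1/2 \<le> p" "q \<le> 2 * of_int i + 3/2" using not_B by blast
    consider p' q' where "W = curve ` {p'<..<q'}" "small_arc p' q'" "\<not> S p' q'"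
      | s where "W = limit_nbhd (r s) (k s) s" "0 < s" "s < 1/2"
    proof (cases "W \<in> limit_sets r k")
      case True
      then show ?thesis using that(2) by (auto simp: limit_sets_def)
    next
      case False
      then obtain p' q' where "W = curve ` {p'<..<q'}" "small_arc p' q'" "\<exists>U\<in>\<U>. curve ` {p'<..<q'} \<subseteq> U"
        using W unfolding arc_sets_def by blast
      moreover from this have "\<not> S p' q'" using W unfolding arc_sets_def by blast
      ultimately show ?thesis using that(1) by blast
    qed
    then show "V \<inter> W = {}"
    proof cases
      case 1
      then obtain j :: int where j: "2 * of_int j - 1/2 \<le> p'" "q' \<le> 2 * of_int j + 1/2" using not_S by blast
      have "q \<le> p' \<or> q' \<le> p"
      proof (cases "j \<le> i")
        case True
        then have "real_of_int j \<le> of_int i" by simp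
        then show ?thesis using i j by linarith
      next
        case False
        then have "real_of_int i + 1 \<le> of_int j" by linarith
        then show ?thesis using i j by linarith
      qed
      then show ?thesis using pq 1 arc_disjoint by blast
    next
      case 2
      have "1/2 \<le> \<bar>u - 2 * of_int j\<bar>" if "p < u" "u < q" for u and j :: int
      proof (cases "j \<le> i")
        case True
        then have "real_of_int j \<le> of_int i" by simp
        then show ?thesis using i that by linarith
      next
        case False
        then have "real_of_int i + 1 \<le> of_int j" by linarith
        then show ?thesis using i that by linarith
      qed
      then show ?thesis unfolding pq(1) 2(1) using 2 by (intro arc_limit_disjoint) auto
    qed
  qed
  moreover obtain m where m: "n = Suc m" "m \<ge> 2" using n by (cases n) auto
  moreover have "higher_acyclic (nerve ?F)" "higher_acyclic (nerve (?F \<inter> ?G))"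
    by (rule higher_acyclic_arcs; blast)+
  moreover have "higher_acyclic (nerve ?G)"
    using rk by (rule higher_acyclic_arcs_limits) (auto simp: B_def)
  ultimately show ?thesis
    unfolding eq m(1) nerve_Int higher_acyclic_def
    by (auto intro!: aug_acyclic_Un subset_closed_nerve)
qed

section \<open>First homology of fine coverings\<close>

lemma aug_acyclic_leg:
  fixes m :: int
  assumes \<U>: "open_covering wave_topology \<U>"
  shows "aug_acyclic 1 (nerve (arc_sets (\<lambda>p q. of_int m + 1/4 \<le> p \<and> q \<le> of_int m + 3/4) \<U>))"
proof -
  let ?V = "arc_sets (\<lambda>p q. of_int m + 1/4 \<le> p \<and> q \<le> of_int m + 3/4) \<U>"
  have un: "\<Union>?V = curve ` {of_int m + 1/4<..<of_int m + 3/4}"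
  proof (intro equalityI subsetI)
    fix z assume "z \<in> curve ` {of_int m + 1/4<..<of_int m + 3/4}"
    then obtain u where u: "z = curve u" "of_int m + 1/4 < u" "u < of_int m + 3/4" by auto
    then obtain p q where pq: "of_int m + 1/4 \<le> p" "p < u" "u < q" "q \<le> of_int m + 3/4" "\<exists>U\<in>\<U>. curve ` {p<..<q} \<subseteq> U"
      using arc_at[OF \<U>] by metis
    then have "small_arc p q" unfolding small_arc_def by (intro conjI exI[of _ m]) auto
    then have "curve ` {p<..<q} \<in> ?V" unfolding arc_sets_def using pq by blast
    then show "z \<in> \<Union>?V" using u pq by (intro UnionI[of "curve ` {p<..<q}"]) auto
  next
    fix z assume "z \<in> \<Union>?V"
    then obtain p q where "z \<in> curve ` {p<..<q}" "of_int m + 1/4 \<le> p" "q \<le> of_int m + 3/4"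
      unfolding arc_sets_def by blast
    then show "z \<in> curve ` {of_int m + 1/4<..<of_int m + 3/4}" by auto
  qed
  \<comment> \<open>Connectedness of the leg lets the 0-cycle in which a 1-cycle is cut bound among
    the arcs shared by both sides.\<close>
  have "connected (\<Union>?V)"
    unfolding un by (intro connected_continuous_image continuous_curve) simp
  moreover have "openin (top_of_set (\<Union>?V)) V" if "V \<in> ?V" for V
  proof -
    have "openin wave_topology V" using that open_arc by (auto simp: arc_sets_def)
    moreover have "V \<subseteq> \<Union>?V" using that by blast
    moreover have "\<Union>?V \<subseteq> wave_space" unfolding un by auto
    ultimately show ?thesis by (rule openin_subset_trans)
  qed
  ultimately show ?thesis
    by (intro aug_acyclic_1 nerve_vertices_joined) (auto simp: nerve_def)
qed

text \<open>
  The cycle \<open>c'\<close> is cut at parameter \<open>2 * m + 1/2\<close>, where the finer limit sets do not reach, and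
  its lower part bounds. Hence \<open>c\<close>, which lies below the cut, is homologous to a cycle above it, and it
  bounds because the lower and upper parts (with all limit sets added to both) have an acyclic intersection.
\<close>

lemma fine_cycle_bounds:
  fixes m :: int
  assumes \<U>: "open_covering wave_topology \<U>" and rk: "limit_scale r k"
    and c: "c \<in> aug_chains 2 (nerve (arc_sets (\<lambda>p q. q \<le> 2 * of_int m + 3/4) \<U> \<union> limit_sets r k))" "aug_bd c = 0"
    and k': "\<And>s. k' s = max (k s) (m + 1)"
    and \<phi>: "refinement_projection (limit_sets r k') (limit_sets r k) \<phi>" "\<And>W. W \<notin> limit_sets r k' \<Longrightarrow> \<phi> W = W"
    and c': "c' \<in> aug_chains 2 (nerve (arc_sets (\<lambda>_ _. True) \<U> \<union> limit_sets r k'))" "aug_bd c' = 0"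
    and d: "d \<in> aug_chains 3 (nerve (arc_sets (\<lambda>_ _. True) \<U> \<union> limit_sets r k))"
      "aug_bd d = c - simplicial_chain_map \<phi> c'"
  shows "\<exists>e\<in>aug_chains 3 (nerve (arc_sets (\<lambda>_ _. True) \<U> \<union> limit_sets r k)). aug_bd e = c"
proof -
  let ?lo = "arc_sets (\<lambda>p q. q \<le> 2 * of_int m + 3/4) \<U>"
  let ?hi = "arc_sets (\<lambda>p q. 2 * of_int m + 1/4 \<le> p) \<U>"
  let ?leg = "arc_sets (\<lambda>p q. 2 * of_int m + 1/4 \<le> p \<and> q \<le> 2 * of_int m + 3/4) \<U>"
  let ?L = "limit_sets r k" and ?L' = "limit_sets r k'"
  have arcs: "arc_sets (\<lambda>_ _. True) \<U> = ?lo \<union> ?hi"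
  proof -
    have "q \<le> 2 * of_int m + 3/4 \<or> 2 * of_int m + 1/4 \<le> p" if small: "small_arc p q" for p q
    proof (rule ccontr)
      assume *: "\<not> ?thesis"
      obtain j :: int where j: "of_int j - 1/2 \<le> p \<and> q \<le> of_int j + 1/2 \<or> of_int j + 1/4 \<le> p \<and> q \<le> of_int j + 3/4"
        using small by (auto simp: small_arc_def)
      \<comment> \<open>The number of its window would lie strictly between the consecutive integers
        2 * m and 2 * m + 1.\<close>
      then have "real_of_int j < of_int (2 * m + 1)" "real_of_int (2 * m) < of_int j" using * by auto
      then have "j < 2 * m + 1" "2 * m < j" by (simp_all only: of_int_less_iff)
      then show False by simp
    qed
    then show ?thesis unfolding arc_sets_def by blast
  qed
  have leg: "?lo \<inter> ?hi = ?leg"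
  proof (intro equalityI subsetI)
    fix V assume V: "V \<in> ?lo \<inter> ?hi"
    then have "V \<in> ?lo" by blast
    then obtain p q where pq: "V = curve ` {p<..<q}" "q \<le> 2 * of_int m + 3/4" "small_arc p q"
      "\<exists>U\<in>\<U>. curve ` {p<..<q} \<subseteq> U"
      unfolding arc_sets_def by blast
    have "curve ` {p<..<q} \<in> ?hi" "p < q" using V pq by (simp_all add: small_arc_def)
    then have "2 * of_int m + 1/4 \<le> p" by (rule arc_sets_eq_mem(1))
    then show "V \<in> ?leg" using pq unfolding arc_sets_def by blast
  next
    fix V assume "V \<in> ?leg"
    then show "V \<in> ?lo \<inter> ?hi" unfolding arc_sets_def by blast
  qed
  \<comment> \<open>The window around the half-integer 2 * m + 1/2 belongs to both sides; arcs on
    one side only thus come from windows that stop there or before.\<close>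
  have lo_only: "\<exists>p q. V = curve ` {p<..<q} \<and> q \<le> 2 * of_int m + 1/2" if V: "V \<in> ?lo" "V \<notin> ?hi" for V
  proof -
    obtain p q where pq: "V = curve ` {p<..<q}" "small_arc p q" "\<exists>U\<in>\<U>. curve ` {p<..<q} \<subseteq> U"
      using V(1) unfolding arc_sets_def by blast
    moreover from this have "\<not> 2 * of_int m + 1/4 \<le> p"
      using V(2) unfolding arc_sets_def by blast
    ultimately have pq: "V = curve ` {p<..<q}" "small_arc p q" "p < 2 * of_int m + 1/4" by auto
    then obtain j :: int where j: "of_int j - 1/2 \<le> p \<and> q \<le> of_int j + 1/2 \<or> of_int j + 1/4 \<le> p \<and> q \<le> of_int j + 3/4"
      by (auto simp: small_arc_def)
    then have "real_of_int j < of_int (2 * m + 1)" using pq(3) by auto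
    then have "j \<le> 2 * m" by linarith
    have "q \<le> 2 * of_int m + 1/2"
      using j
    proof
      assume *: "of_int j + 1/4 \<le> p \<and> q \<le> of_int j + 3/4"
      then have "real_of_int j < of_int (2 * m)" using pq(3) by simp
      then have "j \<le> 2 * m - 1" by linarith
      then have "real_of_int j \<le> 2 * of_int m - 1" by linarith
      then show ?thesis using * by linarith
    next
      assume *: "of_int j - 1/2 \<le> p \<and> q \<le> of_int j + 1/2"
      have "real_of_int j \<le> 2 * of_int m" using \<open>j \<le> 2 * m\<close> by linarith
      then show ?thesis using * by linarith
    qed
    then show ?thesis using pq(1) by blast
  qed
  have hi_only: "\<exists>p q. V = curve ` {p<..<q} \<and> 2 * of_int m + 1/2 \<le> p" if V: "V \<in> ?hi" "V \<notin> ?lo" for V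
  proof -
    obtain p q where pq: "V = curve ` {p<..<q}" "small_arc p q" "\<exists>U\<in>\<U>. curve ` {p<..<q} \<subseteq> U"
      using V(1) unfolding arc_sets_def by blast
    moreover from this have "\<not> q \<le> 2 * of_int m + 3/4"
      using V(2) unfolding arc_sets_def by blast
    ultimately have pq: "V = curve ` {p<..<q}" "small_arc p q" "2 * of_int m + 3/4 < q" by auto
    then obtain j :: int where j: "of_int j - 1/2 \<le> p \<and> q \<le> of_int j + 1/2 \<or> of_int j + 1/4 \<le> p \<and> q \<le> of_int j + 3/4"
      by (auto simp: small_arc_def)
    then have "real_of_int (2 * m) < of_int j" using pq(3) by auto
    then have "2 * m + 1 \<le> j" by linarith
    then have "2 * real_of_int m + 1 \<le> of_int j" by linarith
    then have "2 * of_int m + 1/2 \<le> p" using j by linarith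
    then show ?thesis using pq(1) by blast
  qed
  have "nerve (?lo \<union> (?hi \<union> ?L')) = nerve ?lo \<union> nerve (?hi \<union> ?L')"
  proof (rule nerve_Un)
    fix V W assume V: "V \<in> ?lo - (?hi \<union> ?L')" and W: "W \<in> ?hi \<union> ?L' - ?lo"
    obtain p q where pq: "V = curve ` {p<..<q}" "q \<le> 2 * of_int m + 1/2" using V lo_only by blast
    consider p' q' where "W = curve ` {p'<..<q'}" "2 * of_int m + 1/2 \<le> p'" | s where "W = limit_nbhd (r s) (k' s) s" "0 < s" "s < 1/2"
    proof (cases "W \<in> ?hi")
      case True
      then obtain p' q' where "W = curve ` {p'<..<q'}" "2 * of_int m + 1/2 \<le> p'"
        using W hi_only by blast
      then show ?thesis by (rule that(1))
    next
      case False
      then show ?thesis using W that(2) by (auto simp: limit_sets_def)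
    qed
    then show "V \<inter> W = {}"
    proof cases
      case 1
      then show ?thesis using pq arc_disjoint[of q p' q' p] by auto
    next
      case 2
      \<comment> \<open>The cutoff m + 1 keeps the finer limit sets beyond 2 * m + 3/2 on the
        curve.\<close>
      have "1/2 \<le> \<bar>u - 2 * of_int i\<bar>" if "u < q" "k' s \<le> i" for u i
      proof -
        have "m + 1 \<le> i" using that(2) k'[of s] by simp
        then have "real_of_int m + 1 \<le> of_int i" by linarith
        then show ?thesis using that pq(2) by linarith
      qed
      then show ?thesis unfolding pq(1) 2(1) using 2 by (intro arc_limit_disjoint) auto
    qed
  qed
  then have c'1: "c' \<in> aug_chains (Suc 1) (nerve ?lo \<union> nerve (?hi \<union> ?L'))"
    using c'(1) by (simp add: arcs Un_assoc numeral_2_eq_2)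
  have "?lo \<inter> (?hi \<union> ?L') = ?leg"
  proof -
    \<comment> \<open>A limit set contains points of the axis and an arc does not, so the overlap of
      the two families is exactly the leg.\<close>
    have "V \<notin> ?L'" if "V \<in> ?lo" for V
    proof
      assume "V \<in> ?L'"
      then obtain s where s: "V = limit_nbhd (r s) (k' s) s" "0 < s" "s < 1/2" by (auto simp: limit_sets_def)
      have "0 < r s" using rk s(2,3) by (rule limit_scale.r_pos)
      then have "pt 0 (max (s / 2) (s - r s / 2)) \<in> V"
        unfolding s(1) using s by (subst limit_in_limit_nbhd) auto
      then show False using that by (auto simp: arc_sets_def pt_eq_iff curve_def)
    qed
    then show ?thesis using leg by blast
  qed
  then have "aug_acyclic 1 (nerve ?lo \<inter> nerve (?hi \<union> ?L'))"
    using aug_acyclic_leg[OF \<U>, of "2 * m"] by (simp flip: nerve_Int)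
  then obtain c1 c2 where c12: "c' = c1 + c2" "c1 \<in> aug_chains (Suc 1) (nerve ?lo)" "aug_bd c1 = 0"
    "c2 \<in> aug_chains (Suc 1) (nerve (?hi \<union> ?L'))" "aug_bd c2 = 0"
    using aug_cycle_split[OF subset_closed_nerve subset_closed_nerve c'1 c'(2)] by metis
  \<comment> \<open>The lower part consists of arcs alone, so c1 bounds and only c2 remains.\<close>
  have "higher_acyclic (nerve ?lo)" by (rule higher_acyclic_arcs) blast
  then obtain e where e: "e \<in> aug_chains 3 (nerve ?lo)" "aug_bd e = c1"
    using higher_acyclic_2D[of "nerve ?lo" c1] c12(2,3) by (auto simp: numeral_2_eq_2)
  have proj: "refinement_projection (A \<union> ?L') (A \<union> ?L) \<phi>" "refinement_projection A (A \<union> ?L) \<phi>" for A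
    using \<phi> unfolding refinement_projection_def by (metis Un_iff order_refl)+
  let ?\<phi> = "simplicial_chain_map \<phi>"
  have \<phi>c2: "?\<phi> c2 \<in> aug_chains 2 (nerve (?hi \<union> ?L))"
    using c12(4) refinement_projection_nerve[OF proj(1)] by (intro simplicial_chain_map_chains) (auto simp: numeral_2_eq_2)
  have \<phi>e: "?\<phi> e \<in> aug_chains 3 (nerve (?lo \<union> ?L))"
    using e(1) refinement_projection_nerve[OF proj(2)] by (intro simplicial_chain_map_chains) auto
  have split: "nerve ((?lo \<union> ?L) \<union> (?hi \<union> ?L)) = nerve (?lo \<union> ?L) \<union> nerve (?hi \<union> ?L)"
  proof (rule nerve_Un)
    fix V W assume V: "V \<in> (?lo \<union> ?L) - (?hi \<union> ?L)" and W: "W \<in> (?hi \<union> ?L) - (?lo \<union> ?L)"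
    obtain p q where pq: "V = curve ` {p<..<q}" "q \<le> 2 * of_int m + 1/2" using V lo_only by blast
    obtain p' q' where "W = curve ` {p'<..<q'}" "2 * of_int m + 1/2 \<le> p'" using W hi_only by blast
    then show "V \<inter> W = {}" using pq arc_disjoint[of q p' q' p] by auto
  qed
  have all: "arc_sets (\<lambda>_ _. True) \<U> \<union> ?L = (?lo \<union> ?L) \<union> (?hi \<union> ?L)" using arcs by blast
  \<comment> \<open>Adding the image of e cancels that of c1: the new boundary is c minus the image
    of c2, which up to limit sets lie below and above the cut.\<close>
  have "d + ?\<phi> e \<in> aug_chains 3 (nerve (?lo \<union> ?L) \<union> nerve (?hi \<union> ?L))"
    using d(1) \<phi>e unfolding all split by (auto intro!: aug_chains_add intro: aug_chains_mono)
  then obtain w1 w2 where w: "d + ?\<phi> e = w1 + w2" "w1 \<in> aug_chains 3 (nerve (?lo \<union> ?L))" "w2 \<in> aug_chains 3 (nerve (?hi \<union> ?L))"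
    by (rule aug_chains_split)
  have "aug_bd (w1 + w2) = c - ?\<phi> c2"
    unfolding w(1)[symmetric] using d(2) e(2) c12(1) by (simp add: aug_bd_simplicial_chain_map)
  then have eq: "c - aug_bd w1 = ?\<phi> c2 + aug_bd w2" by (simp add: algebra_simps)
  \<comment> \<open>One side of \<open>eq\<close> uses lower arcs and limit sets, the other upper
    arcs and limit sets. The cycle thus lives in the overlap, where it bounds by the removal
    argument; its filling plus w1 has boundary c.\<close>
  have "c - aug_bd w1 \<in> aug_chains 2 (nerve (?lo \<union> ?L) \<inter> nerve (?hi \<union> ?L))"
  proof (rule aug_chains_Int)
    show "c - aug_bd w1 \<in> aug_chains 2 (nerve (?lo \<union> ?L))"
      using c(1) w(2) by (intro aug_chains_diff aug_bd_chains subset_closed_nerve) (auto simp: numeral_3_eq_3 numeral_2_eq_2)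
    show "c - aug_bd w1 \<in> aug_chains 2 (nerve (?hi \<union> ?L))"
      unfolding eq using \<phi>c2 w(3) by (intro aug_chains_add aug_bd_chains subset_closed_nerve) (auto simp: numeral_3_eq_3 numeral_2_eq_2)
  qed
  moreover have "(?lo \<union> ?L) \<inter> (?hi \<union> ?L) = ?leg \<union> ?L" using leg by blast
  moreover have "higher_acyclic (nerve (?leg \<union> ?L))"
    using rk by (rule higher_acyclic_arcs_limits) (auto intro!: exI[of _ m])
  moreover have "aug_bd (c - aug_bd w1) = 0" using c(2) by (simp add: aug_bd_aug_bd)
  ultimately obtain f where f: "f \<in> aug_chains 3 (nerve (?leg \<union> ?L))" "aug_bd f = c - aug_bd w1"
    using higher_acyclic_2D[of "nerve (?leg \<union> ?L)" "c - aug_bd w1"] by (auto simp flip: nerve_Int)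
  have "nerve (?leg \<union> ?L) \<subseteq> nerve (arc_sets (\<lambda>_ _. True) \<U> \<union> ?L)"
    "nerve (?lo \<union> ?L) \<subseteq> nerve (arc_sets (\<lambda>_ _. True) \<U> \<union> ?L)"
    by (rule nerve_mono; unfold arc_sets_def; blast)+
  then have "f + w1 \<in> aug_chains 3 (nerve (arc_sets (\<lambda>_ _. True) \<U> \<union> ?L))"
    using f(1) w(2) by (intro aug_chains_add) (auto intro: aug_chains_mono)
  then show ?thesis using f(2) by (intro bexI[of _ "f + w1"]) auto
qed

text \<open>In degrees at least 2 the homology of the fine covering already vanishes; in degree 1
  the covering is refined depending on the cycle.\<close>

lemma trivial_cech_wave_space:
  assumes "k \<ge> 1"
  shows "trivial_group (cech_homology_group k wave_topology)"
proof (rule trivial_cech_homologyI)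
  fix \<U> assume \<U>: "open_covering wave_topology \<U>"
  obtain r l where rl: "limit_scale r l"
    and sub: "\<And>s. 0 < s \<Longrightarrow> s < 1/2 \<Longrightarrow> \<exists>U\<in>\<U>. limit_nbhd (r s) (l s) s \<subseteq> U"
    using limit_scale_exists[OF \<U>] by blast
  define \<V> where "\<V> = arc_sets (\<lambda>_ _. True) \<U> \<union> limit_sets r l"
  have "\<exists>\<V>' \<phi>. open_covering wave_topology \<V>' \<and> refinement_projection \<V>' \<V> \<phi> \<and>
      (\<forall>c'\<in>simplicial_cycles k (nerve \<V>').
        c - simplicial_chain_map \<phi> c' \<in> simplicial_boundaries k (nerve \<V>) \<longrightarrow>
        c \<in> simplicial_boundaries k (nerve \<V>))"
    if c: "c \<in> simplicial_cycles k (nerve \<V>)" for c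
  proof (cases "k = 1")
    case False
    then have "aug_acyclic (Suc k) (nerve \<V>)"
      using aug_acyclic_fine[OF rl, of "Suc k" \<U>] assms by (simp add: \<V>_def)
    then have "c \<in> simplicial_boundaries k (nerve \<V>)"
      using c assms unfolding aug_acyclic_def nerve_cycles_eq nerve_boundaries_eq by force
    moreover have "refinement_projection \<V> \<V> id" by (simp add: refinement_projection_def)
    moreover have "open_covering wave_topology \<V>" unfolding \<V>_def by (rule fine_covering[OF \<U> rl sub])
    ultimately show ?thesis by blast
  next
    case True
    have c2: "c \<in> aug_chains 2 (nerve \<V>)" "aug_bd c = 0"
      using c True by (auto simp: nerve_cycles_eq numeral_2_eq_2)
    \<comment> \<open>A finite cycle uses finitely many arcs, hence only arcs up to some turn
      m.\<close>
    define lo where "lo = (\<lambda>m::int. arc_sets (\<lambda>p q. q \<le> 2 * of_int m + 3/4) \<U> \<union> limit_sets r l)"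
    have lo_mono: "lo m \<subseteq> lo m'" if "m \<le> m'" for m m'
    proof -
      have "real_of_int m \<le> of_int m'" using that by simp
      then have "q \<le> 2 * of_int m + 3/4 \<Longrightarrow> q \<le> 2 * real_of_int m' + 3/4" for q by linarith
      then show ?thesis unfolding lo_def arc_sets_def by blast
    qed
    have ex: "\<exists>m. V \<in> lo m" if "V \<in> \<V>" for V
    proof (cases "V \<in> limit_sets r l")
      case False
      then obtain p q where pq: "V = curve ` {p<..<q}" "small_arc p q" "\<exists>U\<in>\<U>. curve ` {p<..<q} \<subseteq> U"
        using \<open>V \<in> \<V>\<close> unfolding \<V>_def arc_sets_def by blast
      have "q \<le> 2 * of_int \<lceil>\<bar>q\<bar>\<rceil> + 3/4" by linarith
      then have "V \<in> lo \<lceil>\<bar>q\<bar>\<rceil>" unfolding lo_def arc_sets_def using pq by blast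
      then show ?thesis by blast
    qed (simp add: lo_def)
    have "\<exists>m. F \<subseteq> lo m" if "finite F" "F \<subseteq> \<V>" for F
      using that
    proof (induction F)
      case (insert V F)
      then obtain m where "F \<subseteq> lo m" by auto
      moreover obtain m' where "V \<in> lo m'" using ex[of V] insert.prems by auto
      ultimately have "insert V F \<subseteq> lo (max m m')"
        using lo_mono[of m "max m m'"] lo_mono[of m' "max m m'"] by auto
      then show ?case by blast
    qed simp
    moreover have "finite (\<Union>(set ` Poly_Mapping.keys c))" "\<Union>(set ` Poly_Mapping.keys c) \<subseteq> \<V>"
      using c2(1) by (auto simp: aug_chains_def nerve_def)
    ultimately obtain m where m: "\<Union>(set ` Poly_Mapping.keys c) \<subseteq> lo m" by blast
    have clo: "c \<in> aug_chains 2 (nerve (lo m))"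
    proof (rule aug_chainsI)
      fix xs assume xs: "xs \<in> Poly_Mapping.keys c"
      then have "set xs \<subseteq> lo m" using m by blast
      then show "length xs = 2 \<and> set xs \<in> insert {} (nerve (lo m))"
        using c2(1) xs by (auto simp: aug_chains_def nerve_def)
    qed
    define l' where "l' = (\<lambda>s. max (l s) (m + 1))"
    have l': "limit_scale r l'" unfolding l'_def using rl by (rule limit_scale_shift)
    have l'_sub: "limit_nbhd (r s) (l' s) s \<subseteq> limit_nbhd (r s) (l s) s" for s
      by (rule limit_nbhd_mono) (simp add: l'_def)
    \<comment> \<open>Arcs go to themselves and limit sets to larger limit sets; the latter are
      chosen because the map acts on sets and not on the parameters s.\<close>
    define \<phi> where "\<phi> = (\<lambda>W. if W \<in> limit_sets r l' then SOME Z. Z \<in> limit_sets r l \<and> W \<subseteq> Z else W)"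
    have \<phi>1: "refinement_projection (limit_sets r l') (limit_sets r l) \<phi>"
      unfolding refinement_projection_def
    proof
      fix W assume W: "W \<in> limit_sets r l'"
      then have "\<exists>Z. Z \<in> limit_sets r l \<and> W \<subseteq> Z" using l'_sub unfolding limit_sets_def by blast
      from someI_ex[OF this] show "\<phi> W \<in> limit_sets r l \<and> W \<subseteq> \<phi> W"
        unfolding \<phi>_def using W by simp
    qed
    have \<phi>2: "\<phi> W = W" if "W \<notin> limit_sets r l'" for W using that by (simp add: \<phi>_def)
    define \<V>' where "\<V>' = arc_sets (\<lambda>_ _. True) \<U> \<union> limit_sets r l'"
    have "\<exists>U\<in>\<U>. limit_nbhd (r s) (l' s) s \<subseteq> U" if "0 < s" "s < 1/2" for s
      using sub[OF that] l'_sub by blast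
    then have "open_covering wave_topology \<V>'"
      unfolding \<V>'_def by (rule fine_covering[OF \<U> l'])
    moreover have "refinement_projection \<V>' \<V> \<phi>"
      unfolding refinement_projection_def
    proof
      fix W assume "W \<in> \<V>'"
      then show "\<phi> W \<in> \<V> \<and> W \<subseteq> \<phi> W"
        using \<phi>1 \<phi>2[of W] by (cases "W \<in> limit_sets r l'") (auto simp: refinement_projection_def \<V>_def \<V>'_def)
    qed
    moreover have "c \<in> simplicial_boundaries k (nerve \<V>)"
      if c': "c' \<in> simplicial_cycles k (nerve \<V>')" and b: "c - simplicial_chain_map \<phi> c' \<in> simplicial_boundaries k (nerve \<V>)" for c'
    proof -
      obtain d where d: "d \<in> aug_chains 3 (nerve \<V>)" "aug_bd d = c - simplicial_chain_map \<phi> c'"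
        using b True by (auto simp: nerve_boundaries_eq numeral_3_eq_3)
      have "c' \<in> aug_chains 2 (nerve \<V>')" "aug_bd c' = 0"
        using c' True by (auto simp: nerve_cycles_eq numeral_2_eq_2)
      then have "\<exists>e\<in>aug_chains 3 (nerve \<V>). aug_bd e = c"
        using fine_cycle_bounds[OF \<U> rl clo[unfolded lo_def] c2(2) _ \<phi>1 \<phi>2, of c' d] d
        unfolding \<V>_def \<V>'_def l'_def by blast
      then show ?thesis using True by (auto simp: nerve_boundaries_eq numeral_3_eq_3)
    qed
    ultimately show ?thesis by blast
  qed
  then show "\<exists>\<V>. open_covering wave_topology \<V> \<and> covering_refines \<V> \<U> \<and>
    (\<forall>c\<in>simplicial_cycles k (nerve \<V>). \<exists>\<V>' \<phi>. open_covering wave_topology \<V>' \<and> refinement_projection \<V>' \<V> \<phi> \<and>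
      (\<forall>c'\<in>simplicial_cycles k (nerve \<V>').
        c - simplicial_chain_map \<phi> c' \<in> simplicial_boundaries k (nerve \<V>) \<longrightarrow>
        c \<in> simplicial_boundaries k (nerve \<V>)))"
    using fine_covering[OF \<U> rl sub] unfolding \<V>_def by (intro exI[of _ \<V>]) (auto simp: \<V>_def)
qed

section \<open>A covering without acyclic refinements\<close>

definition near_set :: "(real^2) set" where "near_set = wave_space \<inter> {z. z$2 < 1/2}"
definition far_set :: "(real^2) set" where "far_set = wave_space \<inter> {z. 1/2 < z$2}"
definition leg :: "int \<Rightarrow> (real^2) set" where "leg i = curve ` {of_int i + 1/4<..<of_int i + 3/4}"
text \<open>The near and far sets are disjoint, and the legs are pairwise disjoint arcs around the
  crossings of height 1/2. Every refinement therefore registers on which leg the curve passes from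
  near to far.\<close>

definition coarse_covering :: "(real^2) set set" where "coarse_covering = {near_set, far_set} \<union> range leg"

lemma curve_in_leg: "curve u \<in> leg i \<longleftrightarrow> of_int i + 1/4 < u \<and> u < of_int i + 3/4"
  using inj_image_mem_iff[OF inj_curve] by (simp add: leg_def)

lemma curve_in_near_far: "curve u \<in> near_set \<longleftrightarrow> wave u < 1/2" "curve u \<in> far_set \<longleftrightarrow> 1/2 < wave u"
  by (simp_all add: near_set_def far_set_def)

lemma open_coarse_covering: "open_covering wave_topology coarse_covering"
proof -
  have "openin wave_topology near_set" "openin wave_topology far_set"
    unfolding near_set_def far_set_def
    by (intro openin_open_Int open_Collect_less continuous_intros)+
  moreover have "openin wave_topology (leg i)" for i unfolding leg_def by (rule open_arc)
  moreover have "z \<in> \<Union>coarse_covering" if "z \<in> wave_space" for z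
    using that
  proof (cases rule: wave_space_cases)
    case (curve u)
    obtain i :: int where i: "\<bar>u - 2 * of_int i\<bar> \<le> 1" by (rule near_even)
    consider "wave u < 1/2" | "1/2 < wave u" | "wave u = 1/2" by linarith
    then show ?thesis
    proof cases
      case 3
      then have "u = 2 * of_int i + 1/2 \<or> u = 2 * of_int i - 1/2" using wave_eq[OF i] by linarith
      then have "curve u \<in> leg (2 * i) \<or> curve u \<in> leg (2 * i - 1)" by (auto simp: curve_in_leg)
      then show ?thesis using curve by (auto simp: coarse_covering_def)
    qed (use curve in \<open>auto simp: coarse_covering_def curve_in_near_far\<close>)
  next
    case (limit y)
    then show ?thesis by (auto simp: coarse_covering_def near_set_def)
  qed
  moreover have "\<Union>coarse_covering \<subseteq> wave_space"
    by (auto simp: coarse_covering_def near_set_def far_set_def leg_def)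
  ultimately show ?thesis
    unfolding open_covering_def topspace_euclidean_subtopology
    unfolding coarse_covering_def by blast
qed

text \<open>
  The cocycle \<open>jump\<close> counts signed passages from one leg to the far set. Its value is 1 on a loop that
  follows the curve between two consecutive visits to a neighbourhood of the end of the limit arc.
\<close>

lemma refinement_not_acyclic:
  assumes \<V>: "open_covering wave_topology \<V>" "covering_refines \<V> coarse_covering"
  shows "\<not> has_homology_of_point (\<lambda>k. nerve_homology k \<V>)"
proof
  assume "has_homology_of_point (\<lambda>k. nerve_homology k \<V>)"
  then have "trivial_group (nerve_homology 1 \<V>)" by (simp add: has_homology_of_point_def)
  then have triv: "simplicial_cycles 1 (nerve \<V>) \<subseteq> simplicial_boundaries 1 (nerve \<V>)"
    unfolding nerve_homology_def abstract_complex.trivial_homology_iff[OF abstract_complex_nerve] .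
  obtain \<tau> where \<tau>: "refinement_projection \<V> coarse_covering \<tau>"
    using covering_refines_projection[OF \<V>(2)] .
  have \<tau>_mem: "z \<in> \<tau> V" if "V \<in> \<V>" "z \<in> V" for V z
    using \<tau> that by (auto simp: refinement_projection_def)
  have \<tau>_cases: "\<tau> V = near_set \<or> \<tau> V = far_set \<or> (\<exists>i. \<tau> V = leg i)" if "V \<in> \<V>" for V
    using \<tau> that by (auto simp: refinement_projection_def coarse_covering_def)
  have opV: "openin wave_topology V" if "V \<in> \<V>" for V
    using \<V>(1) that by (auto simp: open_covering_def)
  have cov: "\<exists>V\<in>\<V>. z \<in> V" if "z \<in> wave_space" for z
    using \<V>(1) that by (auto simp: open_covering_def)
  obtain V0 where V0: "V0 \<in> \<V>" "pt 0 0 \<in> V0" using cov[of "pt 0 0"] by auto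
  obtain G where G: "open G" "V0 = wave_space \<inter> G"
    using opV[OF V0(1)] by (auto simp: openin_open)
  \<comment> \<open>The curve returns to height 0 at the even integers, so late returns lie in the
    member \<open>V0\<close> around the origin, and two consecutive ones close up to a loop.\<close>
  have "(\<lambda>n. curve (2 * real n)) \<longlonglongrightarrow> pt 0 0" using curve_tendsto_limit[of 0] by simp
  then have "eventually (\<lambda>n. curve (2 * real n) \<in> G) sequentially"
    using G V0(2) by (intro topological_tendstoD) auto
  then obtain N where N: "\<And>n. n \<ge> N \<Longrightarrow> curve (2 * real n) \<in> G"
    by (auto simp: eventually_sequentially)
  define m where "m = 2 * int N"
  have ends: "curve (of_int m) \<in> V0" "curve (of_int m + 2) \<in> V0"
    using N[of N] N[of "Suc N"] G(2) by (auto simp: m_def algebra_simps)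
  \<comment> \<open>The leg on which the curve rises after m; the descent before m + 2 uses the leg
    of m + 1.\<close>
  define M where "M = leg m"
  have w: "wave u = \<bar>u - of_int m\<bar>" if "\<bar>u - of_int m\<bar> \<le> 1" for u
    using wave_eq[of u "int N"] that by (simp add: m_def)
  have "M \<noteq> far_set"
  proof -
    have "curve (of_int m + 1/2) \<in> M" by (simp add: M_def curve_in_leg)
    moreover have "curve (of_int m + 1/2) \<notin> far_set" using w[of "of_int m + 1/2"] by (simp add: curve_in_near_far)
    ultimately show ?thesis by blast
  qed
  have near_far: "near_set \<inter> far_set = {}" by (auto simp: near_set_def far_set_def)
  have leg_eq: "i = m" if "z \<in> leg i" "z \<in> M" for z i
  proof -
    obtain u where u: "z = curve u" "of_int i + 1/4 < u" "u < of_int i + 3/4"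
      using \<open>z \<in> leg i\<close> by (auto simp: leg_def)
    then have "of_int m + 1/4 < u" "u < of_int m + 3/4" using \<open>z \<in> M\<close> by (simp_all add: M_def curve_in_leg)
    then have "real_of_int i < of_int m + 1" "real_of_int m < of_int i + 1" using u by linarith+
    then show ?thesis by linarith
  qed
  define far where "far = (\<lambda>V. of_bool (\<tau> V = far_set) :: int)"
  define jump where "jump = (\<lambda>V W. of_bool (\<tau> V = M \<and> \<tau> W = far_set) - of_bool (\<tau> V = far_set \<and> \<tau> W = M) :: int)"
  \<comment> \<open>The free group on one generator stands in for the integers, so that
    \<open>frag_extend\<close> evaluates the cochain on chains.\<close>
  define \<Phi> where "\<Phi> = frag_extend (\<lambda>xs. frag_cmul (jump (xs ! 0) (xs ! 1)) (frag_of ()))"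
  have \<Phi>_simps: "\<Phi> (a + b) = \<Phi> a + \<Phi> b" "\<Phi> (a - b) = \<Phi> a - \<Phi> b" "\<Phi> (- a) = - \<Phi> a" "\<Phi> 0 = 0"
    "\<Phi> (frag_of [V, W]) = frag_cmul (jump V W) (frag_of ())" for a b V W
    by (simp_all add: \<Phi>_def frag_extend_add frag_extend_diff frag_extend_minus)
  \<comment> \<open>At a common point in both \<open>M\<close> and the far set, all three labels are
    \<open>M\<close> or \<open>far_set\<close>, and \<open>jump\<close> is the coboundary of
    \<open>far\<close>. At any other common point these two labels do not both occur, so
    \<open>jump\<close> vanishes.\<close>
  have cocycle: "jump b c - jump a c + jump a b = 0" if "{a, b, c} \<in> nerve \<V>" for a b c
  proof -
    have \<V>abc: "a \<in> \<V>" "b \<in> \<V>" "c \<in> \<V>" using that by (auto simp: nerve_def)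
    obtain z where z: "z \<in> a" "z \<in> b" "z \<in> c"
      using \<open>{a, b, c} \<in> nerve \<V>\<close> by (auto simp: nerve_def)
    show ?thesis
    proof (cases "z \<in> M \<and> z \<in> far_set")
      case True
      have "\<tau> V = M \<or> \<tau> V = far_set" if "V \<in> \<V>" "z \<in> V" for V
        using \<tau>_cases[OF that(1)] \<tau>_mem[OF that] True near_far leg_eq[of z] by (auto simp: M_def)
      then have "\<tau> a = M \<or> \<tau> a = far_set" "\<tau> b = M \<or> \<tau> b = far_set" "\<tau> c = M \<or> \<tau> c = far_set"
        using \<V>abc z by blast+
      then show ?thesis using \<open>M \<noteq> far_set\<close> by (auto simp: jump_def)
    next
      case False
      then have "jump V W = 0" if "V \<in> \<V>" "z \<in> V" "W \<in> \<V>" "z \<in> W" for V W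
        using \<tau>_mem[OF that(1,2)] \<tau>_mem[OF that(3,4)] by (auto simp: jump_def)
      then show ?thesis using \<V>abc z by simp
    qed
  qed
  have \<Phi>_bd: "\<Phi> (aug_bd d) = 0" if "d \<in> aug_chains 3 (nerve \<V>)" for d
    using that
  proof (induction rule: aug_chains_induct)
    case (one xs)
    then obtain a b c where xs: "xs = [a, b, c]" by (auto simp: numeral_3_eq_3 length_Suc_conv)
    then have "{a, b, c} \<in> nerve \<V>" using one by auto
    have "\<Phi> (aug_bd (frag_of xs)) = frag_cmul (jump b c - jump a c + jump a b) (frag_of ())"
      by (simp add: xs \<Phi>_simps frag_cmul_distrib frag_cmul_diff_distrib)
    then show ?case using cocycle[OF \<open>{a, b, c} \<in> nerve \<V>\<close>] by simp
  qed (auto simp: \<Phi>_simps)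
  \<comment> \<open>A primitive of \<open>jump\<close> along the curve: the indicator of
    \<open>far_set\<close> before m + 1, and constant 1 afterwards, since \<open>M\<close> is not
    met again. At m + 1 every label is \<open>far_set\<close>, so the formulas agree.\<close>
  define corr where "corr = (\<lambda>(u :: real) V. if u < of_int m + 1 then far V else 1)"
  have local: "jump V W = corr x W - corr x V"
    if x: "of_int m \<le> x" "x \<le> of_int m + 2" and V: "V \<in> \<V>" "curve x \<in> V" and W: "W \<in> \<V>" "curve x \<in> W" for x V W
  proof (cases "x < of_int m + 1")
    case True
    have far_M: "\<tau> V' = M \<or> \<tau> V' = far_set" if far: "curve x \<in> far_set" and V': "V' \<in> \<V>" "curve x \<in> V'" for V'
    proof -
      have "1/2 < x - of_int m" using far w[of x] x True by (simp add: curve_in_near_far)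
      have "i = m" if "curve x \<in> leg i" for i
      proof -
        have "of_int i + 1/4 < x" "x < of_int i + 3/4" using that by (simp_all add: curve_in_leg)
        then have "real_of_int i < of_int m + 1" "real_of_int m < of_int i + 1"
          using \<open>1/2 < x - of_int m\<close> True by linarith+
        then show ?thesis by linarith
      qed
      then show ?thesis
        using \<tau>_cases[OF V'(1)] \<tau>_mem[OF V'] far near_far by (auto simp: M_def)
    qed
    show ?thesis
    proof (cases "curve x \<in> far_set")
      case True
      then show ?thesis using far_M[OF True V] far_M[OF True W] \<open>x < of_int m + 1\<close> \<open>M \<noteq> far_set\<close>
        by (auto simp: jump_def corr_def far_def)
    next
      case False
      then have "\<tau> V \<noteq> far_set" "\<tau> W \<noteq> far_set" using \<tau>_mem[OF V] \<tau>_mem[OF W] by auto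
      then show ?thesis by (simp add: jump_def corr_def far_def)
    qed
  next
    case False
    then have "curve x \<notin> M" by (simp add: M_def curve_in_leg)
    then have "\<tau> V \<noteq> M" "\<tau> W \<noteq> M" using \<tau>_mem[OF V] \<tau>_mem[OF W] by auto
    then show ?thesis using False by (simp add: jump_def corr_def)
  qed
  \<comment> \<open>The joining chain must also have the jump predicted by the primitive, so the
    connectedness argument computes the total jump as well.\<close>
  define R where "R = (\<lambda>x y. \<forall>V\<in>\<V>. \<forall>W\<in>\<V>. curve x \<in> V \<longrightarrow> curve y \<in> W \<longrightarrow>
    (\<exists>e\<in>aug_chains 2 (nerve \<V>). aug_bd e = frag_of [W] - frag_of [V] \<and>
      \<Phi> e = frag_cmul (corr y W - corr x V) (frag_of ())))"
  have R_sym: "R y x" if xy: "R x y" for x y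
    unfolding R_def
  proof (intro ballI impI)
    fix V W assume *: "V \<in> \<V>" "W \<in> \<V>" "curve y \<in> V" "curve x \<in> W"
    then obtain e where "e\<in>aug_chains 2 (nerve \<V>)" "aug_bd e = frag_of [V] - frag_of [W]"
      "\<Phi> e = frag_cmul (corr y V - corr x W) (frag_of ())"
      using xy unfolding R_def by blast
    then show "\<exists>e\<in>aug_chains 2 (nerve \<V>). aug_bd e = frag_of [W] - frag_of [V] \<and>
      \<Phi> e = frag_cmul (corr x W - corr y V) (frag_of ())"
      by (intro bexI[of _ "- e"]) (auto simp: \<Phi>_simps intro: aug_chains_minus)
  qed
  have R_trans: "R x z" if xy: "R x y" and yz: "R y z" for x y z
    unfolding R_def
  proof (intro ballI impI)
    fix V W assume *: "V \<in> \<V>" "W \<in> \<V>" "curve x \<in> V" "curve z \<in> W"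
    obtain U where U: "U \<in> \<V>" "curve y \<in> U" using cov[of "curve y"] by auto
    obtain e where e: "e\<in>aug_chains 2 (nerve \<V>)" "aug_bd e = frag_of [U] - frag_of [V]"
      "\<Phi> e = frag_cmul (corr y U - corr x V) (frag_of ())"
      using xy * U unfolding R_def by blast
    obtain f where f: "f\<in>aug_chains 2 (nerve \<V>)" "aug_bd f = frag_of [W] - frag_of [U]"
      "\<Phi> f = frag_cmul (corr z W - corr y U) (frag_of ())"
      using yz * U unfolding R_def by blast
    have "\<Phi> (e + f) = frag_cmul (corr z W - corr x V) (frag_of ())"
      by (simp add: \<Phi>_simps e f flip: frag_cmul_distrib)
    then show "\<exists>e\<in>aug_chains 2 (nerve \<V>). aug_bd e = frag_of [W] - frag_of [V] \<and>
      \<Phi> e = frag_cmul (corr z W - corr x V) (frag_of ())"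
      using e f by (intro bexI[of _ "e + f"]) (auto intro: aug_chains_add)
  qed
  let ?S = "{of_int m..of_int m + 2 :: real}"
  have "R (of_int m) (of_int m + 2)"
  proof (rule connected_equivalence_relation[of ?S])
    fix a assume a: "a \<in> ?S"
    obtain U where U: "U \<in> \<V>" "curve a \<in> U" using cov[of "curve a"] by auto
    obtain H where H: "open H" "U = wave_space \<inter> H" using opV[OF U(1)] by (auto simp: openin_open)
    \<comment> \<open>This keeps the neighbourhood from crossing m + 1 unless a = m + 1, where both
      formulas for \<open>corr\<close> agree on \<open>U\<close>.\<close>
    define Q where "Q = (if a < of_int m + 1 then {..<of_int m + 1} else if of_int m + 1 < a then {of_int m + 1<..} else (UNIV :: real set))"
    define T where "T = ?S \<inter> (curve -` H \<inter> Q)"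
    have "open (curve -` H)" using H(1) continuous_curve[of UNIV] by (simp add: continuous_on_open_vimage)
    moreover have "open Q" by (simp add: Q_def)
    ultimately have "openin (top_of_set ?S) T" unfolding T_def by (intro openin_open_Int open_Int)
    moreover have "a \<in> T" using a U(2) H(2) by (auto simp: T_def Q_def)
    moreover have "R a x" if x: "x \<in> T" for x
      unfolding R_def
    proof (intro ballI impI)
      fix V W assume V: "V \<in> \<V>" "W \<in> \<V>" "curve a \<in> V" "curve x \<in> W"
      have xU: "curve x \<in> U" and xS: "x \<in> ?S" and xQ: "x \<in> Q" using x H(2) by (auto simp: T_def)
      have "corr x U = corr a U"
      proof (cases "a = of_int m + 1")
        case True
        have "wave a = 1" using w[of a] True by simp
        then have "curve a \<notin> near_set" by (simp add: curve_in_near_far)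
        moreover have "curve a \<notin> leg i" for i
        proof
          assume "curve a \<in> leg i"
          then have "real_of_int i < of_int (m + 1)" "real_of_int (m + 1) < of_int i + 1" using True by (auto simp: curve_in_leg)
          then have "i < m + 1" "m + 1 < i + 1" by linarith+
          then show False by simp
        qed
        ultimately have "\<tau> U = far_set" using \<tau>_cases[OF U(1)] \<tau>_mem[OF U] by auto
        then show ?thesis using True by (simp add: corr_def far_def)
      next
        case False
        then show ?thesis using xQ by (auto simp: corr_def Q_def split: if_splits)
      qed
      then have "jump V U + jump U W = corr x W - corr a V"
        using local[of a V U] local[of x U W] a xS V U xU by simp
      then have "\<Phi> (frag_of [V, U] + frag_of [U, W]) = frag_cmul (corr x W - corr a V) (frag_of ())"
        by (simp add: \<Phi>_simps flip: frag_cmul_distrib)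
      moreover have "{V, U} \<in> nerve \<V>" "{U, W} \<in> nerve \<V>" using V U xU by (auto simp: nerve_def)
      ultimately show "\<exists>e\<in>aug_chains 2 (nerve \<V>). aug_bd e = frag_of [W] - frag_of [V] \<and>
        \<Phi> e = frag_cmul (corr x W - corr a V) (frag_of ())"
        by (intro bexI[of _ "frag_of [V, U] + frag_of [U, W]"]) (auto intro!: aug_chains_add)
    qed
    ultimately show "\<exists>T. openin (top_of_set ?S) T \<and> a \<in> T \<and> (\<forall>x\<in>T. R a x)" by blast
  qed (use R_sym R_trans in \<open>blast | simp\<close>)+
  then obtain e where e: "e \<in> aug_chains 2 (nerve \<V>)" "aug_bd e = 0"
    "\<Phi> e = frag_cmul (corr (of_int m + 2) V0 - corr (of_int m) V0) (frag_of ())"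
    using V0(1) ends unfolding R_def by force
  \<comment> \<open>The primitive ends at 1 by definition and starts at 0 because \<open>V0\<close>
    contains the origin; the loop has total jump 1.\<close>
  have "\<tau> V0 \<noteq> far_set" using \<tau>_mem[OF V0] by (auto simp: far_set_def)
  then have "\<Phi> e = frag_of ()" using e(3) by (simp add: corr_def far_def)
  have "e \<in> simplicial_cycles 1 (nerve \<V>)" using e by (simp add: nerve_cycles_eq numeral_2_eq_2)
  then obtain d where "d \<in> aug_chains 3 (nerve \<V>)" "aug_bd d = e"
    using triv by (auto simp: nerve_boundaries_eq numeral_3_eq_3)
  then have "\<Phi> e = 0" using \<Phi>_bd by blast
  then show False using \<open>\<Phi> e = frag_of ()\<close> by simp
qed

theorem mainTheorem4:
  shows "\<exists>X :: (real^2) set.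
    locally_compact_space (top_of_set X) \<and>
    cech_acyclic (top_of_set X) \<and>
    (\<exists>\<U>. open_covering (top_of_set X) \<U> \<and>
      (\<forall>\<V>. open_covering (top_of_set X) \<V> \<and> covering_refines \<V> \<U> \<longrightarrow>
        \<not> has_homology_of_point (\<lambda>k. nerve_homology k \<V>)))"
proof (intro exI conjI allI impI)
  show "locally_compact_space wave_topology" by (rule locally_compact_wave_space)
  have "wave_space \<noteq> {}" using curve_in_space by blast
  then show "cech_acyclic wave_topology"
    unfolding cech_acyclic_def has_homology_of_point_def
    using cech_homology_0 connected_wave_space trivial_cech_wave_space by blast
  show "open_covering wave_topology coarse_covering" by (rule open_coarse_covering)
  show "\<not> has_homology_of_point (\<lambda>k. nerve_homology k \<V>)"
    if "open_covering wave_topology \<V> \<and> covering_refines \<V> coarse_covering" for \<V>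
    using refinement_not_acyclic that by blast
qed

end
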